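(* A bounded convex domain $D\subset\mathbb C^n$ is visible if and only if $\partial D$ is disc-free and the family $\mathcal F$ of all complex geodesics $\varphi:\mathbb D\to D$ such that $\delta_D(\varphi(0))=\max_{\mathbb D}(\delta_D\circ\varphi)$ is uniformly equicontinuous (with respect to the Euclidean distance).
   Context: Let $\mathbb D\subset\mathbb C$ be the open unit disc and $\tanh^{-1}t=\frac12\log\frac{1+t}{1-t}$. For a domain $D\subset\mathbb C^n$, the Lempert function is $l_D(z,w)=\inf\{\tanh^{-1}|\alpha|:\exists\varphi:\mathbb D\to D\text{ holomorphic with }\varphi(0)=z,\ \varphi(\alpha)=w\}$, and the Kobayashi distance $k_D$ is the largest pseudodistance on $D$ not exceeding $l_D$. Set $\delta_D(z)=\mathrm{dist}(z,\partial D)$ (Euclidean distance). A real geodesic of $D$ is a curve $\psi:[a,b]\to D$ with $k_D(\psi(s),\psi(t))=|s-t|$ for all $s,t\in[a,b]$. A bounded domain $D$ that is complete with respect to $k_D$ (every bounded convex domain is) is called visible if for any $\varepsilon>0$ there is $K\Subset D$ that intersects (the image of) every real geodesic $\psi$ of $D$ with Euclidean diameter $\mathrm{diam}(\psi)>\varepsilon$. A complex geodesic of $D$ is a holomorphic map $\varphi:\mathbb D\to D$ such that $k_{\mathbb D}(\zeta,\eta)=k_D(\varphi(\zeta),\varphi(\eta))$ for all $\zeta,\eta\in\mathbb D$. $\partial D$ is disc-free if any holomorphic map $\mathbb D\to\mathbb C^n$ with image contained in $\partial D$ is constant. *)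

theory Defs
  imports "HOL-Complex_Analysis.Complex_Analysis"
begin

abbreviation unit_disc :: "complex set" where
  "unit_disc \<equiv> ball 0 1"

definition is_domain :: "(complex ^ 'n) set \<Rightarrow> bool" where
  "is_domain D \<longleftrightarrow> open D \<and> connected D \<and> D \<noteq> {}"

text \<open>The library's \<^const>\<open>holomorphic_on\<close> covers scalar-valued functions only.\<close>

definition holomorphic_disc_map :: "(complex \<Rightarrow> complex ^ 'n) \<Rightarrow> bool" where
  "holomorphic_disc_map \<phi> \<longleftrightarrow> (\<forall>i. (\<lambda>\<zeta>. \<phi> \<zeta> $ i) holomorphic_on unit_disc)"

text \<open>
  The infimum is taken in the reals. For a domain the set is nonempty (proved below for the convex
  case), and it is bounded below by 0.
\<close>

definition lempert :: "(complex ^ 'n) set \<Rightarrow> complex ^ 'n \<Rightarrow> complex ^ 'n \<Rightarrow> real" where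
  "lempert D z w =
     Inf {artanh (cmod \<alpha>) |\<alpha>. \<alpha> \<in> unit_disc \<and>
            (\<exists>\<phi>. holomorphic_disc_map \<phi> \<and> \<phi> ` unit_disc \<subseteq> D \<and> \<phi> 0 = z \<and> \<phi> \<alpha> = w)}"

lemma ex_disc_through_points:
  fixes D :: "(complex ^ 'n) set"
  assumes D: "open D" "convex D" and z: "z \<in> D" and w: "w \<in> D"
  shows "\<exists>\<alpha>\<in>unit_disc. \<exists>\<phi>. holomorphic_disc_map \<phi> \<and> \<phi> ` unit_disc \<subseteq> D \<and> \<phi> 0 = z \<and> \<phi> \<alpha> = w"
proof -
  define L where "L = (\<lambda>t::complex. \<chi> i. z $ i + t * (w $ i - z $ i))"
  define S where "S = L -` D"
  have L01: "L 0 = z" "L 1 = w"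
    by (simp_all add: L_def vec_eq_iff)
  have S01: "0 \<in> S" "1 \<in> S"
    using z w L01 by (simp_all add: S_def)
  have contL: "continuous_on UNIV L"
    unfolding L_def by (intro continuous_intros)
  have openS: "open S"
    unfolding S_def using D(1) contL by (rule open_vimage)
  have aff: "L (u *\<^sub>R x + v *\<^sub>R y) = u *\<^sub>R L x + v *\<^sub>R L y" if "u + v = 1" for u v x y
  proof -
    have v: "v = 1 - u" using that by simp
    show ?thesis
      by (simp add: L_def vec_eq_iff v)
         (simp add: scaleR_conv_of_real[where 'a = complex] algebra_simps)
  qed
  have convS: "convex S"
    using D(2) by (auto simp: convex_def S_def aff)
  have hol: "holomorphic_disc_map (L \<circ> g)" if "g holomorphic_on unit_disc" for g
    using that unfolding holomorphic_disc_map_def L_def o_def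
    by (auto intro!: holomorphic_intros)
  have "\<exists>g \<alpha>. g holomorphic_on unit_disc \<and> g ` unit_disc \<subseteq> S \<and> \<alpha> \<in> unit_disc \<and> g 0 = 0 \<and> g \<alpha> = 1"
  proof (cases "S = UNIV")
    case True
    then show ?thesis
      by (intro exI[of _ "\<lambda>\<zeta>. 2 * \<zeta>"] exI[of _ "1/2"]) (auto intro!: holomorphic_intros)
  next
    case False
    have "open S \<and> simply_connected S"
      using openS convS convex_imp_simply_connected by blast
    then obtain f g where fg: "g holomorphic_on unit_disc"
        "\<forall>s\<in>S. f s \<in> unit_disc \<and> g (f s) = s" "\<forall>s\<in>unit_disc. g s \<in> S \<and> f (g s) = s"
      using False S01 unfolding Riemann_mapping_theorem by blast
    define a where "a = f 0"
    have a: "cmod a < 1" "g a = 0"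
      using fg(2) S01 by (auto simp: a_def)
    have f1: "cmod (f 1) < 1" "g (f 1) = 1"
      using fg(2) S01 by auto
    define m where "m = Moebius_function 0 (- a)"
    have m: "m holomorphic_on unit_disc" "m ` unit_disc \<subseteq> unit_disc"
      using a by (auto simp: m_def intro!: Moebius_function_holomorphic Moebius_function_norm_lt_1)
    have m0: "m 0 = a"
      by (simp add: m_def Moebius_function_of_zero)
    define \<alpha> where "\<alpha> = Moebius_function 0 a (f 1)"
    have \<alpha>: "\<alpha> \<in> unit_disc"
      using a f1 by (simp add: \<alpha>_def Moebius_function_norm_lt_1)
    have m\<alpha>: "m \<alpha> = f 1"
      unfolding m_def \<alpha>_def using a f1 by (intro Moebius_function_compose) auto
    show ?thesis
    proof (intro exI[of _ "g \<circ> m"] exI[of _ \<alpha>] conjI)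
      show "g \<circ> m holomorphic_on unit_disc"
        using m fg(1) holomorphic_on_compose holomorphic_on_subset by blast
      show "(g \<circ> m) ` unit_disc \<subseteq> S"
        using m(2) fg(3) by fastforce
    qed (use \<alpha> m0 m\<alpha> a f1 in auto)
  qed
  then obtain g \<alpha> where g: "g holomorphic_on unit_disc" "g ` unit_disc \<subseteq> S" "\<alpha> \<in> unit_disc"
      "g 0 = 0" "g \<alpha> = 1"
    by blast
  show ?thesis
  proof (intro bexI[of _ \<alpha>] exI[of _ "L \<circ> g"] conjI)
    show "(L \<circ> g) ` unit_disc \<subseteq> D"
      using g(2) by (auto simp: S_def)
  qed (use g hol L01 in auto)
qed

lemma lempert_nonneg:
  fixes D :: "(complex ^ 'n) set"
  assumes "open D" "convex D" "z \<in> D" "w \<in> D"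
  shows "0 \<le> lempert D z w"
  unfolding lempert_def
proof (rule cInf_greatest)
  show "{artanh (cmod \<alpha>) |\<alpha>. \<alpha> \<in> unit_disc \<and>
           (\<exists>\<phi>. holomorphic_disc_map \<phi> \<and> \<phi> ` unit_disc \<subseteq> D \<and> \<phi> 0 = z \<and> \<phi> \<alpha> = w)} \<noteq> {}"
    using ex_disc_through_points[OF assms] by blast
  fix x
  assume "x \<in> {artanh (cmod \<alpha>) |\<alpha>. \<alpha> \<in> unit_disc \<and>
           (\<exists>\<phi>. holomorphic_disc_map \<phi> \<and> \<phi> ` unit_disc \<subseteq> D \<and> \<phi> 0 = z \<and> \<phi> \<alpha> = w)}"
  then obtain \<alpha> where \<alpha>: "x = artanh (cmod \<alpha>)" "cmod \<alpha> < 1"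
    by auto
  then have "1 \<le> (1 + cmod \<alpha>) / (1 - cmod \<alpha>)"
    by (simp add: field_simps)
  then have "0 \<le> ln ((1 + cmod \<alpha>) / (1 - cmod \<alpha>))"
    by (rule ln_ge_zero)
  then show "0 \<le> x"
    unfolding \<alpha>(1) artanh_def by (rule divide_nonneg_nonneg) simp
qed

definition pseudodistance_on :: "'a set \<Rightarrow> ('a \<Rightarrow> 'a \<Rightarrow> real) \<Rightarrow> bool" where
  "pseudodistance_on D d \<longleftrightarrow>
     (\<forall>x\<in>D. d x x = 0) \<and>
     (\<forall>x\<in>D. \<forall>y\<in>D. 0 \<le> d x y \<and> d x y = d y x) \<and>
     (\<forall>x\<in>D. \<forall>y\<in>D. \<forall>z\<in>D. d x z \<le> d x y + d y z)"

text \<open>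
  The largest pseudodistance below the Lempert function is the pointwise supremum of all of them.
  The value 0 off \<open>D \<times> D\<close> is immaterial; it makes the function nonnegative and symmetric
  everywhere, as \<^locale>\<open>Metric_space\<close> requires.
\<close>

definition kobayashi_dist :: "(complex ^ 'n) set \<Rightarrow> complex ^ 'n \<Rightarrow> complex ^ 'n \<Rightarrow> real" where
  "kobayashi_dist D z w =
     (if z \<in> D \<and> w \<in> D
      then Sup {d z w |d. pseudodistance_on D d \<and> (\<forall>x\<in>D. \<forall>y\<in>D. d x y \<le> lempert D x y)}
      else 0)"

lemma kobayashi_dist_greatest:
  fixes D :: "(complex ^ 'n) set"
  assumes D: "open D" "convex D"
  shows "pseudodistance_on D (kobayashi_dist D)"
    and "\<And>z w. \<lbrakk>z \<in> D; w \<in> D\<rbrakk> \<Longrightarrow> kobayashi_dist D z w \<le> lempert D z w"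
    and "\<And>d z w. \<lbrakk>pseudodistance_on D d; \<forall>x\<in>D. \<forall>y\<in>D. d x y \<le> lempert D x y; z \<in> D; w \<in> D\<rbrakk>
           \<Longrightarrow> d z w \<le> kobayashi_dist D z w"
proof -
  define P where "P = {d. pseudodistance_on D d \<and> (\<forall>x\<in>D. \<forall>y\<in>D. d x y \<le> lempert D x y)}"
  have K: "kobayashi_dist D z w = (SUP d\<in>P. d z w)" if "z \<in> D" "w \<in> D" for z w
    using that by (auto simp: kobayashi_dist_def P_def image_def intro!: arg_cong[where f = Sup])
  have P0: "(\<lambda>_ _. 0) \<in> P"
    using lempert_nonneg[OF D] by (simp add: P_def pseudodistance_on_def)
  have bdd: "bdd_above ((\<lambda>d. d z w) ` P)" if "z \<in> D" "w \<in> D" for z w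
    using that by (auto simp: P_def bdd_above_def)
  have upper: "d z w \<le> kobayashi_dist D z w" if "d \<in> P" "z \<in> D" "w \<in> D" for d z w
    unfolding K[OF that(2,3)] using bdd[OF that(2,3)] that(1) by (intro cSUP_upper)
  have least: "kobayashi_dist D z w \<le> B" if "z \<in> D" "w \<in> D" "\<And>d. d \<in> P \<Longrightarrow> d z w \<le> B" for z w B
    using that P0 by (auto simp: K intro!: cSUP_least)
  show le: "kobayashi_dist D z w \<le> lempert D z w" if "z \<in> D" "w \<in> D" for z w
    using that by (intro least) (auto simp: P_def)
  show "d z w \<le> kobayashi_dist D z w"
    if "pseudodistance_on D d" "\<forall>x\<in>D. \<forall>y\<in>D. d x y \<le> lempert D x y" "z \<in> D" "w \<in> D" for d z w
    using that by (intro upper) (auto simp: P_def)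
  show "pseudodistance_on D (kobayashi_dist D)"
    unfolding pseudodistance_on_def
  proof (intro conjI ballI)
    fix x y z assume x: "x \<in> D" and y: "y \<in> D" and z: "z \<in> D"
    show "0 \<le> kobayashi_dist D x y"
      using upper[OF P0 x y] .
    have refl: "d x x = 0" if "d \<in> P" for d
      using that x by (auto simp: P_def pseudodistance_on_def)
    show "kobayashi_dist D x x = 0"
      using upper[OF P0 x x] least[OF x x, of 0] refl by force
    have "kobayashi_dist D u v \<le> kobayashi_dist D v u" if "u \<in> D" "v \<in> D" for u v
    proof (rule least[OF that])
      fix d assume "d \<in> P"
      moreover have "d u v = d v u"
        using calculation that by (auto simp: P_def pseudodistance_on_def)
      ultimately show "d u v \<le> kobayashi_dist D v u"
        using upper that by metis
    qed
    then show "kobayashi_dist D x y = kobayashi_dist D y x"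
      using x y by (intro antisym) auto
    show "kobayashi_dist D x z \<le> kobayashi_dist D x y + kobayashi_dist D y z"
    proof (rule least[OF x z])
      fix d assume d: "d \<in> P"
      have "d x z \<le> d x y + d y z"
        using d x y z by (auto simp: P_def pseudodistance_on_def)
      also have "\<dots> \<le> kobayashi_dist D x y + kobayashi_dist D y z"
        using upper[OF d x y] upper[OF d y z] by simp
      finally show "d x z \<le> kobayashi_dist D x y + kobayashi_dist D y z" .
    qed
  qed
qed

definition boundary_dist :: "(complex ^ 'n) set \<Rightarrow> complex ^ 'n \<Rightarrow> real" where
  "boundary_dist D z = infdist z (frontier D)"

definition real_geodesic ::
    "(complex ^ 'n) set \<Rightarrow> real \<Rightarrow> real \<Rightarrow> (real \<Rightarrow> complex ^ 'n) \<Rightarrow> bool" where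
  "real_geodesic D a b \<psi> \<longleftrightarrow>
     a \<le> b \<and> continuous_on {a..b} \<psi> \<and> \<psi> ` {a..b} \<subseteq> D \<and>
     (\<forall>s\<in>{a..b}. \<forall>t\<in>{a..b}. kobayashi_dist D (\<psi> s) (\<psi> t) = \<bar>s - t\<bar>)"

definition visible :: "(complex ^ 'n) set \<Rightarrow> bool" where
  "visible D \<longleftrightarrow>
     is_domain D \<and> bounded D \<and> Metric_space.mcomplete D (kobayashi_dist D) \<and>
     (\<forall>\<epsilon>>0. \<exists>K. compact (closure K) \<and> closure K \<subseteq> D \<and>
        (\<forall>a b \<psi>. real_geodesic D a b \<psi> \<and> diameter (\<psi> ` {a..b}) > \<epsilon> \<longrightarrow>
           \<psi> ` {a..b} \<inter> K \<noteq> {}))"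

text \<open>
  The distance on the disc is the Kobayashi distance of the unit ball of \<open>\<complex>\<^sup>1\<close>, into which
  \<^const>\<open>vec\<close> embeds the scalar disc.
\<close>

definition complex_geodesic :: "(complex ^ 'n) set \<Rightarrow> (complex \<Rightarrow> complex ^ 'n) \<Rightarrow> bool" where
  "complex_geodesic D \<phi> \<longleftrightarrow>
     holomorphic_disc_map \<phi> \<and> \<phi> ` unit_disc \<subseteq> D \<and>
     (\<forall>\<zeta>\<in>unit_disc. \<forall>\<eta>\<in>unit_disc.
        kobayashi_dist (ball 0 1 :: (complex ^ 1) set) (vec \<zeta>) (vec \<eta>) =
        kobayashi_dist D (\<phi> \<zeta>) (\<phi> \<eta>))"

definition disc_free :: "(complex ^ 'n) set \<Rightarrow> bool" where
  "disc_free S \<longleftrightarrow>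
     (\<forall>\<phi>. holomorphic_disc_map \<phi> \<and> \<phi> ` unit_disc \<subseteq> S \<longrightarrow> \<phi> constant_on unit_disc)"

definition uniformly_equicontinuous_on ::
    "'a::metric_space set \<Rightarrow> ('a \<Rightarrow> 'b::metric_space) set \<Rightarrow> bool" where
  "uniformly_equicontinuous_on S F \<longleftrightarrow>
     (\<forall>\<epsilon>>0. \<exists>\<delta>>0. \<forall>f\<in>F. \<forall>x\<in>S. \<forall>y\<in>S. dist x y < \<delta> \<longrightarrow> dist (f x) (f y) < \<epsilon>)"

definition centred_geodesics :: "(complex ^ 'n) set \<Rightarrow> (complex \<Rightarrow> complex ^ 'n) set" where
  "centred_geodesics D =
     {\<phi>. complex_geodesic D \<phi> \<and>
         (\<forall>\<zeta>\<in>unit_disc. boundary_dist D (\<phi> \<zeta>) \<le> boundary_dist D (\<phi> 0))}"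

end

theory Submission
  imports Defs
begin

text \<open>
  All the complex geometry rests on one construction of Lempert. If \<open>\<phi>\<close> and \<open>\<psi>\<close> are discs in a bounded
  convex domain that agree at some points, and \<open>\<mu>\<close> is a rational function whose poles in the disc are
  simple and lie at these points, with values in \<open>[0, 1]\<close> on the unit circle, then \<open>\<phi> + \<mu> (\<psi> - \<phi>)\<close> is again a disc in the
  domain, by the maximum principle applied to the supporting functionals. A first choice of \<open>\<mu>\<close>
  gives the triangle inequality for the Lempert function, which is therefore the Kobayashi distance.
  A second choice shows that a disc which is extremal for one pair of its points is extremal for all
  pairs; together with Montel's theorem, any two points lie on a complex geodesic.

  If the domain is visible, then a disc in the boundary, pushed slightly inwards, yields points that
  stay at bounded Kobayashi distance and far apart, while the geodesics joining them would have to
  visit a fixed compact set; so the boundary is disc-free. A centred geodesic that moves two nearby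
  parameters far apart must visit a fixed compact set in between, hence its centre lies in a compact
  set, hence the parameters stay away from the circle, where all discs are uniformly Lipschitz.

  Conversely, equicontinuity and disc-freeness bound the Gromov products of points that are
  far apart. For three points \<open>z, x, w\<close> in this order on a real geodesic, both pairs \<open>z, x\<close> and \<open>x, w\<close>
  far apart, this bounds the distance of \<open>x\<close> to a base point.
\<close>

section \<open>The pseudohyperbolic distance on the disc\<close>

text \<open>Most estimates below are one-variable statements (Schwarz-Pick, Harnack, maximum
  principles) about a disc composed with a linear functional. Discs may be reparametrised by the
  automorphisms of the unit disc, a noncompact group, so the family of all complex geodesics can
  never be equicontinuous; maximality of \<open>boundary_dist\<close> at 0 removes this freedom. It
  has a second effect: when the centres of centred geodesics approach the boundary, the geodesics do
  so at every parameter, so any limit is a disc in the boundary, and disc-freeness applies to it.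
  Kobayashi distance and compactness are tied together by \<open>boundary_dist_le_exp_kob\<close>:
  points at bounded distance from a compact set cannot approach the boundary. In the converse, a
  real geodesic need not lie in a complex geodesic, as the bidisc shows, so its course cannot be
  read off from a disc. Gromov products concern pairs of points only, and each pair can be placed on
  a centred geodesic.\<close>

definition pseudohyp :: "complex \<Rightarrow> complex \<Rightarrow> real" where
  "pseudohyp z w = cmod (Moebius_function 0 z w)"

lemma pseudohyp_eq: "pseudohyp z w = cmod (w - z) / cmod (1 - cnj z * w)"
  by (simp add: pseudohyp_def Moebius_function_simple norm_divide)

lemma pseudohyp_nonneg: "0 \<le> pseudohyp z w"
  by (simp add: pseudohyp_def)

lemma pseudohyp_lt_1: "\<lbrakk>cmod z < 1; cmod w < 1\<rbrakk> \<Longrightarrow> pseudohyp z w < 1"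
  by (simp add: pseudohyp_def Moebius_function_norm_lt_1)

lemma pseudohyp_0: "pseudohyp 0 w = cmod w" "pseudohyp w 0 = cmod w"
  by (simp_all add: pseudohyp_eq)

lemma one_minus_cnj_mult_nonzero:
  assumes "cmod z < 1" "cmod w \<le> 1"
  shows "1 - cnj z * w \<noteq> 0"
proof
  assume "1 - cnj z * w = 0"
  then have "cmod (cnj z * w) = 1"
    by simp
  moreover have "cmod z * cmod w \<le> cmod z"
    using assms by (simp add: mult_left_le)
  ultimately show False
    using assms(1) by (simp add: norm_mult)
qed

lemma norm_one_minus_cnj_mult_sq:
  "(cmod (1 - cnj z * w))\<^sup>2 = (cmod (w - z))\<^sup>2 + (1 - (cmod z)\<^sup>2) * (1 - (cmod w)\<^sup>2)"
proof -
  have "complex_of_real ((cmod (1 - cnj z * w))\<^sup>2) =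
        of_real ((cmod (w - z))\<^sup>2 + (1 - (cmod z)\<^sup>2) * (1 - (cmod w)\<^sup>2))"
    unfolding of_real_add of_real_mult of_real_diff complex_norm_square of_real_1
    by (simp add: algebra_simps)
  then show ?thesis
    using of_real_eq_iff by blast
qed

lemma one_minus_pseudohyp_sq:
  assumes "cmod z < 1" "cmod w < 1"
  shows "1 - (pseudohyp z w)\<^sup>2 = (1 - (cmod z)\<^sup>2) * (1 - (cmod w)\<^sup>2) / (cmod (1 - cnj z * w))\<^sup>2"
proof -
  have "(cmod (1 - cnj z * w))\<^sup>2 \<noteq> 0"
    using one_minus_cnj_mult_nonzero[of z w] assms by simp
  then have "1 - (pseudohyp z w)\<^sup>2 = ((cmod (1 - cnj z * w))\<^sup>2 - (cmod (w - z))\<^sup>2) / (cmod (1 - cnj z * w))\<^sup>2"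
    by (simp add: pseudohyp_eq power_divide diff_divide_distrib)
  also have "(cmod (1 - cnj z * w))\<^sup>2 - (cmod (w - z))\<^sup>2 = (1 - (cmod z)\<^sup>2) * (1 - (cmod w)\<^sup>2)"
    by (simp add: norm_one_minus_cnj_mult_sq[of z w])
  finally show ?thesis .
qed

lemma Moebius_maps_disc: "cmod a < 1 \<Longrightarrow> Moebius_function 0 a ` unit_disc \<subseteq> unit_disc"
  by (auto simp: Moebius_function_norm_lt_1)

lemma Moebius_inverse:
  assumes "cmod a < 1" "cmod z < 1"
  shows "Moebius_function 0 a (Moebius_function 0 (-a) z) = z"
    and "Moebius_function 0 (-a) (Moebius_function 0 a z) = z"
  using assms by (auto intro!: Moebius_function_compose)

lemma Moebius_minus_0: "Moebius_function 0 (-a) 0 = a"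
  by (simp add: Moebius_function_of_zero)

text \<open>Moebius maps that carry 0 to \<open>z\<close> and \<open>f z\<close> to 0 turn
  \<open>f\<close> into a self-map of the disc that fixes 0, which is the situation of the Schwarz
  lemma.\<close>

lemma schwarz_pick:
  assumes f: "f holomorphic_on unit_disc" "f ` unit_disc \<subseteq> unit_disc"
    and z: "cmod z < 1" and w: "cmod w < 1"
  shows "pseudohyp (f z) (f w) \<le> pseudohyp z w"
proof -
  have fz: "cmod (f x) < 1" if "cmod x < 1" for x
    using f(2) that by (simp add: image_subset_iff)
  define g where "g = Moebius_function 0 (f z) \<circ> (f \<circ> Moebius_function 0 (-z))"
  have m: "Moebius_function 0 (-z) holomorphic_on unit_disc"
    using z by (simp add: Moebius_function_holomorphic)
  have m': "Moebius_function 0 (-z) ` unit_disc \<subseteq> unit_disc"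
    using z by (intro Moebius_maps_disc) simp
  have "g holomorphic_on unit_disc"
    unfolding g_def
    by (intro holomorphic_on_compose_gen[where t = unit_disc] m f Moebius_function_holomorphic fz z m')
       (use m' f(2) in \<open>auto simp: image_comp\<close>)
  moreover have "g 0 = 0"
    by (simp add: g_def Moebius_minus_0 Moebius_function_eq_zero)
  moreover have "cmod (g x) < 1" if "cmod x < 1" for x
    using that m' z by (auto simp: g_def intro!: Moebius_function_norm_lt_1 fz)
  ultimately have "cmod (g (Moebius_function 0 z w)) \<le> cmod (Moebius_function 0 z w)"
    using Schwarz_Lemma(1)[of g] Moebius_function_norm_lt_1[OF z w] by blast
  then show ?thesis
    using z w by (simp add: g_def pseudohyp_def Moebius_inverse)
qed

lemma pseudohyp_Moebius:
  assumes a: "cmod a < 1" and z: "cmod z < 1" and w: "cmod w < 1"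
  shows "pseudohyp (Moebius_function 0 a z) (Moebius_function 0 a w) = pseudohyp z w"
proof (rule antisym)
  have hol: "Moebius_function 0 b holomorphic_on unit_disc"
      "Moebius_function 0 b ` unit_disc \<subseteq> unit_disc" if "cmod b < 1" for b
    using that by (auto simp: Moebius_function_holomorphic Moebius_function_norm_lt_1)
  show "pseudohyp (Moebius_function 0 a z) (Moebius_function 0 a w) \<le> pseudohyp z w"
    by (intro schwarz_pick hol a z w)
  have "pseudohyp (Moebius_function 0 (-a) (Moebius_function 0 a z))
      (Moebius_function 0 (-a) (Moebius_function 0 a w))
      \<le> pseudohyp (Moebius_function 0 a z) (Moebius_function 0 a w)"
    using a z w by (intro schwarz_pick hol) (auto simp: Moebius_function_norm_lt_1)
  then show "pseudohyp z w \<le> pseudohyp (Moebius_function 0 a z) (Moebius_function 0 a w)"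
    using a z w by (simp add: Moebius_inverse)
qed

section \<open>The inverse hyperbolic tangent\<close>

lemma artanh_mono:
  fixes x y :: real
  assumes "0 \<le> x" "x \<le> y" "y < 1"
  shows "artanh x \<le> artanh y"
proof -
  have "(1 + x) / (1 - x) \<le> (1 + y) / (1 - y)"
    using assms by (intro frac_le) auto
  moreover have "0 < (1 + x) / (1 - x)"
    using assms by simp
  ultimately show ?thesis
    unfolding artanh_def by (intro divide_right_mono) (auto simp del: divide_le_cancel)
qed

lemma artanh_strict_mono:
  fixes x y :: real
  assumes "0 \<le> x" "x < y" "y < 1"
  shows "artanh x < artanh y"
proof -
  have "(1 + x) / (1 - x) < (1 + y) / (1 - y)"
    using assms by (intro frac_less) auto
  moreover have "0 < (1 + x) / (1 - x)" "0 < (1 + y) / (1 - y)"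
    using assms by auto
  ultimately show ?thesis
    unfolding artanh_def by (intro divide_strict_right_mono) (auto simp del: divide_le_cancel)
qed

lemma artanh_less_iff:
  fixes x y :: real
  assumes "0 \<le> x" "x < 1" "0 \<le> y" "y < 1"
  shows "artanh x < artanh y \<longleftrightarrow> x < y"
  using artanh_strict_mono[of x y] artanh_mono[of y x] assms by force

lemma artanh_nonneg: "\<lbrakk>0 \<le> x; x < 1\<rbrakk> \<Longrightarrow> 0 \<le> artanh (x::real)"
  using artanh_mono[of 0 x] by simp

lemma exp_2_artanh:
  fixes x :: real
  assumes "\<bar>x\<bar> < 1"
  shows "exp (2 * artanh x) = (1 + x) / (1 - x)"
  using assms by (simp add: artanh_def abs_less_iff)

text \<open>Hyperbolic lengths add along a diameter: the point at distance \<open>artanh b\<close>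
  beyond \<open>a\<close> is \<open>(a + b) / (1 + a * b)\<close>, which becomes the parameter
  \<open>c\<close> of \<open>lempert_triangle\<close>.\<close>

lemma artanh_add:
  fixes a b :: real
  assumes "0 \<le> a" "a < 1" "0 \<le> b" "b < 1"
  shows "artanh ((a + b) / (1 + a * b)) = artanh a + artanh b"
proof -
  have p: "0 < 1 + a * b"
    using assms by (simp add: add_pos_nonneg)
  have "1 + (a + b) / (1 + a * b) = (1 + a) * (1 + b) / (1 + a * b)"
    using p by (simp add: field_simps)
  moreover have "1 - (a + b) / (1 + a * b) = (1 - a) * (1 - b) / (1 + a * b)"
    using p by (simp add: field_simps)
  ultimately have "(1 + (a + b) / (1 + a * b)) / (1 - (a + b) / (1 + a * b)) =
      ((1 + a) / (1 - a)) * ((1 + b) / (1 - b))"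
    using p by simp
  moreover have "0 < (1 + a) / (1 - a)" "0 < (1 + b) / (1 - b)"
    using assms by auto
  ultimately show ?thesis
    unfolding artanh_def by (simp add: ln_mult_pos add_divide_distrib)
qed

lemma artanh_le_imp_le_tanh:
  fixes x T :: real
  assumes "0 \<le> x" "x < 1"
  shows "artanh x \<le> T \<Longrightarrow> x \<le> tanh T"
proof (rule ccontr)
  assume h: "artanh x \<le> T" "\<not> x \<le> tanh T"
  have T: "0 \<le> T"
    using artanh_nonneg[OF assms] h by linarith
  have "artanh (tanh T) < artanh x"
    using h T assms by (intro artanh_strict_mono) auto
  then show False
    using h by (simp add: artanh_tanh_real)
qed

text \<open>The Hermitian form. A real half-space is given by the real part of
  \<open>hdot _ a\<close>, which is complex linear in its first argument; along a disc this is the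
  real part of a holomorphic function, so maximum principles apply.\<close>

definition hdot :: "complex ^ 'n \<Rightarrow> complex ^ 'n \<Rightarrow> complex" where
  "hdot x a = (\<Sum>i\<in>UNIV. x $ i * cnj (a $ i))"

lemma Re_hdot: "Re (hdot x a) = x \<bullet> a"
  by (simp add: hdot_def inner_vec_def inner_complex_def)

lemma hdot_linear:
  "hdot (x + y) a = hdot x a + hdot y a" "hdot (x - y) a = hdot x a - hdot y a"
  "hdot (\<chi> i. k * v $ i) a = k * hdot v a"
  by (simp_all add: hdot_def algebra_simps sum.distrib sum_subtractf sum_distrib_left)

lemma norm_hdot_le: "cmod (hdot x a) \<le> (\<Sum>i\<in>UNIV. cmod (a $ i)) * norm x"
proof -
  have "cmod (hdot x a) \<le> (\<Sum>i\<in>UNIV. cmod (x $ i * cnj (a $ i)))"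
    unfolding hdot_def by (rule norm_sum)
  also have "\<dots> \<le> (\<Sum>i\<in>UNIV. cmod (a $ i) * norm x)"
  proof (rule sum_mono)
    fix i
    show "cmod (x $ i * cnj (a $ i)) \<le> cmod (a $ i) * norm x"
      using mult_left_mono[OF Finite_Cartesian_Product.norm_nth_le[of x i], of "cmod (a $ i)"]
      by (simp add: norm_mult mult.commute)
  qed
  finally show ?thesis
    by (simp add: sum_distrib_right)
qed

lemma holomorphic_hdot:
  "holomorphic_disc_map \<phi> \<Longrightarrow> (\<lambda>z. hdot (\<phi> z) a) holomorphic_on unit_disc"
  unfolding holomorphic_disc_map_def hdot_def by (auto intro!: holomorphic_intros)

lemma holomorphic_disc_map_compose:
  assumes "holomorphic_disc_map \<phi>" "g holomorphic_on unit_disc" "g ` unit_disc \<subseteq> unit_disc"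
  shows "holomorphic_disc_map (\<phi> \<circ> g)"
proof -
  have "(\<lambda>z. \<phi> z $ i) \<circ> g holomorphic_on unit_disc" for i
    using assms by (intro holomorphic_on_compose_gen[where t = unit_disc])
      (auto simp: holomorphic_disc_map_def)
  then show ?thesis
    by (simp add: holomorphic_disc_map_def o_def)
qed

lemma holomorphic_disc_map_continuous:
  assumes "holomorphic_disc_map \<phi>"
  shows "continuous_on unit_disc \<phi>"
proof -
  have "continuous_on unit_disc (\<lambda>z. \<chi> i. \<phi> z $ i)"
    using assms unfolding holomorphic_disc_map_def
    by (intro continuous_on_vec_lambda) (auto intro: holomorphic_on_imp_continuous_on)
  then show ?thesis
    by simp
qed

section \<open>Gluing discs in convex domains\<close>

text \<open>Since \<open>h\<close> need not extend to the closed disc, the maximum principle is used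
  on a ball of radius \<open>r < 1\<close> that contains \<open>z\<close> and whose boundary already
  lies where the bound \<open>B + e\<close> holds.\<close>

lemma Re_le_on_disc_if_le_on_spheres:
  assumes h: "h holomorphic_on unit_disc"
    and bd: "\<And>e. e > 0 \<Longrightarrow> \<exists>r0<1. \<forall>z. r0 < cmod z \<and> cmod z < 1 \<longrightarrow> Re (h z) \<le> B + e"
    and z: "cmod z < 1"
  shows "Re (h z) \<le> B"
proof (rule field_le_epsilon)
  fix e :: real assume "e > 0"
  then obtain r0 where r0: "r0 < 1" "\<And>z. r0 < cmod z \<Longrightarrow> cmod z < 1 \<Longrightarrow> Re (h z) \<le> B + e"
    using bd by blast
  obtain r where r: "max r0 (cmod z) < r" "r < 1"
    using dense[of "max r0 (cmod z)" 1] r0(1) z by auto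
  then have "0 < r"
    by (meson le_less_trans max.bounded_iff norm_ge_zero order.refl order.trans)
  show "Re (h z) \<le> B + e"
  proof (rule maximum_real_frontier[of h "ball 0 r"])
    show "h holomorphic_on interior (ball 0 r)"
      using h by (rule holomorphic_on_subset) (use r in auto)
    show "continuous_on (closure (ball 0 r)) h"
      using holomorphic_on_imp_continuous_on[OF h] by (rule continuous_on_subset)
        (use r \<open>0 < r\<close> in \<open>auto simp: subset_eq\<close>)
    show "Re (h w) \<le> B + e" if "w \<in> frontier (ball 0 r)" for w
      using that r \<open>0 < r\<close> by (intro r0) (auto simp: frontier_ball)
  qed (use r \<open>0 < r\<close> in auto)
qed

text \<open>
  The boundary values of \<open>\<nu>\<close> are convex combinations of those of \<open>\<phi>\<close> and \<open>\<psi>\<close>; since \<open>\<mu>\<close> is only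
  real on the circle itself, the inequality is obtained on circles of radius tending to 1.
\<close>

lemma glued_disc_in_half_space:
  fixes \<phi> \<psi> \<nu> :: "complex \<Rightarrow> complex ^ 'n"
  assumes D: "bounded D" "\<And>x. x \<in> D \<Longrightarrow> x \<bullet> a \<le> c"
    and \<nu>: "holomorphic_disc_map \<nu>"
    and \<phi>: "\<phi> ` unit_disc \<subseteq> D" and \<psi>: "\<psi> ` unit_disc \<subseteq> D"
    and \<psi>m: "\<And>z. z \<in> unit_disc \<Longrightarrow> \<psi> z \<bullet> a \<le> c - m" and m: "0 \<le> m"
    and r1: "0 < r1" "r1 < 1" and cont: "continuous_on {z. r1 \<le> cmod z \<and> cmod z \<le> 1} \<mu>"
    and \<mu>: "\<And>z. cmod z = 1 \<Longrightarrow> \<exists>t. \<mu> z = of_real t \<and> c0 \<le> t \<and> t \<le> 1" and c0: "0 \<le> c0"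
    and eq: "\<And>z i. r1 < cmod z \<Longrightarrow> cmod z < 1 \<Longrightarrow> \<nu> z $ i = \<phi> z $ i + \<mu> z * (\<psi> z $ i - \<phi> z $ i)"
    and z: "cmod z < 1"
  shows "\<nu> z \<bullet> a \<le> c - c0 * m"
proof -
  obtain R where R: "\<And>x. x \<in> D \<Longrightarrow> norm x \<le> R"
    using D(1) bounded_iff by blast
  define A where "A = (\<Sum>i\<in>UNIV. cmod (a $ i))"
  define M where "M = A * (2 * R)"
  have A0: "0 \<le> A"
    unfolding A_def by (simp add: sum_nonneg)
  have hb: "cmod (hdot (\<psi> w) a - hdot (\<phi> w) a) \<le> M" if "cmod w < 1" for w
  proof -
    have D': "\<psi> w \<in> D" "\<phi> w \<in> D"
      using that \<phi> \<psi> by (auto simp: image_subset_iff)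
    have "norm (\<psi> w - \<phi> w) \<le> 2 * R"
      using norm_triangle_ineq4[of "\<psi> w" "\<phi> w"] R[OF D'(1)] R[OF D'(2)] by linarith
    then have "A * norm (\<psi> w - \<phi> w) \<le> M"
      unfolding M_def using A0 by (rule mult_left_mono)
    then show ?thesis
      using norm_hdot_le[of "\<psi> w - \<phi> w" a] by (simp add: A_def hdot_linear)
  qed
  have M0: "0 \<le> M"
    using order_trans[OF norm_ge_zero hb[of 0]] by simp
  have "{z. r1 \<le> cmod z \<and> cmod z \<le> 1} = cball 0 1 - ball 0 r1"
    by auto
  then have "compact {z. r1 \<le> cmod z \<and> cmod z \<le> 1}"
    by (simp add: compact_diff)
  then have uc: "uniformly_continuous_on {z. r1 \<le> cmod z \<and> cmod z \<le> 1} \<mu>"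
    using cont compact_uniformly_continuous by blast
  have "Re (hdot (\<nu> z) a) \<le> c - c0 * m"
  proof (rule Re_le_on_disc_if_le_on_spheres[of "\<lambda>z. hdot (\<nu> z) a"])
    show "(\<lambda>z. hdot (\<nu> z) a) holomorphic_on unit_disc"
      by (rule holomorphic_hdot[OF \<nu>])
    show "cmod z < 1" by (rule z)
  next
    fix e :: real assume e: "e > 0"
    \<comment> \<open>Replacing \<open>\<mu> w\<close> by a value within \<open>\<eta>\<close>
      changes the functional by at most \<open>\<eta> * M\<close>; the \<open>+ 1\<close> covers
      \<open>M = 0\<close>.\<close>
    define \<eta> where "\<eta> = e / (M + 1)"
    have \<eta>: "0 < \<eta>" "\<eta> * M \<le> e"
      using e M0 by (auto simp: \<eta>_def field_simps)
    obtain d where d: "d > 0" "\<And>z w. r1 \<le> cmod z \<Longrightarrow> cmod z \<le> 1 \<Longrightarrow> r1 \<le> cmod w \<Longrightarrow> cmod w \<le> 1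
        \<Longrightarrow> dist z w < d \<Longrightarrow> dist (\<mu> z) (\<mu> w) < \<eta>"
      using uniformly_continuous_onE[OF uc \<eta>(1)] by (smt (verit) dist_commute mem_Collect_eq)
    show "\<exists>r0<1. \<forall>z. r0 < cmod z \<and> cmod z < 1 \<longrightarrow> Re (hdot (\<nu> z) a) \<le> c - c0 * m + e"
    proof (intro exI[of _ "max r1 (1 - d)"] conjI allI impI)
      show "max r1 (1 - d) < 1"
        using r1 d(1) by simp
      fix w assume w: "max r1 (1 - d) < cmod w \<and> cmod w < 1"
      then have w0: "cmod w > 0" "r1 < cmod w" "1 - d < cmod w" "cmod w < 1"
        using r1 by auto
      \<comment> \<open>The radial projection to the circle, where \<open>\<mu>\<close> is
        real.\<close>
      define u where "u = w / of_real (cmod w)"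
      have u: "cmod u = 1"
        using w0 by (simp add: u_def norm_divide)
      have "u - w = w * (1 / of_real (cmod w) - 1)"
        by (simp add: u_def algebra_simps)
      also have "(1 / of_real (cmod w) - 1 :: complex) = of_real (1 / cmod w - 1)"
        by simp
      finally have "cmod (u - w) = cmod w * (1 / cmod w - 1)"
        using w0 by (simp add: norm_mult del: of_real_diff of_real_divide)
      then have "cmod (u - w) = 1 - cmod w"
        using w0 by (simp add: algebra_simps)
      then have "dist (\<mu> w) (\<mu> u) < \<eta>"
        using w0 u r1 by (intro d(2)) (auto simp: dist_norm norm_minus_commute)
      obtain t where t: "\<mu> u = of_real t" "c0 \<le> t" "t \<le> 1"
        using \<mu>[OF u] by blast
      define p q where "p = hdot (\<phi> w) a" and "q = hdot (\<psi> w) a"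
      have pq: "Re p \<le> c" "Re q \<le> c - m" "cmod (q - p) \<le> M"
        using \<phi> \<psi>m D(2) hb w0 by (auto simp: p_def q_def Re_hdot image_subset_iff)
      have "\<nu> w = \<phi> w + (\<chi> i. \<mu> w * (\<psi> w - \<phi> w) $ i)"
        using eq[of w] w0 by (simp add: vec_eq_iff)
      then have "hdot (\<nu> w) a = p + \<mu> w * (q - p)"
        by (simp only: hdot_linear p_def q_def)
      \<comment> \<open>A convex combination of \<open>p\<close> and \<open>q\<close>, whose real
        parts are bounded, plus an error due to the distance of \<open>w\<close> from the
        circle.\<close>
      also have "\<dots> = of_real (1 - t) * p + of_real t * q + (\<mu> w - \<mu> u) * (q - p)"
        by (simp add: t(1) algebra_simps)
      finally have "Re (hdot (\<nu> w) a) = (1 - t) * Re p + t * Re q + Re ((\<mu> w - \<mu> u) * (q - p))"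
        by simp
      also have "Re ((\<mu> w - \<mu> u) * (q - p)) \<le> \<eta> * M"
      proof -
        have "Re ((\<mu> w - \<mu> u) * (q - p)) \<le> cmod (\<mu> w - \<mu> u) * cmod (q - p)"
          by (metis complex_Re_le_cmod norm_mult)
        also have "\<dots> \<le> \<eta> * M"
          using \<open>dist (\<mu> w) (\<mu> u) < \<eta>\<close> pq(3) \<eta>(1) by (intro mult_mono) (auto simp: dist_norm)
        finally show ?thesis .
      qed
      also have "(1 - t) * Re p + t * Re q \<le> (1 - t) * c + t * (c - m)"
        using t c0 pq by (intro add_mono mult_left_mono) auto
      also have "(1 - t) * c + t * (c - m) = c - t * m"
        by (simp add: algebra_simps)
      also have "c - t * m \<le> c - c0 * m"
        using t m by (simp add: mult_right_mono)
      finally show "Re (hdot (\<nu> w) a) \<le> c - c0 * m + e"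
        using \<eta>(2) by linarith
    qed
  qed
  then show ?thesis
    by (simp add: Re_hdot)
qed

section \<open>Convex sets and their supporting half-spaces\<close>

lemma in_closure_if_in_half_spaces:
  fixes D :: "'a::euclidean_space set"
  assumes "convex D" "D \<noteq> {}"
    and "\<And>a c. norm a = 1 \<Longrightarrow> (\<And>y. y \<in> D \<Longrightarrow> y \<bullet> a \<le> c) \<Longrightarrow> x \<bullet> a \<le> c"
  shows "x \<in> closure D"
proof (rule ccontr)
  assume "x \<notin> closure D"
  then obtain a b where ab: "a \<bullet> x < b" "\<forall>y\<in>closure D. a \<bullet> y > b"
    using separating_hyperplane_closed_point[of "closure D" x] assms(1) by (auto simp: convex_closure)
  have "a \<noteq> 0"
    using ab assms(2) closure_subset[of D] by fastforce
  define u where "u = - a /\<^sub>R norm a"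
  have "x \<bullet> u \<le> - b / norm a"
  proof (rule assms(3))
    show "norm u = 1"
      using \<open>a \<noteq> 0\<close> by (simp add: u_def)
    fix y assume "y \<in> D"
    then have "b < a \<bullet> y"
      using ab closure_subset[of D] by blast
    then show "y \<bullet> u \<le> - b / norm a"
      using \<open>a \<noteq> 0\<close> by (simp add: u_def inner_commute field_simps)
  qed
  then show False
    using ab(1) \<open>a \<noteq> 0\<close> by (simp add: u_def inner_commute field_simps)
qed

text \<open>The margin \<open>e\<close> puts the ball into the closure of \<open>D\<close>, and an
  open convex set is the interior of its closure.\<close>

lemma ball_subset_if_in_half_spaces:
  fixes D :: "'a::euclidean_space set"
  assumes D: "convex D" "open D" "D \<noteq> {}"
    and x: "\<And>a c. norm a = 1 \<Longrightarrow> (\<And>y. y \<in> D \<Longrightarrow> y \<bullet> a \<le> c) \<Longrightarrow> x \<bullet> a \<le> c - e"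
  shows "ball x e \<subseteq> D"
proof -
  have "ball x e \<subseteq> closure D"
  proof
    fix y assume y: "y \<in> ball x e"
    show "y \<in> closure D"
    proof (rule in_closure_if_in_half_spaces[OF D(1,3)])
      fix a :: 'a and c assume a: "norm a = 1" "\<And>y. y \<in> D \<Longrightarrow> y \<bullet> a \<le> c"
      have "(y - x) \<bullet> a \<le> norm (y - x)"
        using norm_cauchy_schwarz[of "y - x" a] a(1) by simp
      then show "y \<bullet> a \<le> c"
        using x[OF a] y by (simp add: dist_norm norm_minus_commute inner_diff_left)
    qed
  qed
  then have "ball x e \<subseteq> interior (closure D)"
    by (simp add: interior_maximal)
  then show ?thesis
    using convex_interior_closure[OF D(1)] interior_open[OF D(2)] by simp
qed

text \<open>A nonzero functional has no maximum on an open set, so the inequality stays strict when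
  \<open>x\<close> is a boundary point. Strictness gives the contradiction in
  \<open>disc_in_closure_imp_in_domain\<close> and the positivity that Harnack's inequality asks
  for.\<close>

lemma separating_half_space_open:
  fixes D :: "'a::euclidean_space set"
  assumes "convex D" "open D" "x \<notin> D"
  obtains a where "norm a = 1" "\<And>y. y \<in> D \<Longrightarrow> y \<bullet> a < x \<bullet> a"
proof (cases "x \<in> closure D")
  case True
  have ri: "rel_interior D = D"
    using assms(2) by (rule rel_interior_open)
  then obtain a where a: "a \<noteq> 0" "\<And>y. y \<in> D \<Longrightarrow> a \<bullet> x < a \<bullet> y"
    using supporting_hyperplane_relative_frontier[OF assms(1) True] assms(3) by metis
  show ?thesis
  proof
    show "norm (- a /\<^sub>R norm a) = 1"
      using a by simp
    show "y \<bullet> (- a /\<^sub>R norm a) < x \<bullet> (- a /\<^sub>R norm a)" if "y \<in> D" for y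
      using a(2)[OF that] a(1) by (simp add: inner_commute field_simps)
  qed
next
  case False
  then obtain a b where ab: "a \<bullet> x < b" "\<forall>y\<in>closure D. a \<bullet> y > b"
    using separating_hyperplane_closed_point[of "closure D" x] assms(1) by (auto simp: convex_closure)
  show ?thesis
  proof (cases "a = 0")
    case True
    then have "D = {}"
      using ab closure_subset[of D] by fastforce
    \<comment> \<open>With \<open>D\<close> empty, any unit vector separates.\<close>
    then show ?thesis
      using that[of "SOME i. i \<in> Basis"] by (simp add: some_in_eq)
  next
    case a: False
    show ?thesis
    proof
      show "norm (- a /\<^sub>R norm a) = 1"
        using a by simp
      show "y \<bullet> (- a /\<^sub>R norm a) < x \<bullet> (- a /\<^sub>R norm a)" if "y \<in> D" for y
      proof -
        have "a \<bullet> x < a \<bullet> y"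
          using ab closure_subset[of D] that by (meson less_trans subset_eq)
        then show ?thesis
          using a by (simp add: inner_commute field_simps)
      qed
    qed
  qed
qed

text \<open>Where the disc leaves \<open>D\<close> it touches a supporting hyperplane, and the
  exponential of the functional has maximal modulus there. It is then constant, although its modulus
  is strictly smaller at \<open>z0\<close>.\<close>

lemma disc_in_closure_imp_in_domain:
  fixes D :: "(complex ^ 'n) set"
  assumes D: "convex D" "open D"
    and \<phi>: "holomorphic_disc_map \<phi>" "\<phi> ` unit_disc \<subseteq> closure D"
    and z0: "z0 \<in> unit_disc" "\<phi> z0 \<in> D"
  shows "\<phi> ` unit_disc \<subseteq> D"
proof (rule ccontr)
  assume "\<not> \<phi> ` unit_disc \<subseteq> D"
  then obtain z where z: "z \<in> unit_disc" "\<phi> z \<notin> D"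
    by blast
  obtain a where a: "norm a = 1" "\<And>y. y \<in> D \<Longrightarrow> y \<bullet> a < \<phi> z \<bullet> a"
    using separating_half_space_open[OF D z(2)] by metis
  have cl: "y \<bullet> a \<le> \<phi> z \<bullet> a" if "y \<in> closure D" for y
  proof -
    have "D \<subseteq> {y. a \<bullet> y \<le> \<phi> z \<bullet> a}"
      using a(2) by (auto simp: inner_commute intro: less_imp_le)
    then have "closure D \<subseteq> {y. a \<bullet> y \<le> \<phi> z \<bullet> a}"
      by (intro closure_minimal closed_halfspace_le)
    then show ?thesis
      using that by (auto simp: inner_commute)
  qed
  define f where "f = (\<lambda>z. exp (hdot (\<phi> z) a))"
  have "f constant_on unit_disc"
  proof (rule maximum_modulus_principle[where U = unit_disc and \<xi> = z])
    show "f holomorphic_on unit_disc"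
      unfolding f_def by (intro holomorphic_intros holomorphic_hdot \<phi>)
    show "cmod (f w) \<le> cmod (f z)" if "w \<in> unit_disc" for w
      using cl[of "\<phi> w"] \<phi>(2) that by (simp add: f_def Re_hdot image_subset_iff)
  qed (use z in auto)
  then have "cmod (f z0) = cmod (f z)"
    using z z0 by (metis constant_on_def)
  then show False
    using a(2)[OF z0(2)] by (simp add: f_def Re_hdot)
qed

section \<open>Extremal discs\<close>

text \<open>The scalar theorem treats one coordinate at a time; each new coordinate passes to a
  further subsequence, along which the earlier limits persist.\<close>

lemma Montel_coordinates:
  fixes \<phi> :: "nat \<Rightarrow> complex \<Rightarrow> complex ^ 'n"
  assumes hol: "\<And>n. holomorphic_disc_map (\<phi> n)"
    and D: "bounded D" "\<And>n. \<phi> n ` unit_disc \<subseteq> D" and S: "finite S"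
  shows "\<exists>r. strict_mono (r :: nat \<Rightarrow> nat) \<and> (\<forall>i\<in>S. \<exists>g. g holomorphic_on unit_disc \<and>
           (\<forall>K. compact K \<and> K \<subseteq> unit_disc \<longrightarrow>
              uniform_limit K (\<lambda>n z. \<phi> (r n) z $ i) g sequentially))"
  using S
proof induction
  case empty
  then show ?case
    using strict_mono_id by blast
next
  case (insert i S)
  then obtain r where r: "strict_mono r" "\<forall>i\<in>S. \<exists>g. g holomorphic_on unit_disc \<and>
           (\<forall>K. compact K \<and> K \<subseteq> unit_disc \<longrightarrow>
              uniform_limit K (\<lambda>n z. \<phi> (r n) z $ i) g sequentially)"
    by blast
  obtain B where B: "\<And>x. x \<in> D \<Longrightarrow> norm x \<le> B"
    using D(1) bounded_iff by blast
  define \<H> where "\<H> = {h. h holomorphic_on unit_disc \<and> (\<forall>z\<in>unit_disc. cmod (h z) \<le> B)}"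
  have "cmod (\<phi> n z $ i) \<le> B" if "cmod z < 1" for n z
  proof -
    have "\<phi> n z \<in> D"
      using D(2)[of n] that by (simp add: image_subset_iff)
    then show ?thesis
      using B Finite_Cartesian_Product.norm_nth_le[of "\<phi> n z" i] by (meson order_trans)
  qed
  then have rng: "range (\<lambda>n z. \<phi> (r n) z $ i) \<subseteq> \<H>"
    using hol by (auto simp: \<H>_def holomorphic_disc_map_def)
  obtain g r' where g: "g holomorphic_on unit_disc" "strict_mono r'"
      "\<And>K. \<lbrakk>compact K; K \<subseteq> unit_disc\<rbrakk> \<Longrightarrow> uniform_limit K ((\<lambda>n z. \<phi> (r n) z $ i) \<circ> r') g sequentially"
    by (rule Montel[OF open_ball _ _ rng]) (force simp: \<H>_def)+
  have sub: "uniform_limit K (\<lambda>n z. \<phi> (r (r' n)) z $ j) f sequentially"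
    if "uniform_limit K (\<lambda>n z. \<phi> (r n) z $ j) f sequentially" for j f K
    using filterlim_compose[OF that filterlim_subseq[OF g(2)]] .
  show ?case
  proof (intro exI[of _ "r \<circ> r'"] conjI ballI)
    show "strict_mono (r \<circ> r')"
      using r(1) g(2) by (rule strict_mono_o)
    fix j assume j: "j \<in> insert i S"
    show "\<exists>g. g holomorphic_on unit_disc \<and> (\<forall>K. compact K \<and> K \<subseteq> unit_disc \<longrightarrow>
              uniform_limit K (\<lambda>n z. \<phi> ((r \<circ> r') n) z $ j) g sequentially)"
    proof (cases "j = i")
      case True
      then show ?thesis
        using g by (auto simp: o_def)
    next
      case False
      then have "j \<in> S"
        using j by simp
      then obtain f where "f holomorphic_on unit_disc" "\<And>K. compact K \<and> K \<subseteq> unit_disc \<Longrightarrow>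
          uniform_limit K (\<lambda>n z. \<phi> (r n) z $ j) f sequentially"
        using r(2) by blast
      then show ?thesis
        using sub by (intro exI[of _ f]) (simp add: o_def)
    qed
  qed
qed

text \<open>Convergence is phrased along moving parameters because the discs reach their prescribed
  points at parameters that vary with \<open>n\<close>. The bound \<open>\<rho>\<close> keeps these
  in a compact subdisc, where convergence is uniform.\<close>

lemma Montel_disc_maps:
  fixes \<phi> :: "nat \<Rightarrow> complex \<Rightarrow> complex ^ 'n"
  assumes hol: "\<And>n. holomorphic_disc_map (\<phi> n)"
    and D: "bounded D" "\<And>n. \<phi> n ` unit_disc \<subseteq> D"
  obtains r g where "strict_mono (r :: nat \<Rightarrow> nat)" "holomorphic_disc_map g"
    "\<And>\<alpha> a \<rho>. \<rho> < 1 \<Longrightarrow> (\<And>n. cmod (\<alpha> n) \<le> \<rho>) \<Longrightarrow> \<alpha> \<longlonglongrightarrow> a \<Longrightarrow> (\<lambda>n. \<phi> (r n) (\<alpha> n)) \<longlonglongrightarrow> g a"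
proof -
  have "\<exists>r. strict_mono (r :: nat \<Rightarrow> nat) \<and> (\<forall>i\<in>UNIV. \<exists>g. g holomorphic_on unit_disc \<and>
           (\<forall>K. compact K \<and> K \<subseteq> unit_disc \<longrightarrow>
              uniform_limit K (\<lambda>n z. \<phi> (r n) z $ i) g sequentially))"
    using Montel_coordinates[OF hol D finite] .
  then obtain r where r: "strict_mono (r :: nat \<Rightarrow> nat)" and ex: "\<forall>i. \<exists>g. g holomorphic_on unit_disc \<and>
           (\<forall>K. compact K \<and> K \<subseteq> unit_disc \<longrightarrow>
              uniform_limit K (\<lambda>n z. \<phi> (r n) z $ i) g sequentially)"
    by auto
  obtain G where G: "\<And>i. G i holomorphic_on unit_disc"
      "\<And>i K. compact K \<Longrightarrow> K \<subseteq> unit_disc \<Longrightarrow> uniform_limit K (\<lambda>n z. \<phi> (r n) z $ i) (G i) sequentially"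
    using choice[OF ex] by blast
  show ?thesis
  proof
    show "strict_mono r" by (rule r)
    show "holomorphic_disc_map (\<lambda>z. \<chi> i. G i z)"
      using G(1) by (simp add: holomorphic_disc_map_def)
    fix \<alpha> a \<rho> assume \<alpha>: "\<rho> < 1" "\<And>n. cmod (\<alpha> n) \<le> \<rho>" "\<alpha> \<longlonglongrightarrow> a"
    have a: "cmod a \<le> \<rho>"
      using \<alpha>(3) by (intro LIMSEQ_le_const2[OF tendsto_norm]) (use \<alpha>(2) in auto)
    show "(\<lambda>n. \<phi> (r n) (\<alpha> n)) \<longlonglongrightarrow> (\<chi> i. G i a)"
    proof (rule vec_tendstoI)
      fix i
      have "(\<lambda>n. G i (\<alpha> n)) \<longlonglongrightarrow> G i a"
      proof (rule continuous_on_tendsto_compose[OF holomorphic_on_imp_continuous_on[OF G(1)] \<alpha>(3)])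
        show "\<forall>\<^sub>F n in sequentially. \<alpha> n \<in> unit_disc"
          using \<alpha>(1,2) by (intro always_eventually) (auto intro: le_less_trans)
      qed (use a \<alpha>(1) in auto)
      moreover have "(\<lambda>n. \<phi> (r n) (\<alpha> n) $ i - G i (\<alpha> n)) \<longlonglongrightarrow> 0"
      proof (rule metric_LIMSEQ_I)
        fix e :: real assume "0 < e"
        have "uniform_limit (cball 0 \<rho>) (\<lambda>n z. \<phi> (r n) z $ i) (G i) sequentially"
          using \<alpha>(1) by (intro G(2)) auto
        then obtain N where "\<forall>n\<ge>N. \<forall>z\<in>cball 0 \<rho>. dist (\<phi> (r n) z $ i) (G i z) < e"
          using \<open>0 < e\<close> unfolding uniform_limit_sequentially_iff by blast
        then show "\<exists>N. \<forall>n\<ge>N. dist (\<phi> (r n) (\<alpha> n) $ i - G i (\<alpha> n)) 0 < e"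
          using \<alpha>(2) by (intro exI[of _ N]) (auto simp: dist_norm)
      qed
      ultimately have "(\<lambda>n. (\<phi> (r n) (\<alpha> n) $ i - G i (\<alpha> n)) + G i (\<alpha> n)) \<longlonglongrightarrow> 0 + G i a"
        by (intro tendsto_add)
      then show "(\<lambda>n. \<phi> (r n) (\<alpha> n) $ i) \<longlonglongrightarrow> (\<chi> i. G i a) $ i"
        by simp
    qed
  qed
qed

locale bounded_convex_domain =
  fixes D :: "(complex ^ 'n) set"
  assumes op: "open D" and cv: "convex D" and bd: "bounded D" and ne: "D \<noteq> {}"
begin

definition disc_in :: "(complex \<Rightarrow> complex ^ 'n) \<Rightarrow> bool" where
  "disc_in \<phi> \<longleftrightarrow> holomorphic_disc_map \<phi> \<and> \<phi> ` unit_disc \<subseteq> D"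

lemma disc_in_mem: "disc_in \<phi> \<Longrightarrow> cmod z < 1 \<Longrightarrow> \<phi> z \<in> D"
  by (auto simp: disc_in_def image_subset_iff)

lemma disc_in_compose:
  assumes "disc_in \<phi>" "g holomorphic_on unit_disc" "g ` unit_disc \<subseteq> unit_disc"
  shows "disc_in (\<phi> \<circ> g)"
  using assms holomorphic_disc_map_compose by (fastforce simp: disc_in_def)

lemma disc_in_Moebius: "disc_in \<phi> \<Longrightarrow> cmod a < 1 \<Longrightarrow> disc_in (\<phi> \<circ> Moebius_function 0 a)"
  by (intro disc_in_compose Moebius_function_holomorphic Moebius_maps_disc)

lemma lempert_le:
  assumes "disc_in \<phi>" "cmod z < 1" "cmod w < 1"
  shows "lempert D (\<phi> z) (\<phi> w) \<le> artanh (pseudohyp z w)"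
proof -
  define \<alpha> where "\<alpha> = Moebius_function 0 z w"
  have "disc_in (\<phi> \<circ> Moebius_function 0 (-z))"
    using assms by (simp add: disc_in_Moebius)
  moreover have "cmod \<alpha> < 1" "cmod \<alpha> = pseudohyp z w"
    using assms by (simp_all add: \<alpha>_def Moebius_function_norm_lt_1 pseudohyp_def)
  moreover have "(\<phi> \<circ> Moebius_function 0 (-z)) 0 = \<phi> z" "(\<phi> \<circ> Moebius_function 0 (-z)) \<alpha> = \<phi> w"
    using assms by (simp_all add: \<alpha>_def Moebius_minus_0 Moebius_inverse)
  ultimately show ?thesis
    unfolding lempert_def
    by (intro cInf_lower bdd_belowI[of _ 0])
       (auto simp: disc_in_def intro!: artanh_nonneg exI[of _ \<alpha>] exI[of _ "\<phi> \<circ> Moebius_function 0 (-z)"])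
qed

lemma lempert_less_imp_disc:
  assumes "z \<in> D" "w \<in> D" "lempert D z w < B"
  obtains \<phi> \<alpha> where "disc_in \<phi>" "cmod \<alpha> < 1" "\<phi> 0 = z" "\<phi> \<alpha> = w" "artanh (cmod \<alpha>) < B"
proof -
  let ?S = "{artanh (cmod \<alpha>) |\<alpha>. \<alpha> \<in> unit_disc \<and>
            (\<exists>\<phi>. holomorphic_disc_map \<phi> \<and> \<phi> ` unit_disc \<subseteq> D \<and> \<phi> 0 = z \<and> \<phi> \<alpha> = w)}"
  have "?S \<noteq> {}"
    using ex_disc_through_points[OF op cv assms(1,2)] by blast
  moreover have "bdd_below ?S"
    by (intro bdd_belowI[of _ 0]) (auto intro!: artanh_nonneg)
  ultimately have "\<exists>x\<in>?S. x < B"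
    using assms(3) unfolding lempert_def by (simp add: cInf_less_iff)
  then show ?thesis
    using that by (auto simp: disc_in_def)
qed

text \<open>A minimising sequence has parameters bounded away from the circle, so the limit
  parameter stays in the disc; the limit disc lies in the closure of \<open>D\<close> and passes
  through \<open>z\<close>, hence cannot touch the boundary.\<close>

lemma extremal_disc_exists:
  assumes z: "z \<in> D" and w: "w \<in> D"
  obtains \<phi> \<alpha> where "disc_in \<phi>" "cmod \<alpha> < 1" "\<phi> 0 = z" "\<phi> \<alpha> = w" "lempert D z w = artanh (cmod \<alpha>)"
proof -
  define L where "L = lempert D z w"
  have "\<exists>\<phi> \<alpha>. disc_in \<phi> \<and> cmod \<alpha> < 1 \<and> \<phi> 0 = z \<and> \<phi> \<alpha> = w \<and> artanh (cmod \<alpha>) < L + 1 / real (Suc n)" for n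
  proof -
    have "lempert D z w < L + 1 / real (Suc n)"
      by (simp add: L_def)
    then show ?thesis
      using lempert_less_imp_disc[OF z w] by metis
  qed
  then obtain \<phi> \<alpha> where \<phi>: "\<And>n. disc_in (\<phi> n)" "\<And>n. cmod (\<alpha> n) < 1" "\<And>n. \<phi> n 0 = z" "\<And>n. \<phi> n (\<alpha> n) = w"
      "\<And>n. artanh (cmod (\<alpha> n)) < L + 1 / real (Suc n)"
    by metis
  define \<rho> where "\<rho> = tanh (L + 1)"
  have \<rho>: "\<rho> < 1"
    by (simp add: \<rho>_def tanh_real_lt_1)
  have \<alpha>\<rho>: "cmod (\<alpha> n) \<le> \<rho>" for n
  proof -
    have "1 / real (Suc n) \<le> 1"
      by simp
    then have "artanh (cmod (\<alpha> n)) \<le> L + 1"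
      using \<phi>(5)[of n] by linarith
    then show ?thesis
      using artanh_le_imp_le_tanh[of "cmod (\<alpha> n)"] \<phi>(2) by (simp add: \<rho>_def)
  qed
  then have "bounded (range \<alpha>)"
    by (auto simp: bounded_iff)
  then obtain a r1 where r1: "strict_mono (r1 :: nat \<Rightarrow> nat)" "(\<alpha> \<circ> r1) \<longlonglongrightarrow> a"
    using bounded_imp_convergent_subsequence by blast
  obtain r2 g where r2: "strict_mono r2" "holomorphic_disc_map g"
    "\<And>\<alpha> a \<rho>. \<rho> < 1 \<Longrightarrow> (\<And>n. cmod (\<alpha> n) \<le> \<rho>) \<Longrightarrow> \<alpha> \<longlonglongrightarrow> a \<Longrightarrow> (\<lambda>n. \<phi> (r1 (r2 n)) (\<alpha> n)) \<longlonglongrightarrow> g a"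
    by (rule Montel_disc_maps[of "\<lambda>n. \<phi> (r1 n)" D]) (use \<phi>(1) bd in \<open>auto simp: disc_in_def\<close>)
  have lim: "(\<lambda>n. \<alpha> (r1 (r2 n))) \<longlonglongrightarrow> a"
    using LIMSEQ_subseq_LIMSEQ[OF r1(2) r2(1)] by (simp add: o_def)
  have a: "cmod a \<le> \<rho>"
    using lim by (intro LIMSEQ_le_const2[OF tendsto_norm]) (use \<alpha>\<rho> in auto)
  have gz: "g 0 = z"
    using r2(3)[of 0 "\<lambda>_. 0" 0] by (simp add: \<phi>(3) LIMSEQ_const_iff)
  have ga: "g a = w"
    using r2(3)[OF \<rho> \<alpha>\<rho> lim] by (simp add: \<phi>(4) LIMSEQ_const_iff)
  have "g ` unit_disc \<subseteq> closure D"
  proof (rule image_subsetI)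
    fix x assume that: "x \<in> unit_disc"
    have "(\<lambda>n. \<phi> (r1 (r2 n)) x) \<longlonglongrightarrow> g x"
      using that by (intro r2(3)[of "cmod x"]) auto
    moreover have "\<phi> (r1 (r2 n)) x \<in> D" for n
      using disc_in_mem[OF \<phi>(1)] that by simp
    ultimately show "g x \<in> closure D"
      unfolding closure_sequential by (intro exI[of _ "\<lambda>n. \<phi> (r1 (r2 n)) x"]) simp
  qed
  then have "g ` unit_disc \<subseteq> D"
    using disc_in_closure_imp_in_domain[OF cv op r2(2), of 0] z gz by simp
  then have g: "disc_in g"
    using r2(2) by (simp add: disc_in_def)
  have "(\<lambda>n. artanh (cmod (\<alpha> (r1 (r2 n))))) \<longlonglongrightarrow> artanh (cmod a)"
    using a \<rho> norm_ge_zero[of a] by (intro tendsto_artanh tendsto_norm lim) linarith+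
  moreover have "(\<lambda>n. L + 1 / real (Suc (r1 (r2 n)))) \<longlonglongrightarrow> L"
  proof -
    have "(\<lambda>n. L + 1 / real (Suc n)) \<longlonglongrightarrow> L"
      using tendsto_add[OF tendsto_const[of L] LIMSEQ_inverse_real_of_nat]
      unfolding inverse_eq_divide add_0_right .
    from LIMSEQ_subseq_LIMSEQ[OF this strict_mono_o[OF r1(1) r2(1)]] show ?thesis
      unfolding o_def .
  qed
  ultimately have "artanh (cmod a) \<le> L"
    by (rule LIMSEQ_le) (intro exI[of _ 0] allI impI less_imp_le \<phi>(5))
  moreover have a1: "cmod a < 1"
    using a \<rho> by (rule le_less_trans)
  moreover have "L \<le> artanh (cmod a)"
    using lempert_le[OF g _ a1, of 0] unfolding gz ga pseudohyp_0 L_def by simp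
  ultimately show ?thesis
    using that[OF g a1 gz ga] unfolding L_def by linarith
qed

lemma lempert_same: "z \<in> D \<Longrightarrow> lempert D z z = 0"
  using lempert_le[of "\<lambda>_. z" 0 0] lempert_nonneg[OF op cv, of z z]
  by (simp add: disc_in_def holomorphic_disc_map_def pseudohyp_0 image_subset_iff)

lemma lempert_pos:
  assumes "z \<in> D" "w \<in> D" "z \<noteq> w"
  shows "0 < lempert D z w"
proof -
  obtain \<phi> \<alpha> where \<phi>: "disc_in \<phi>" "cmod \<alpha> < 1" "\<phi> 0 = z" "\<phi> \<alpha> = w" "lempert D z w = artanh (cmod \<alpha>)"
    by (rule extremal_disc_exists[OF assms(1,2)])
  have "\<alpha> \<noteq> 0"
    using \<phi>(3,4) assms(3) by auto
  then show ?thesis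
    using artanh_strict_mono[of 0 "cmod \<alpha>", OF order.refl _ \<phi>(2)] unfolding \<phi>(5) artanh_0 zero_less_norm_iff
    by blast
qed

lemma lempert_commute_le:
  assumes "z \<in> D" "w \<in> D"
  shows "lempert D w z \<le> lempert D z w"
proof -
  obtain \<phi> \<alpha> where \<phi>: "disc_in \<phi>" "cmod \<alpha> < 1" "\<phi> 0 = z" "\<phi> \<alpha> = w" "lempert D z w = artanh (cmod \<alpha>)"
    by (rule extremal_disc_exists[OF assms(1,2)])
  show ?thesis
    using lempert_le[OF \<phi>(1), of \<alpha> 0] \<phi>(2) by (simp add: \<phi>(3,4,5) pseudohyp_0)
qed

lemma lempert_commute: "z \<in> D \<Longrightarrow> w \<in> D \<Longrightarrow> lempert D w z = lempert D z w"
  by (intro antisym lempert_commute_le)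

end

section \<open>Equality of the Lempert function and the Kobayashi distance\<close>

text \<open>This cancels the poles of the multipliers: the difference of two discs that agree at
  \<open>a\<close> is divisible by \<open>z - a\<close>, with the derivative filling the removable
  singularity.\<close>

lemma holomorphic_disc_map_factor_root:
  fixes F :: "complex \<Rightarrow> complex ^ 'n"
  assumes F: "holomorphic_disc_map F" and a: "F a = 0"
  obtains \<kappa> where "holomorphic_disc_map \<kappa>" "\<And>z i. F z $ i = (z - a) * \<kappa> z $ i"
proof
  show "holomorphic_disc_map (\<lambda>z. \<chi> i. if z = a then deriv (\<lambda>z. F z $ i) a else F z $ i / (z - a))"
    unfolding holomorphic_disc_map_def
  proof (rule allI)
    fix i
    have "(\<lambda>z. if z = a then deriv (\<lambda>z. F z $ i) a else (F z $ i - F a $ i) / (z - a)) holomorphic_on unit_disc"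
      using F by (intro pole_lemma_open) (auto simp: holomorphic_disc_map_def)
    then show "(\<lambda>z. (\<chi> i. if z = a then deriv (\<lambda>z. F z $ i) a else F z $ i / (z - a)) $ i) holomorphic_on unit_disc"
      unfolding a zero_index diff_zero vec_lambda_beta .
  qed
qed (simp add: a)

lemma holomorphic_disc_map_diff:
  "holomorphic_disc_map F \<Longrightarrow> holomorphic_disc_map G \<Longrightarrow> holomorphic_disc_map (\<lambda>z. F z - G z)"
  by (simp add: holomorphic_disc_map_def holomorphic_on_diff)

lemma holomorphic_disc_map_add_scaled:
  assumes "holomorphic_disc_map F" "holomorphic_disc_map G" "k holomorphic_on unit_disc"
  shows "holomorphic_disc_map (\<lambda>z. F z + (\<chi> i. k z * G z $ i))"
  using assms by (auto simp: holomorphic_disc_map_def intro!: holomorphic_intros)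

lemma norm_vec_scale:
  fixes v :: "complex ^ 'n"
  shows "norm (\<chi> i. k * v $ i) = cmod k * norm v"
  by (simp add: norm_vec_def norm_mult L2_set_right_distrib)

text \<open>The source of all multipliers: on the circle each product
  \<open>(z - b) * (1 - cnj b * z)\<close> is \<open>z\<close> times a nonnegative real, so a
  quotient in which the powers of \<open>z\<close> balance is real there.\<close>

lemma unit_circle_factor:
  assumes "cmod z = 1"
  shows "(z - b) * (1 - cnj b * z) = z * of_real ((cmod (1 - cnj b * z))\<^sup>2)"
proof -
  have zz: "z * cnj z = 1"
    using assms complex_norm_square[of z] by simp
  have "z * of_real ((cmod (1 - cnj b * z))\<^sup>2) = z * ((1 - cnj b * z) * (1 - b * cnj z))"
    unfolding complex_norm_square by simp
  also have "\<dots> = (1 - cnj b * z) * (z - b * (z * cnj z))"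
    by (simp add: algebra_simps)
  finally show ?thesis
    by (simp add: zz mult.commute)
qed

lemma norm_one_minus_cnj_mult_bounds:
  assumes "cmod z = 1"
  shows "1 - cmod b \<le> cmod (1 - cnj b * z)" "cmod (1 - cnj b * z) \<le> 1 + cmod b"
  using norm_triangle_ineq2[of 1 "cnj b * z"] norm_triangle_ineq4[of 1 "cnj b * z"] assms
  by (simp_all add: norm_mult)

context bounded_convex_domain
begin

lemma half_space_margin:
  assumes b: "ball x m \<subseteq> D" and m: "0 < m" and a: "norm a = 1" "\<And>y. y \<in> D \<Longrightarrow> y \<bullet> a \<le> c"
  shows "x \<bullet> a \<le> c - m"
proof (rule ccontr)
  assume "\<not> x \<bullet> a \<le> c - m"
  then obtain s where s: "max 0 (c - x \<bullet> a) < s" "s < m"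
    using dense[of "max 0 (c - x \<bullet> a)" m] m by auto
  then have "x + s *\<^sub>R a \<in> ball x m"
    by (simp add: dist_norm a(1))
  then have "(x + s *\<^sub>R a) \<bullet> a \<le> c"
    using a(2) b by blast
  moreover have "a \<bullet> a = 1"
    using a(1) by (simp add: dot_square_norm)
  ultimately show False
    using s(1) by (simp add: inner_add_left)
qed

text \<open>The half-space estimate is applied to every half-space that contains \<open>D\<close>. A
  margin of \<open>\<psi>\<close> survives by the factor \<open>c0\<close>, because on the circle
  \<open>\<psi>\<close> enters with weight at least \<open>c0\<close>.\<close>

lemma
  fixes \<phi> \<psi> \<nu> :: "complex \<Rightarrow> complex ^ 'n"
  assumes \<phi>: "disc_in \<phi>" and \<psi>: "disc_in \<psi>" and \<nu>: "holomorphic_disc_map \<nu>"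
    and r1: "0 < r1" "r1 < 1" and cont: "continuous_on {z. r1 \<le> cmod z \<and> cmod z \<le> 1} \<mu>"
    and \<mu>: "\<And>z. cmod z = 1 \<Longrightarrow> \<exists>t. \<mu> z = of_real t \<and> c0 \<le> t \<and> t \<le> 1" and c0: "0 \<le> c0"
    and eq: "\<And>z i. r1 < cmod z \<Longrightarrow> cmod z < 1 \<Longrightarrow> \<nu> z $ i = \<phi> z $ i + \<mu> z * (\<psi> z $ i - \<phi> z $ i)"
    and z: "cmod z < 1"
  shows glued_disc_in_closure: "\<nu> z \<in> closure D"
    and glued_disc_margin: "\<lbrakk>0 < m; \<And>z. cmod z < 1 \<Longrightarrow> ball (\<psi> z) m \<subseteq> D\<rbrakk> \<Longrightarrow> ball (\<nu> z) (c0 * m) \<subseteq> D"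
proof -
  have img: "\<phi> ` unit_disc \<subseteq> D" "\<psi> ` unit_disc \<subseteq> D"
    using \<phi> \<psi> by (auto simp: disc_in_def)
  show "\<nu> z \<in> closure D"
  proof (rule in_closure_if_in_half_spaces[OF cv ne])
    fix a :: "complex ^ 'n" and c assume a: "norm a = 1" "\<And>y. y \<in> D \<Longrightarrow> y \<bullet> a \<le> c"
    show "\<nu> z \<bullet> a \<le> c"
    proof -
      have "\<psi> w \<bullet> a \<le> c - 0" if "w \<in> unit_disc" for w
        using a(2) disc_in_mem[OF \<psi>] that by simp
      from glued_disc_in_half_space[OF bd a(2) \<nu> img this order.refl r1 cont \<mu> c0 eq z]
      show ?thesis by simp
    qed
  qed
  assume m: "0 < m" "\<And>z. cmod z < 1 \<Longrightarrow> ball (\<psi> z) m \<subseteq> D"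
  show "ball (\<nu> z) (c0 * m) \<subseteq> D"
  proof (rule ball_subset_if_in_half_spaces[OF cv op ne])
    fix a :: "complex ^ 'n" and c assume a: "norm a = 1" "\<And>y. y \<in> D \<Longrightarrow> y \<bullet> a \<le> c"
    have "\<psi> w \<bullet> a \<le> c - m" if "w \<in> unit_disc" for w
      using that by (intro half_space_margin[OF m(2) m(1) a]) auto
    from glued_disc_in_half_space[OF bd a(2) \<nu> img this less_imp_le[OF m(1)] r1 cont \<mu> c0 eq z]
    show "\<nu> z \<bullet> a \<le> c - c0 * m"
      by simp
  qed
qed

lemma real_extremal_disc_exists:
  assumes "z \<in> D" "w \<in> D" "z \<noteq> w"
  obtains \<phi> a where "disc_in \<phi>" "0 < a" "a < 1" "\<phi> 0 = z" "\<phi> (of_real a) = w"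
    "lempert D z w = artanh a"
proof -
  obtain \<phi> \<alpha> where \<phi>: "disc_in \<phi>" "cmod \<alpha> < 1" "\<phi> 0 = z" "\<phi> \<alpha> = w" "lempert D z w = artanh (cmod \<alpha>)"
    by (rule extremal_disc_exists[OF assms(1,2)])
  have \<alpha>: "\<alpha> \<noteq> 0"
    using \<phi>(3,4) assms(3) by auto
  define u where "u = \<alpha> / of_real (cmod \<alpha>)"
  have u: "cmod u = 1" "u * of_real (cmod \<alpha>) = \<alpha>"
    using \<alpha> by (simp_all add: u_def norm_divide)
  show ?thesis
  proof
    show "disc_in (\<phi> \<circ> (\<lambda>z. u * z))"
      by (rule disc_in_compose[OF \<phi>(1)]) (auto intro!: holomorphic_intros simp: norm_mult u(1))
    show "0 < cmod \<alpha>" "cmod \<alpha> < 1" "lempert D z w = artanh (cmod \<alpha>)"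
      using \<alpha> \<phi>(2,5) by simp_all
    show "(\<phi> \<circ> (\<lambda>z. u * z)) 0 = z" "(\<phi> \<circ> (\<lambda>z. u * z)) (complex_of_real (cmod \<alpha>)) = w"
      using \<phi>(3,4) u(2) by simp_all
  qed
qed

text \<open>
  Here \<open>\<mu> = 1 - \<lambda>\<close> with \<open>\<lambda> x = (x - c) (x - 1/c) / ((x - a) (x - 1/a))\<close>, where the discs agree at \<open>a\<close>:
  on the unit circle \<open>\<lambda> x\<close> is the quotient of \<open>c + 1/c - 2 Re x\<close> by \<open>a + 1/a - 2 Re x\<close>, which lies
  in \<open>[0, 1]\<close> because \<open>a < c < 1\<close>; moreover \<open>\<lambda> 0 = 1\<close> and \<open>\<lambda> c = 0\<close>.
\<close>

lemma lempert_triangle: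
  assumes z: "z1 \<in> D" "z2 \<in> D" "z3 \<in> D"
  shows "lempert D z1 z3 \<le> lempert D z1 z2 + lempert D z2 z3"
proof (cases "z1 = z2 \<or> z2 = z3")
  case True
  then show ?thesis
    using lempert_same z by auto
next
  case False
  then have ne12: "z1 \<noteq> z2" and ne23: "z2 \<noteq> z3"
    by auto
  obtain \<phi> a where \<phi>: "disc_in \<phi>" and a: "0 < a" "a < 1" and \<phi>0: "\<phi> 0 = z1" and \<phi>a: "\<phi> (of_real a) = z2"
    and la: "lempert D z1 z2 = artanh a"
    by (rule real_extremal_disc_exists[OF z(1,2) ne12])
  obtain \<psi>' b where \<psi>': "disc_in \<psi>'" and b: "0 < b" "b < 1" and \<psi>'0: "\<psi>' 0 = z2" and \<psi>'b: "\<psi>' (of_real b) = z3"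
    and lb: "lempert D z2 z3 = artanh b"
    by (rule real_extremal_disc_exists[OF z(2,3) ne23])
  define A where "A = complex_of_real a"
  have cA: "cmod A = a" "cnj A = A"
    using a by (simp_all add: A_def)
  \<comment> \<open>The second disc is reparametrised so that it takes the common value
    \<open>z2\<close> at the same parameter \<open>A\<close> as the first.\<close>
  define \<psi> where "\<psi> = \<psi>' \<circ> Moebius_function 0 A"
  have \<psi>: "disc_in \<psi>"
    unfolding \<psi>_def using cA a by (intro disc_in_Moebius \<psi>') simp
  define c where "c = (a + b) / (1 + a * b)"
  have ab: "0 < 1 + a * b"
    using a b by (simp add: add_pos_pos)
  have c: "a < c" "c < 1"
  proof -
    have "a * a * b < 1 * b"
      using a b mult_strict_mono[of a 1 a 1] by (intro mult_strict_right_mono) auto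
    then have "a * (1 + a * b) < a + b"
      by (simp add: distrib_left)
    then show "a < c"
      using ab by (simp add: c_def pos_less_divide_eq)
    have "0 < (1 - a) * (1 - b)"
      using a b by simp
    then have "a + b < 1 + a * b"
      by (simp add: algebra_simps)
    then show "c < 1"
      using ab by (simp add: c_def)
  qed
  have lc: "artanh c = artanh a + artanh b"
    unfolding c_def using a b by (intro artanh_add) auto
  have Mc: "Moebius_function 0 A (of_real c) = of_real b"
  proof -
    have "Moebius_function 0 (-A) (of_real b) = of_real c"
      by (simp add: Moebius_function_simple A_def c_def add.commute)
    then show ?thesis
      using Moebius_inverse(1)[of A "of_real b"] cA a b by simp
  qed
  have \<psi>A: "\<psi> A = \<phi> A" and \<psi>c: "\<psi> (of_real c) = z3"
    by (simp_all add: \<psi>_def Moebius_function_eq_zero \<psi>'0 \<phi>a[folded A_def] Mc \<psi>'b)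
  have hol: "holomorphic_disc_map \<phi>" "holomorphic_disc_map \<psi>"
    using \<phi> \<psi> by (simp_all add: disc_in_def)
  obtain \<kappa> where \<kappa>: "holomorphic_disc_map \<kappa>" "\<And>z i. (\<psi> z - \<phi> z) $ i = (z - A) * \<kappa> z $ i"
    by (rule holomorphic_disc_map_factor_root[OF holomorphic_disc_map_diff[OF hol(2,1)], of A])
       (use \<psi>A in auto)
  \<comment> \<open>The value forced by \<open>\<mu> c = 1\<close>, which makes the glued disc take
    the value of \<open>\<psi>\<close> at \<open>c\<close>. The bound by
    \<open>(1 - a)\<^sup>2\<close> will give \<open>\<mu> \<le> 1\<close> on the circle.\<close>
  define k where "k = (c - a) * (1 - a * c) / c"
  have ac: "a * c < 1"
    using a c mult_strict_mono[of a 1 c 1] by simp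
  have k: "0 < k" "k \<le> (1 - a)\<^sup>2"
  proof -
    show "0 < k"
      using a c ac by (simp add: k_def)
    have "(1 - a)\<^sup>2 * c - (c - a) * (1 - a * c) = a * (1 - c)\<^sup>2"
      by (simp add: power2_eq_square algebra_simps)
    moreover have "0 \<le> a * (1 - c)\<^sup>2"
      using a by simp
    ultimately have "(c - a) * (1 - a * c) \<le> (1 - a)\<^sup>2 * c"
      by linarith
    then show "k \<le> (1 - a)\<^sup>2"
      using a c by (simp add: k_def pos_divide_le_eq)
  qed
  have nz: "1 - A * x \<noteq> 0" if "cmod x \<le> 1" for x
    using one_minus_cnj_mult_nonzero[of A x] that cA a by simp
  \<comment> \<open>This is \<open>\<phi> + \<mu> * (\<psi> - \<phi>)\<close> with the pole at
    \<open>A\<close> cancelled, hence holomorphic on the whole disc.\<close>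
  define \<nu> where "\<nu> = (\<lambda>x. \<phi> x + (\<chi> i. of_real k * x / (1 - A * x) * \<kappa> x $ i))"
  have \<nu>: "holomorphic_disc_map \<nu>"
    unfolding \<nu>_def
    by (intro holomorphic_disc_map_add_scaled hol \<kappa> holomorphic_intros) (use nz in auto)
  define \<mu> where "\<mu> = (\<lambda>x. of_real k * x / ((x - A) * (1 - A * x)))"
  define r where "r = (1 + a) / 2"
  have r: "0 < r" "r < 1" "a < r"
    using a by (simp_all add: r_def)
  have xA: "x - A \<noteq> 0" if "r \<le> cmod x" for x
    using that r cA by auto
  have cl: "\<nu> x \<in> closure D" if "x \<in> unit_disc" for x
  proof (rule glued_disc_in_closure[OF \<phi> \<psi> \<nu> r(1,2)])
    show "continuous_on {z. r \<le> cmod z \<and> cmod z \<le> 1} \<mu>"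
      unfolding \<mu>_def by (intro continuous_intros) (use nz xA in auto)
    show "\<nu> z $ i = \<phi> z $ i + \<mu> z * (\<psi> z $ i - \<phi> z $ i)" if "r < cmod z" "cmod z < 1" for z i
      using \<kappa>(2)[of z i] xA[of z] that by (simp add: \<nu>_def \<mu>_def)
    show "\<exists>t. \<mu> z = complex_of_real t \<and> 0 \<le> t \<and> t \<le> 1" if z: "cmod z = 1" for z
    proof (intro exI conjI)
      let ?n = "cmod (1 - A * z)"
      have "(z - A) * (1 - A * z) = z * of_real (?n\<^sup>2)"
        using unit_circle_factor[OF z, of A] cA by simp
      moreover have "z \<noteq> 0"
        using z by auto
      ultimately show "\<mu> z = of_real (k / ?n\<^sup>2)"
        by (simp add: \<mu>_def)
      show "0 \<le> k / ?n\<^sup>2"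
        using k by simp
      have "1 - a \<le> ?n"
        using norm_one_minus_cnj_mult_bounds(1)[OF z, of A] cA by simp
      then have "(1 - a)\<^sup>2 \<le> ?n\<^sup>2"
        using a by (intro power_mono) auto
      moreover have "0 < ?n"
        using nz[of z] z by simp
      ultimately show "k / ?n\<^sup>2 \<le> 1"
        using k by (simp add: pos_divide_le_eq)
    qed
  qed (use that in auto)
  have \<nu>0: "\<nu> 0 = z1"
    by (simp add: \<nu>_def \<phi>0 vec_eq_iff)
  have \<nu>c: "\<nu> (of_real c) = z3"
  proof -
    have kc: "of_real k * of_real c / (1 - A * of_real c) = of_real c - A"
    proof -
      have "k * c / (1 - a * c) = c - a"
        using a c ac by (simp add: k_def)
      then have "complex_of_real (k * c / (1 - a * c)) = of_real (c - a)"
        by simp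
      then show ?thesis
        by (simp add: A_def)
    qed
    have "\<nu> (of_real c) $ i = \<psi> (of_real c) $ i" for i
    proof -
      have "\<nu> (of_real c) $ i = \<phi> (of_real c) $ i +
          of_real k * of_real c / (1 - A * of_real c) * \<kappa> (of_real c) $ i"
        by (simp add: \<nu>_def)
      then show ?thesis
        unfolding kc \<kappa>(2)[of "of_real c" i, symmetric] by simp
    qed
    then show ?thesis
      using \<psi>c by (simp add: vec_eq_iff)
  qed
  have "\<nu> ` unit_disc \<subseteq> D"
    using cl \<nu>0 z(1) by (intro disc_in_closure_imp_in_domain[OF cv op \<nu>, of 0]) auto
  then have "disc_in \<nu>"
    using \<nu> by (simp add: disc_in_def)
  from lempert_le[OF this, of 0 "of_real c"] have "lempert D z1 z3 \<le> artanh c"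
    using a c by (simp add: \<nu>0 \<nu>c pseudohyp_0)
  then show ?thesis
    by (simp add: la lb lc)
qed

text \<open>With the triangle inequality, the Lempert function is itself a pseudodistance, hence the
  largest one below itself.\<close>

lemma kobayashi_eq_lempert:
  assumes "z \<in> D" "w \<in> D"
  shows "kobayashi_dist D z w = lempert D z w"
proof (rule antisym)
  show "kobayashi_dist D z w \<le> lempert D z w"
    using kobayashi_dist_greatest(2)[OF op cv assms] .
  have "pseudodistance_on D (lempert D)"
    unfolding pseudodistance_on_def
    using lempert_same lempert_commute lempert_triangle lempert_nonneg[OF op cv] by simp
  then show "lempert D z w \<le> kobayashi_dist D z w"
    using kobayashi_dist_greatest(3)[OF op cv _ _ assms] by simp
qed

end

section \<open>Complex geodesics\<close>

text \<open>\<open>f\<close> is the Cayley transform of \<open>g\<close> that sends the right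
  half-plane to the disc and \<open>g 0\<close> to 0. The Schwarz bound for \<open>f\<close> becomes
  a quadratic inequality in the real parts at 0 and \<open>z\<close>, which factorises; if the first
  factor were positive, so would be the second.\<close>

lemma harnack_disc:
  assumes g: "g holomorphic_on unit_disc" and pos: "\<And>z. cmod z < 1 \<Longrightarrow> 0 < Re (g z)"
    and z: "cmod z < 1"
  shows "Re (g 0) * (1 - cmod z) \<le> Re (g z) * (1 + cmod z)"
proof -
  define x0 where "x0 = Re (g 0)"
  define x where "x = Re (g z)"
  define r where "r = cmod z"
  have x: "0 < x0" "0 < x" and r: "0 \<le> r" "r < 1"
    using pos[of 0] pos[OF z] z by (simp_all add: x0_def x_def r_def)
  have sq: "(cmod (g w + cnj (g 0)))\<^sup>2 - (cmod (g w - g 0))\<^sup>2 = 4 * Re (g w) * x0" for w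
    by (simp add: cmod_power2 x0_def) (simp add: power2_eq_square algebra_simps)
  have lt: "cmod (g w - g 0) < cmod (g w + cnj (g 0))" if "cmod w < 1" for w
  proof -
    have "0 < 4 * Re (g w) * x0"
      using pos[OF that] x by simp
    then have "(cmod (g w - g 0))\<^sup>2 < (cmod (g w + cnj (g 0)))\<^sup>2"
      using sq[of w] by linarith
    then show ?thesis
      by (rule power2_less_imp_less) simp
  qed
  have nz: "g w + cnj (g 0) \<noteq> 0" if "cmod w < 1" for w
    using lt[OF that] by auto
  define f where "f = (\<lambda>w. (g w - g 0) / (g w + cnj (g 0)))"
  have "f holomorphic_on unit_disc"
    unfolding f_def using nz by (intro holomorphic_intros g) auto
  moreover have "f 0 = 0"
    by (simp add: f_def)
  moreover have "cmod (f w) < 1" if "cmod w < 1" for w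
    using lt[OF that] nz[OF that] by (simp add: f_def norm_divide)
  ultimately have "cmod (f z) \<le> r"
    using Schwarz_Lemma(1)[of f z] z by (simp add: r_def)
  then have "cmod (g z - g 0) \<le> r * cmod (g z + cnj (g 0))"
    using nz[OF z] by (simp add: f_def norm_divide pos_divide_le_eq)
  then have "(cmod (g z - g 0))\<^sup>2 \<le> (r * cmod (g z + cnj (g 0)))\<^sup>2"
    by (intro power_mono) auto
  then have "(1 - r\<^sup>2) * (cmod (g z + cnj (g 0)))\<^sup>2 \<le> 4 * x * x0"
    using sq[of z] by (simp add: power_mult_distrib algebra_simps x_def)
  moreover have "(1 - r\<^sup>2) * (x + x0)\<^sup>2 \<le> (1 - r\<^sup>2) * (cmod (g z + cnj (g 0)))\<^sup>2"
  proof (rule mult_left_mono)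
    have "x + x0 \<le> cmod (g z + cnj (g 0))"
      using complex_Re_le_cmod[of "g z + cnj (g 0)"] by (simp add: x_def x0_def)
    then show "(x + x0)\<^sup>2 \<le> (cmod (g z + cnj (g 0)))\<^sup>2"
      using x by (intro power_mono) auto
    show "0 \<le> 1 - r\<^sup>2"
      using r by (simp add: power_le_one)
  qed
  ultimately have "(1 - r\<^sup>2) * (x + x0)\<^sup>2 - 4 * x * x0 \<le> 0"
    by linarith
  moreover have "(1 - r\<^sup>2) * (x + x0)\<^sup>2 - 4 * x * x0 =
      ((1 - r) * x0 - (1 + r) * x) * ((1 + r) * x0 - (1 - r) * x)"
    by (simp add: power2_eq_square algebra_simps)
  ultimately have le: "((1 - r) * x0 - (1 + r) * x) * ((1 + r) * x0 - (1 - r) * x) \<le> 0"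
    by simp
  have "(1 - r) * x0 \<le> (1 + r) * x"
  proof (rule ccontr)
    assume "\<not> (1 - r) * x0 \<le> (1 + r) * x"
    then have 1: "0 < (1 - r) * x0 - (1 + r) * x"
      by simp
    have "(1 - r) * x \<le> (1 + r) * x" "(1 - r) * x0 \<le> (1 + r) * x0"
      using r x by (auto intro: mult_right_mono)
    then have "0 < (1 + r) * x0 - (1 - r) * x"
      using 1 by linarith
    from mult_pos_pos[OF 1 this] show False
      using le by linarith
  qed
  then show ?thesis
    by (simp add: x_def x0_def r_def mult.commute)
qed

context bounded_convex_domain
begin

text \<open>A uniform margin leaves room to reach \<open>\<nu> \<alpha>\<close> sooner, at
  \<open>\<beta> = s * \<alpha>\<close> with \<open>s\<close> slightly below 1: the correction by
  the linear map that sends \<open>\<beta>\<close> to \<open>\<nu> \<alpha> - \<nu> \<beta>\<close>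
  is smaller than \<open>e\<close> on the disc, since \<open>\<nu> \<beta>\<close> is close to
  \<open>\<nu> \<alpha>\<close> and \<open>cmod \<beta>\<close> is at least
  \<open>cmod \<alpha> / 2\<close>.\<close>

lemma interior_disc_not_extremal:
  assumes \<nu>: "holomorphic_disc_map \<nu>" and e: "0 < e" and b: "\<And>z. cmod z < 1 \<Longrightarrow> ball (\<nu> z) e \<subseteq> D"
    and \<alpha>: "\<alpha> \<noteq> 0" "cmod \<alpha> < 1"
  shows "lempert D (\<nu> 0) (\<nu> \<alpha>) < artanh (cmod \<alpha>)"
proof -
  have "\<alpha> \<in> unit_disc" "0 < e * cmod \<alpha> / 2"
    using e \<alpha> by auto
  then obtain d where d: "0 < d" "\<And>x. cmod x < 1 \<Longrightarrow> dist x \<alpha> < d \<Longrightarrow> dist (\<nu> x) (\<nu> \<alpha>) < e * cmod \<alpha> / 2"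
    using holomorphic_disc_map_continuous[OF \<nu>] unfolding continuous_on_iff by (metis mem_ball_0)
  define s where "s = max (1 / 2) (1 - d / 2)"
  have s: "1 / 2 \<le> s" "s < 1" "1 - s < d"
    using d(1) by (auto simp: s_def)
  define \<beta> where "\<beta> = of_real s * \<alpha>"
  have \<beta>: "cmod \<beta> = s * cmod \<alpha>" "\<beta> \<noteq> 0"
    using s \<alpha> by (auto simp: \<beta>_def norm_mult)
  have \<beta>lt: "cmod \<beta> < cmod \<alpha>"
    using s \<alpha> by (simp add: \<beta>)
  then have \<beta>1: "cmod \<beta> < 1"
    using \<alpha> by simp
  have "dist \<beta> \<alpha> = (1 - s) * cmod \<alpha>"
  proof -
    have "\<beta> - \<alpha> = of_real (s - 1) * \<alpha>"
      by (simp add: \<beta>_def algebra_simps)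
    then have "cmod (\<beta> - \<alpha>) = \<bar>s - 1\<bar> * cmod \<alpha>"
      by (simp only: norm_mult norm_of_real)
    then show ?thesis
      using s by (simp add: dist_norm)
  qed
  also have "\<dots> \<le> 1 - s"
    using s \<alpha> by (simp add: mult_left_le)
  finally have "dist (\<nu> \<beta>) (\<nu> \<alpha>) < e * cmod \<alpha> / 2"
    using s \<beta>1 by (intro d(2)) auto
  also have "\<dots> \<le> e * cmod \<beta>"
    using mult_right_mono[OF s(1), of "cmod \<alpha>"] mult_left_mono[of "cmod \<alpha> / 2" "cmod \<beta>" e] e
    by (simp add: \<beta>(1))
  finally have close: "norm (\<nu> \<alpha> - \<nu> \<beta>) < e * cmod \<beta>"
    by (simp add: dist_norm norm_minus_commute)
  define \<nu>' where "\<nu>' = (\<lambda>z. \<nu> z + (\<chi> i. z / \<beta> * (\<nu> \<alpha> - \<nu> \<beta>) $ i))"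
  have "holomorphic_disc_map \<nu>'"
    unfolding \<nu>'_def using \<beta>
    by (intro holomorphic_disc_map_add_scaled \<nu>) (auto simp: holomorphic_disc_map_def intro!: holomorphic_intros)
  moreover have "\<nu>' z \<in> D" if "cmod z < 1" for z
  proof -
    have n: "norm (x - (x + y)) = norm y" for x y :: "complex ^ 'n"
      by simp
    have "dist (\<nu> z) (\<nu>' z) = cmod z / cmod \<beta> * norm (\<nu> \<alpha> - \<nu> \<beta>)"
      unfolding dist_norm \<nu>'_def n norm_vec_scale norm_divide by (rule refl)
    also have "\<dots> \<le> 1 / cmod \<beta> * norm (\<nu> \<alpha> - \<nu> \<beta>)"
      using that by (intro mult_right_mono divide_right_mono) auto
    also have "\<dots> < e"
      using close \<beta>(2) by (simp add: pos_divide_less_eq)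
    finally show ?thesis
      using b[OF that] by auto
  qed
  ultimately have "disc_in \<nu>'"
    by (auto simp: disc_in_def)
  from lempert_le[OF this, of 0 \<beta>] \<beta>1 have "lempert D (\<nu>' 0) (\<nu>' \<beta>) \<le> artanh (cmod \<beta>)"
    by (simp add: pseudohyp_0)
  moreover have "\<nu>' 0 = \<nu> 0" "\<nu>' \<beta> = \<nu> \<alpha>"
    using \<beta>(2) by (simp_all add: \<nu>'_def vec_eq_iff)
  moreover have "artanh (cmod \<beta>) < artanh (cmod \<alpha>)"
    using \<beta>lt \<alpha> by (intro artanh_strict_mono) auto
  ultimately show ?thesis
    by simp
qed

text \<open>
  A better disc \<open>\<psi>\<close> through \<open>\<phi> \<zeta>\<close> and \<open>\<phi> \<eta>\<close> is relatively compact in the domain after a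
  dilation. The multiplier has its poles at \<open>\<zeta>\<close> and \<open>\<eta>\<close>, vanishes at 0 and \<open>\<alpha>\<close>, and is bounded below on
  the circle, so the glued disc passes through \<open>\<phi> 0\<close> and \<open>\<phi> \<alpha>\<close> and is relatively compact.
\<close>

lemma nonextremal_propagates:
  assumes \<phi>: "disc_in \<phi>" and \<zeta>: "cmod \<zeta> < 1" and \<eta>: "cmod \<eta> < 1" and \<alpha>: "\<alpha> \<noteq> 0" "cmod \<alpha> < 1"
    and less: "lempert D (\<phi> \<zeta>) (\<phi> \<eta>) < artanh (pseudohyp \<zeta> \<eta>)"
  shows "lempert D (\<phi> 0) (\<phi> \<alpha>) < artanh (cmod \<alpha>)"
proof -
  have ne: "\<zeta> \<noteq> \<eta>"
    using less lempert_same[OF disc_in_mem[OF \<phi> \<eta>]] by (auto simp: pseudohyp_def Moebius_function_eq_zero)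
  obtain \<psi>0 \<beta> where \<psi>0: "disc_in \<psi>0" "cmod \<beta> < 1" "\<psi>0 0 = \<phi> \<zeta>" "\<psi>0 \<beta> = \<phi> \<eta>"
      and a\<beta>: "artanh (cmod \<beta>) < artanh (pseudohyp \<zeta> \<eta>)"
    by (rule lempert_less_imp_disc[OF disc_in_mem[OF \<phi> \<zeta>] disc_in_mem[OF \<phi> \<eta>] less])
  have \<beta>: "cmod \<beta> < pseudohyp \<zeta> \<eta>"
    using a\<beta> artanh_less_iff[of "cmod \<beta>" "pseudohyp \<zeta> \<eta>"] \<psi>0(2) pseudohyp_lt_1[OF \<zeta> \<eta>]
    by (simp add: pseudohyp_nonneg)
  define \<gamma> where "\<gamma> = Moebius_function 0 \<zeta> \<eta>"
  define s where "s = cmod (\<beta> / \<gamma>)"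
  have \<gamma>: "cmod \<gamma> = pseudohyp \<zeta> \<eta>" "\<gamma> \<noteq> 0"
    using \<beta> norm_ge_zero[of \<beta>] by (auto simp: \<gamma>_def pseudohyp_def)
  have "0 < pseudohyp \<zeta> \<eta>"
    using norm_ge_zero \<beta> by (rule le_less_trans)
  then have s: "s < 1" "0 \<le> s"
    using \<beta> \<gamma>(1) by (simp_all add: s_def norm_divide)
  \<comment> \<open>The inner map sends \<open>\<zeta>\<close> to 0 and \<open>\<eta>\<close> to
    \<open>\<beta>\<close>. As \<open>\<beta>\<close> is closer to 0 than \<open>\<gamma>\<close>,
    it is a contraction into the ball of radius \<open>s < 1\<close>, which makes the image of
    \<open>\<psi>\<close> relatively compact in \<open>D\<close>.\<close>
  define \<psi> where "\<psi> = \<psi>0 \<circ> (\<lambda>z. \<beta> / \<gamma> * Moebius_function 0 \<zeta> z)"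
  have g: "cmod (\<beta> / \<gamma> * Moebius_function 0 \<zeta> z) \<le> s" if "cmod z < 1" for z
    unfolding norm_mult s_def[symmetric]
    using Moebius_function_norm_lt_1[OF \<zeta> that, of 0] s(2) by (simp add: mult_left_le)
  have \<psi>: "disc_in \<psi>"
    unfolding \<psi>_def
  proof (rule disc_in_compose[OF \<psi>0(1)])
    show "(\<lambda>z. \<beta> / \<gamma> * Moebius_function 0 \<zeta> z) holomorphic_on unit_disc"
      by (intro holomorphic_intros Moebius_function_holomorphic \<zeta>)
    show "(\<lambda>z. \<beta> / \<gamma> * Moebius_function 0 \<zeta> z) ` unit_disc \<subseteq> unit_disc"
      using le_less_trans[OF g s(1)] by (intro image_subsetI) simp
  qed
  have "compact (\<psi>0 ` cball 0 s)"
    using holomorphic_disc_map_continuous[of \<psi>0] \<psi>0(1) s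
    by (intro compact_continuous_image) (auto simp: disc_in_def intro: continuous_on_subset)
  moreover have "\<psi>0 ` cball 0 s \<subseteq> D"
    using \<psi>0(1) s by (auto intro!: disc_in_mem)
  ultimately obtain m where m: "0 < m" "(\<Union>x\<in>\<psi>0 ` cball 0 s. ball x m) \<subseteq> D"
    using compact_subset_open_imp_ball_epsilon_subset[OF _ op] by blast
  have mb: "ball (\<psi> z) m \<subseteq> D" if "cmod z < 1" for z
  proof -
    have "\<psi> z \<in> \<psi>0 ` cball 0 s"
      unfolding \<psi>_def o_def using g[OF that] by (intro imageI) simp
    then show ?thesis
      using m(2) by blast
  qed
  have \<psi>\<zeta>: "\<psi> \<zeta> = \<phi> \<zeta>" and \<psi>\<eta>: "\<psi> \<eta> = \<phi> \<eta>"
    using \<psi>0(3,4) \<gamma>(2) by (simp_all add: \<psi>_def Moebius_function_eq_zero flip: \<gamma>_def)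
  have hol: "holomorphic_disc_map \<phi>" "holomorphic_disc_map \<psi>"
    using \<phi> \<psi> by (simp_all add: disc_in_def)
  obtain \<kappa>1 where \<kappa>1: "holomorphic_disc_map \<kappa>1" "\<And>z i. (\<psi> z - \<phi> z) $ i = (z - \<zeta>) * \<kappa>1 z $ i"
    by (rule holomorphic_disc_map_factor_root[OF holomorphic_disc_map_diff[OF hol(2,1)], of \<zeta>])
       (use \<psi>\<zeta> in auto)
  have "\<kappa>1 \<eta> = 0"
    using \<kappa>1(2)[of \<eta>] \<psi>\<eta> ne by (simp add: vec_eq_iff)
  then obtain \<kappa> where \<kappa>: "holomorphic_disc_map \<kappa>" "\<And>z i. \<kappa>1 z $ i = (z - \<eta>) * \<kappa> z $ i"
    using holomorphic_disc_map_factor_root[OF \<kappa>1(1), of \<eta>] by blast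
  have nz: "1 - cnj \<zeta> * x \<noteq> 0" "1 - cnj \<eta> * x \<noteq> 0" if "cmod x \<le> 1" for x
    using one_minus_cnj_mult_nonzero that \<zeta> \<eta> by auto
  \<comment> \<open>On the circle the numerator \<open>(cmod (1 - cnj \<alpha> * z))\<^sup>2\<close>
    of the multiplier is at most 4, and the denominator at least
    \<open>((1 - cmod \<zeta>) * (1 - cmod \<eta>))\<^sup>2\<close>; this \<open>k\<close> makes the
    quotient at most 1.\<close>
  define k where "k = ((1 - cmod \<zeta>) * (1 - cmod \<eta>))\<^sup>2 / 4"
  have k: "0 < k"
    using \<zeta> \<eta> by (simp add: k_def)
  define \<nu> where "\<nu> = (\<lambda>x. \<phi> x + (\<chi> i. of_real k * x * ((x - \<alpha>) * (1 - cnj \<alpha> * x)) /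
      ((1 - cnj \<zeta> * x) * (1 - cnj \<eta> * x)) * \<kappa> x $ i))"
  have \<nu>: "holomorphic_disc_map \<nu>"
    unfolding \<nu>_def
    by (intro holomorphic_disc_map_add_scaled hol \<kappa> holomorphic_intros) (use nz in auto)
  define \<mu> where "\<mu> = (\<lambda>x. of_real k * x * ((x - \<alpha>) * (1 - cnj \<alpha> * x)) /
      (((x - \<zeta>) * (1 - cnj \<zeta> * x)) * ((x - \<eta>) * (1 - cnj \<eta> * x))))"
  \<comment> \<open>The smallest numerator over the largest denominator: each of the two factors
    below is at most 4.\<close>
  define c0 where "c0 = k * (1 - cmod \<alpha>)\<^sup>2 / 16"
  have c0: "0 < c0"
    using k \<alpha> by (simp add: c0_def)
  define q where "q = max (cmod \<zeta>) (cmod \<eta>)"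
  define r where "r = (1 + q) / 2"
  have q: "0 \<le> q" "q < 1" "cmod \<zeta> \<le> q" "cmod \<eta> \<le> q"
    using \<zeta> \<eta> by (auto simp: q_def le_max_iff_disj)
  then have r: "0 < r" "r < 1" "q < r"
    by (simp_all add: r_def)
  have xnz: "x - \<zeta> \<noteq> 0" "x - \<eta> \<noteq> 0" if "r \<le> cmod x" for x
    using that r q by auto
  have margin: "ball (\<nu> x) (c0 * m) \<subseteq> D" if "cmod x < 1" for x
  proof (rule glued_disc_margin[OF \<phi> \<psi> \<nu> r(1,2) _ _ less_imp_le[OF c0] _ that m(1) mb])
    show "continuous_on {z. r \<le> cmod z \<and> cmod z \<le> 1} \<mu>"
      unfolding \<mu>_def by (intro continuous_intros) (use nz xnz in auto)
    show "\<nu> z $ i = \<phi> z $ i + \<mu> z * (\<psi> z $ i - \<phi> z $ i)" if z: "r < cmod z" "cmod z < 1" for z i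
    proof -
      have "\<psi> z $ i - \<phi> z $ i = (z - \<zeta>) * ((z - \<eta>) * \<kappa> z $ i)"
        using \<kappa>1(2)[of z i] \<kappa>(2)[of z i] by simp
      then show ?thesis
        using xnz[of z] z by (simp add: \<nu>_def \<mu>_def)
    qed
    show "\<exists>t. \<mu> z = complex_of_real t \<and> c0 \<le> t \<and> t \<le> 1" if z: "cmod z = 1" for z
    proof (intro exI conjI)
      let ?n = "\<lambda>b. cmod (1 - cnj b * z)"
      have zn: "z \<noteq> 0"
        using z by auto
      have "\<mu> z = of_real k * z * (z * of_real ((?n \<alpha>)\<^sup>2)) / ((z * of_real ((?n \<zeta>)\<^sup>2)) * (z * of_real ((?n \<eta>)\<^sup>2)))"
        unfolding \<mu>_def unit_circle_factor[OF z] ..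
      also have "\<dots> = of_real (k * (?n \<alpha>)\<^sup>2 / ((?n \<zeta>)\<^sup>2 * (?n \<eta>)\<^sup>2))"
        using zn by simp
      finally show "\<mu> z = of_real (k * (?n \<alpha>)\<^sup>2 / ((?n \<zeta>)\<^sup>2 * (?n \<eta>)\<^sup>2))" .
      have lo: "(1 - cmod b)\<^sup>2 \<le> (?n b)\<^sup>2" and hi: "(?n b)\<^sup>2 \<le> 4" if "cmod b < 1" for b
      proof -
        show "(1 - cmod b)\<^sup>2 \<le> (?n b)\<^sup>2"
          using norm_one_minus_cnj_mult_bounds(1)[OF z, of b] that by (intro power_mono) auto
        have "(?n b)\<^sup>2 \<le> 2\<^sup>2"
          using norm_one_minus_cnj_mult_bounds(2)[OF z, of b] that by (intro power_mono) auto
        then show "(?n b)\<^sup>2 \<le> 4"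
          by simp
      qed
      have pos: "0 < (?n \<zeta>)\<^sup>2 * (?n \<eta>)\<^sup>2"
        using nz[of z] z by simp
      have "k * (1 - cmod \<alpha>)\<^sup>2 / 16 \<le> k * (?n \<alpha>)\<^sup>2 / ((?n \<zeta>)\<^sup>2 * (?n \<eta>)\<^sup>2)"
      proof (rule frac_le)
        show "(?n \<zeta>)\<^sup>2 * (?n \<eta>)\<^sup>2 \<le> 16"
          using mult_mono[OF hi[OF \<zeta>] hi[OF \<eta>]] by simp
        show "k * (1 - cmod \<alpha>)\<^sup>2 \<le> k * (?n \<alpha>)\<^sup>2"
          using k lo[OF \<alpha>(2)] by simp
      qed (use k pos in auto)
      then show "c0 \<le> k * (?n \<alpha>)\<^sup>2 / ((?n \<zeta>)\<^sup>2 * (?n \<eta>)\<^sup>2)"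
        by (simp add: c0_def)
      have "k * (?n \<alpha>)\<^sup>2 \<le> k * 4"
        using k hi[OF \<alpha>(2)] by simp
      also have "k * 4 = (1 - cmod \<zeta>)\<^sup>2 * (1 - cmod \<eta>)\<^sup>2"
        by (simp add: k_def power_mult_distrib)
      also have "\<dots> \<le> (?n \<zeta>)\<^sup>2 * (?n \<eta>)\<^sup>2"
        using lo[OF \<zeta>] lo[OF \<eta>] by (intro mult_mono) auto
      finally show "k * (?n \<alpha>)\<^sup>2 / ((?n \<zeta>)\<^sup>2 * (?n \<eta>)\<^sup>2) \<le> 1"
        using pos by (simp add: pos_divide_le_eq)
    qed
  qed
  have "\<nu> 0 = \<phi> 0" "\<nu> \<alpha> = \<phi> \<alpha>"
    by (simp_all add: \<nu>_def vec_eq_iff)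
  then show ?thesis
    using interior_disc_not_extremal[OF \<nu> _ margin \<alpha>] c0 m(1) by simp
qed

text \<open>\<open>complex_geodesic\<close> with the distance of the unit disc evaluated;
  \<open>complex_geodesic_iff\<close> identifies the two.\<close>

definition geodesic_disc :: "(complex \<Rightarrow> complex ^ 'n) \<Rightarrow> bool" where
  "geodesic_disc \<phi> \<longleftrightarrow> disc_in \<phi> \<and>
     (\<forall>\<zeta> \<eta>. cmod \<zeta> < 1 \<longrightarrow> cmod \<eta> < 1 \<longrightarrow>
        kobayashi_dist D (\<phi> \<zeta>) (\<phi> \<eta>) = artanh (pseudohyp \<zeta> \<eta>))"

lemma geodesic_disc_exists:
  assumes z: "z \<in> D" "w \<in> D" "z \<noteq> w"
  obtains \<phi> \<alpha> where "geodesic_disc \<phi>" "cmod \<alpha> < 1" "\<phi> 0 = z" "\<phi> \<alpha> = w"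
proof -
  obtain \<phi> \<alpha> where \<phi>: "disc_in \<phi>" "cmod \<alpha> < 1" "\<phi> 0 = z" "\<phi> \<alpha> = w" "lempert D z w = artanh (cmod \<alpha>)"
    by (rule extremal_disc_exists[OF z(1,2)])
  have \<alpha>: "\<alpha> \<noteq> 0"
    using \<phi>(3,4) z(3) by auto
  have "kobayashi_dist D (\<phi> \<zeta>) (\<phi> \<eta>) = artanh (pseudohyp \<zeta> \<eta>)" if "cmod \<zeta> < 1" "cmod \<eta> < 1" for \<zeta> \<eta>
  proof -
    have "\<not> lempert D (\<phi> \<zeta>) (\<phi> \<eta>) < artanh (pseudohyp \<zeta> \<eta>)"
      using nonextremal_propagates[OF \<phi>(1) that \<alpha> \<phi>(2)] unfolding \<phi>(3,4,5) by linarith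
    then show ?thesis
      using lempert_le[OF \<phi>(1) that] that by (simp add: kobayashi_eq_lempert disc_in_mem[OF \<phi>(1)])
  qed
  then show ?thesis
    using \<phi>(1-4) by (intro that[of \<phi> \<alpha>]) (auto simp: geodesic_disc_def)
qed

end

lemma norm_vec1: "norm (vec \<zeta> :: complex ^ 1) = cmod \<zeta>"
  by (simp add: norm_vec_def L2_set_def)

text \<open>The ball of \<open>complex ^ 1\<close> is itself a bounded convex domain, so it has
  extremal discs; Schwarz-Pick bounds these from below, and \<open>vec\<close> gives the other
  inequality.\<close>

lemma kobayashi_dist_disc:
  assumes "cmod \<zeta> < 1" "cmod \<eta> < 1"
  shows "kobayashi_dist (ball 0 1 :: (complex ^ 1) set) (vec \<zeta>) (vec \<eta>) = artanh (pseudohyp \<zeta> \<eta>)"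
proof -
  interpret B: bounded_convex_domain "ball 0 1 :: (complex ^ 1) set"
    by unfold_locales auto
  have mem: "(vec x :: complex ^ 1) \<in> ball 0 1" if "cmod x < 1" for x
    using that by (simp add: norm_vec1)
  have vec: "B.disc_in vec"
    using mem by (auto simp: B.disc_in_def holomorphic_disc_map_def)
  obtain \<phi> \<beta> where \<phi>: "B.disc_in \<phi>" "cmod \<beta> < 1" "\<phi> 0 = vec \<zeta>" "\<phi> \<beta> = vec \<eta>"
      and l: "lempert (ball 0 1) (vec \<zeta> :: complex ^ 1) (vec \<eta>) = artanh (cmod \<beta>)"
    by (rule B.extremal_disc_exists[OF mem[OF assms(1)] mem[OF assms(2)]])
  have "pseudohyp (\<phi> 0 $ 1) (\<phi> \<beta> $ 1) \<le> pseudohyp 0 \<beta>"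
  proof (rule schwarz_pick[of "\<lambda>z. \<phi> z $ 1"])
    show "(\<lambda>z. \<phi> z $ 1) holomorphic_on unit_disc"
      using \<phi>(1) by (simp add: B.disc_in_def holomorphic_disc_map_def)
    have "cmod (\<phi> z $ 1) < 1" if "cmod z < 1" for z
      using B.disc_in_mem[OF \<phi>(1) that] Finite_Cartesian_Product.norm_nth_le[of "\<phi> z" 1] by simp
    then show "(\<lambda>z. \<phi> z $ 1) ` unit_disc \<subseteq> unit_disc"
      by auto
  qed (use \<phi>(2) in auto)
  then have "pseudohyp \<zeta> \<eta> \<le> cmod \<beta>"
    by (simp add: \<phi>(3,4) pseudohyp_0)
  then have "artanh (pseudohyp \<zeta> \<eta>) \<le> lempert (ball 0 1) (vec \<zeta> :: complex ^ 1) (vec \<eta>)"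
    unfolding l using \<phi>(2) by (intro artanh_mono pseudohyp_nonneg)
  then show ?thesis
    using B.lempert_le[OF vec assms] B.kobayashi_eq_lempert[OF mem[OF assms(1)] mem[OF assms(2)]]
    by simp
qed

lemma (in bounded_convex_domain) complex_geodesic_iff: "complex_geodesic D \<phi> \<longleftrightarrow> geodesic_disc \<phi>"
  unfolding complex_geodesic_def geodesic_disc_def disc_in_def
  by (auto simp: kobayashi_dist_disc)

section \<open>Boundary behaviour of the Kobayashi distance\<close>

context bounded_convex_domain
begin

abbreviation kob :: "complex ^ 'n \<Rightarrow> complex ^ 'n \<Rightarrow> real" where
  "kob \<equiv> kobayashi_dist D"

lemma frontier_nonempty: "frontier D \<noteq> {}"
  using ne bd not_bounded_UNIV by (auto simp: frontier_eq_empty)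

lemma boundary_dist_pos: "z \<in> D \<Longrightarrow> 0 < boundary_dist D z"
  unfolding boundary_dist_def
  by (rule infdist_pos_not_in_closed) (use frontier_nonempty op in \<open>auto simp: frontier_def interior_open\<close>)

lemma ball_boundary_dist_subset:
  assumes "z \<in> D"
  shows "ball z (boundary_dist D z) \<subseteq> D"
proof (rule ccontr)
  assume "\<not> ball z (boundary_dist D z) \<subseteq> D"
  then have "ball z (boundary_dist D z) - D \<noteq> {}"
    by blast
  moreover have "z \<in> ball z (boundary_dist D z) \<inter> D"
    using boundary_dist_pos[OF assms] assms by simp
  ultimately have "ball z (boundary_dist D z) \<inter> frontier D \<noteq> {}"
    by (intro connected_Int_frontier connected_ball) blast
  then obtain p where "p \<in> frontier D" "dist z p < boundary_dist D z"
    by auto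
  then show False
    using infdist_le[of p "frontier D" z] by (simp add: boundary_dist_def)
qed

lemma nearest_boundary_point:
  obtains p where "p \<in> frontier D" "boundary_dist D z = dist z p"
  using infdist_attains_inf[OF frontier_closed frontier_nonempty, of z] unfolding boundary_dist_def by blast

lemma boundary_dist_continuous: "continuous_on S (boundary_dist D)"
  unfolding boundary_dist_def by (intro continuous_intros)

lemma kob_commute: "kob z w = kob w z"
proof (cases "z \<in> D \<and> w \<in> D")
  case True
  then show ?thesis
    using lempert_commute[of z w] by (simp add: kobayashi_eq_lempert)
next
  case False
  then show ?thesis
    unfolding kobayashi_dist_def by auto
qed

lemma kob_nonneg: "0 \<le> kob z w"
  using lempert_nonneg[OF op cv] by (cases "z \<in> D \<and> w \<in> D") (auto simp: kobayashi_eq_lempert, auto simp: kobayashi_dist_def)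

lemma kob_triangle: "\<lbrakk>x \<in> D; y \<in> D; z \<in> D\<rbrakk> \<Longrightarrow> kob x z \<le> kob x y + kob y z"
  by (simp add: kobayashi_eq_lempert lempert_triangle)

lemma kob_eq_0_iff: "\<lbrakk>x \<in> D; y \<in> D\<rbrakk> \<Longrightarrow> kob x y = 0 \<longleftrightarrow> x = y"
  using lempert_pos[of x y] lempert_same[of x] kobayashi_eq_lempert[of x y] by fastforce

text \<open>Harnack's inequality along an extremal disc from \<open>z\<close> to \<open>w\<close>,
  for the distance to a supporting hyperplane at the boundary point nearest to \<open>w\<close>.
  This distance is at most \<open>boundary_dist D w\<close> at \<open>w\<close> and at least
  \<open>boundary_dist D z\<close> at \<open>z\<close>.\<close>

lemma boundary_dist_le_exp_kob:
  assumes z: "z \<in> D" and w: "w \<in> D"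
  shows "boundary_dist D z \<le> exp (2 * kob z w) * boundary_dist D w"
proof -
  obtain \<phi> \<alpha> where \<phi>: "disc_in \<phi>" "cmod \<alpha> < 1" "\<phi> 0 = z" "\<phi> \<alpha> = w" "lempert D z w = artanh (cmod \<alpha>)"
    by (rule extremal_disc_exists[OF z w])
  obtain p where p: "p \<in> frontier D" "boundary_dist D w = dist w p"
    by (rule nearest_boundary_point)
  have "p \<notin> D"
    using p(1) op by (simp add: frontier_def interior_open)
  then obtain a where a: "norm a = 1" "\<And>y. y \<in> D \<Longrightarrow> y \<bullet> a < p \<bullet> a"
    using separating_half_space_open[OF cv op] by metis
  define g where "g = (\<lambda>x. of_real (p \<bullet> a) - hdot (\<phi> x) a)"
  have Re_g: "Re (g x) = p \<bullet> a - \<phi> x \<bullet> a" for x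
    by (simp add: g_def Re_hdot)
  have "Re (g 0) * (1 - cmod \<alpha>) \<le> Re (g \<alpha>) * (1 + cmod \<alpha>)"
  proof (rule harnack_disc)
    show "g holomorphic_on unit_disc"
      unfolding g_def using \<phi>(1) by (intro holomorphic_intros holomorphic_hdot) (simp add: disc_in_def)
    show "0 < Re (g x)" if "cmod x < 1" for x
      using a(2)[OF disc_in_mem[OF \<phi>(1) that]] by (simp add: Re_g)
  qed (rule \<phi>(2))
  moreover have "boundary_dist D z \<le> Re (g 0)"
    using half_space_margin[OF ball_boundary_dist_subset[OF z] boundary_dist_pos[OF z] a(1) less_imp_le[OF a(2)]]
    by (simp add: Re_g \<phi>(3))
  moreover have "Re (g \<alpha>) \<le> boundary_dist D w"
    using norm_cauchy_schwarz[of "p - w" a] a(1)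
    by (simp add: Re_g \<phi>(4) p(2) dist_norm norm_minus_commute inner_diff_left)
  ultimately have "boundary_dist D z * (1 - cmod \<alpha>) \<le> boundary_dist D w * (1 + cmod \<alpha>)"
    using \<phi>(2) norm_ge_zero[of \<alpha>]
    by (meson add_nonneg_nonneg diff_ge_0_iff_ge less_imp_le mult_right_mono order_trans zero_le_one)
  moreover have "exp (2 * kob z w) = (1 + cmod \<alpha>) / (1 - cmod \<alpha>)"
    unfolding kobayashi_eq_lempert[OF z w] \<phi>(5) using \<phi>(2) by (intro exp_2_artanh) simp
  ultimately show ?thesis
    using \<phi>(2) by (simp add: pos_le_divide_eq mult.commute)
qed

text \<open>The affine disc centred at \<open>z\<close> in the direction of \<open>w\<close>, of
  radius \<open>d\<close>, stays in the ball.\<close>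

lemma kob_le_artanh:
  assumes z: "ball z d \<subseteq> D" and w: "norm (w - z) < d"
  shows "kob z w \<le> artanh (norm (w - z) / d)"
proof -
  have d: "0 < d"
    using w norm_ge_zero[of "w - z"] by linarith
  then have zD: "z \<in> D"
    using z by auto
  have wD: "w \<in> D"
    using z w by (auto simp: dist_norm norm_minus_commute)
  show ?thesis
  proof (cases "w = z")
    case True
    then show ?thesis
      using lempert_same zD by (simp add: kobayashi_eq_lempert)
  next
    case False
    define n where "n = norm (w - z)"
    have n: "0 < n" "n < d"
      using False w by (simp_all add: n_def)
    define \<phi> where "\<phi> = (\<lambda>x. z + (\<chi> i. x * of_real (d / n) * (w - z) $ i))"
    have "holomorphic_disc_map \<phi>"
      unfolding \<phi>_def by (intro holomorphic_disc_map_add_scaled holomorphic_intros)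
        (auto simp: holomorphic_disc_map_def)
    moreover have "\<phi> x \<in> D" if "cmod x < 1" for x
    proof -
      have "norm (\<chi> i. x * of_real (d / n) * (w - z) $ i) = cmod x * (d / n) * n"
        unfolding norm_vec_scale norm_mult norm_of_real n_def[symmetric] using d n by simp
      also have "\<dots> = cmod x * d"
        using n by simp
      also have "\<dots> < d"
        using that d by simp
      finally have "\<phi> x \<in> ball z d"
        by (simp add: \<phi>_def dist_norm)
      then show ?thesis
        using z by blast
    qed
    ultimately have "disc_in \<phi>"
      by (auto simp: disc_in_def)
    from lempert_le[OF this, of 0 "of_real (n / d)"]
    have "lempert D (\<phi> 0) (\<phi> (of_real (n / d))) \<le> artanh (n / d)"
      using n by (simp add: pseudohyp_0 norm_divide)
    moreover have "\<phi> 0 = z" "\<phi> (of_real (n / d)) = w"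
      using n d by (simp_all add: \<phi>_def vec_eq_iff)
    ultimately show ?thesis
      using zD wD by (simp add: kobayashi_eq_lempert n_def)
  qed
qed

lemma kob_small_near:
  assumes z: "z \<in> D" and e: "0 < e"
  obtains d where "0 < d" "\<And>w. dist w z < d \<Longrightarrow> w \<in> D \<and> kob z w < e"
proof
  let ?\<delta> = "boundary_dist D z"
  have t: "0 < tanh e" "tanh e < 1"
    using e by (auto simp: tanh_real_lt_1)
  show "0 < ?\<delta> * tanh e"
    using t boundary_dist_pos[OF z] by simp
  fix w assume w: "dist w z < ?\<delta> * tanh e"
  have q: "norm (w - z) / ?\<delta> < tanh e"
    using w boundary_dist_pos[OF z] by (simp add: dist_norm pos_divide_less_eq mult.commute)
  have lt: "norm (w - z) < ?\<delta>"
    using q t boundary_dist_pos[OF z] by (simp add: pos_divide_less_eq) (smt (verit) mult_less_cancel_right1)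
  then have "w \<in> D"
    using ball_boundary_dist_subset[OF z] by (auto simp: dist_norm norm_minus_commute)
  moreover have "artanh (norm (w - z) / ?\<delta>) < artanh (tanh e)"
    using q t boundary_dist_pos[OF z] by (intro artanh_strict_mono) auto
  ultimately show "w \<in> D \<and> kob z w < e"
    using kob_le_artanh[OF ball_boundary_dist_subset[OF z] lt] by (simp add: artanh_tanh_real)
qed

lemma kob_continuous: "base \<in> D \<Longrightarrow> continuous_on D (kob base)"
  unfolding continuous_on_iff
proof (intro ballI allI impI)
  fix z and e :: real assume base: "base \<in> D" and z: "z \<in> D" and "0 < e"
  then obtain d where d: "0 < d" "\<And>w. dist w z < d \<Longrightarrow> w \<in> D \<and> kob z w < e"
    using kob_small_near by metis
  show "\<exists>d>0. \<forall>w\<in>D. dist w z < d \<longrightarrow> dist (kob base w) (kob base z) < e"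
  proof (intro exI conjI ballI impI)
    show "0 < d" by (rule d(1))
    fix w assume w: "w \<in> D" "dist w z < d"
    have "kob base w \<le> kob base z + kob z w" "kob base z \<le> kob base w + kob z w"
      using kob_triangle[OF base z w(1)] kob_triangle[OF base w(1) z] kob_commute[of z w] by simp_all
    then show "dist (kob base w) (kob base z) < e"
      using d(2)[OF w(2)] by (simp add: dist_real_def abs_less_iff)
  qed
qed

text \<open>A compact exhaustion of \<open>D\<close> as \<open>c\<close> decreases to 0. Taking the
  closure of \<open>D\<close> makes it closed, and for positive \<open>c\<close> it contains no
  boundary point, since \<open>boundary_dist\<close> vanishes there.\<close>

definition core :: "real \<Rightarrow> (complex ^ 'n) set" where
  "core c = {z \<in> closure D. c \<le> boundary_dist D z}"

lemma compact_core: "compact (core c)"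
proof -
  have "closed {z. c \<le> boundary_dist D z}"
    by (intro closed_Collect_le continuous_on_const boundary_dist_continuous)
  then have "compact (closure D \<inter> {z. c \<le> boundary_dist D z})"
    using bd by (intro compact_Int_closed) auto
  then show ?thesis
    by (simp add: core_def Int_def)
qed

lemma core_subset: "0 < c \<Longrightarrow> core c \<subseteq> D"
proof
  fix z assume "0 < c" "z \<in> core c"
  then have z: "z \<in> closure D" "z \<notin> frontier D"
    by (auto simp: core_def boundary_dist_def)
  then show "z \<in> D"
    using op by (simp add: frontier_def interior_open)
qed

lemma mem_core: "z \<in> D \<Longrightarrow> c \<le> boundary_dist D z \<Longrightarrow> z \<in> core c"
  using closure_subset by (auto simp: core_def)

lemma kob_bounded_on_core:
  assumes "0 < c" "base \<in> D"
  obtains B where "\<And>z. z \<in> core c \<Longrightarrow> kob base z \<le> B"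
proof -
  have "compact (kob base ` core c)"
    using kob_continuous[OF assms(2)] core_subset[OF assms(1)] compact_core
    by (intro compact_continuous_image) (auto intro: continuous_on_subset)
  then have "bdd_above (kob base ` core c)"
    by (intro bounded_imp_bdd_above compact_imp_bounded)
  then show ?thesis
    using that by (auto simp: bdd_above_def)
qed

lemma boundary_dist_lower:
  assumes "z \<in> D" "w \<in> D" "c \<le> boundary_dist D z" "kob z w \<le> B"
  shows "exp (- 2 * B) * c \<le> boundary_dist D w"
proof -
  have "c \<le> exp (2 * kob z w) * boundary_dist D w"
    using boundary_dist_le_exp_kob[OF assms(1,2)] assms(3) by linarith
  also have "\<dots> \<le> exp (2 * B) * boundary_dist D w"
    using assms boundary_dist_pos[OF assms(2)] by (intro mult_right_mono) auto
  finally have "exp (- 2 * B) * c \<le> exp (- 2 * B) * (exp (2 * B) * boundary_dist D w)"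
    by (intro mult_left_mono) auto
  also have "\<dots> = boundary_dist D w"
    by (simp add: exp_minus)
  finally show ?thesis .
qed

lemma Metric_space_kob: "Metric_space D kob"
  by unfold_locales (auto simp: kob_nonneg kob_commute kob_eq_0_iff kob_triangle)

text \<open>The tail of a Cauchy sequence stays within Kobayashi distance 1 of one of its terms,
  hence in a core; a Euclidean limit of a subsequence there is also a limit for
  \<open>kob\<close>.\<close>

lemma mcomplete_kob: "Metric_space.mcomplete D kob"
proof -
  interpret M: Metric_space D kob
    by (rule Metric_space_kob)
  show ?thesis
    unfolding M.mcomplete_def
  proof (intro allI impI)
    fix \<sigma> assume cau: "M.MCauchy \<sigma>"
    have \<sigma>: "\<sigma> n \<in> D" for n
      using cau by (auto simp: M.MCauchy_def)
    obtain N where N: "\<And>n. N \<le> n \<Longrightarrow> kob (\<sigma> N) (\<sigma> n) < 1"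
      using cau zero_less_one unfolding M.MCauchy_def by (meson order.refl)
    define c where "c = exp (- 2 * 1) * boundary_dist D (\<sigma> N)"
    have c: "0 < c"
      using boundary_dist_pos[OF \<sigma>] by (simp add: c_def)
    have "\<sigma> (N + n) \<in> core c" for n
      unfolding c_def using N[of "N + n"]
      by (intro mem_core \<sigma> boundary_dist_lower[OF \<sigma> \<sigma>]) auto
    then obtain x r where x: "x \<in> core c" "strict_mono r" "((\<lambda>n. \<sigma> (N + n)) \<circ> r) \<longlonglongrightarrow> x"
      using compact_core[unfolded compact_def] by (meson)
    have xD: "x \<in> D"
      using x(1) core_subset[OF c] by blast
    have sm: "strict_mono (\<lambda>n. N + r n)"
      using x(2) by (simp add: strict_mono_def)
    have "limitin M.mtopology (\<sigma> \<circ> (\<lambda>n. N + r n)) x sequentially"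
      unfolding M.limit_metric_sequentially
    proof (intro conjI xD allI impI)
      fix e :: real assume "0 < e"
      then obtain d where d: "0 < d" "\<And>w. dist w x < d \<Longrightarrow> w \<in> D \<and> kob x w < e"
        using kob_small_near[OF xD] by metis
      obtain M where "\<forall>n\<ge>M. dist (((\<lambda>n. \<sigma> (N + n)) \<circ> r) n) x < d"
        using metric_LIMSEQ_D[OF x(3) d(1)] by blast
      then show "\<exists>M. \<forall>n\<ge>M. (\<sigma> \<circ> (\<lambda>n. N + r n)) n \<in> D \<and> kob ((\<sigma> \<circ> (\<lambda>n. N + r n)) n) x < e"
        using d(2) by (intro exI[of _ M]) (auto simp: o_def kob_commute[of _ x])
    qed
    then show "\<exists>x. limitin M.mtopology \<sigma> x sequentially"
      using M.MCauchy_convergent_subsequence[OF cau sm] by blast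
  qed
qed

end

section \<open>Real geodesics in complex geodesics\<close>

lemma tanh_artanh_real:
  fixes x :: real
  assumes "\<bar>x\<bar> < 1"
  shows "tanh (artanh x) = x"
proof -
  have e: "exp (- 2 * artanh x) = (1 - x) / (1 + x)"
    using exp_2_artanh[OF assms] by (simp add: exp_minus)
  have "0 < 1 + x"
    using assms by auto
  then show ?thesis
    unfolding tanh_real_altdef e by (simp add: field_simps)
qed

lemma tanh_diff_real: "tanh (s - t) = (tanh s - tanh t) / (1 - tanh s * tanh (t::real))"
  using tanh_add[of s "- t"] by simp

text \<open>
  With \<open>a = cnj \<zeta> * u\<close>, this says that the Euclidean distance to \<open>\<zeta>\<close> increases along the hyperbolic
  geodesic that leaves \<open>\<zeta>\<close> in the direction \<open>u\<close>.
\<close>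

lemma norm_scaled_denominator_mono:
  assumes "0 \<le> x" "x \<le> b" "b \<le> 1" "cmod a \<le> 1"
  shows "x * cmod (1 + a * of_real b) \<le> b * cmod (1 + a * of_real x)"
proof -
  define p where "p = a * of_real (x * b)"
  have xb: "x * b \<le> x" "x * b \<le> b" "0 \<le> x * b"
    using assms by (auto simp: mult_left_le mult_left_le_one_le)
  have "\<bar>Re p\<bar> \<le> cmod a * (x * b)"
    using abs_Re_le_cmod[of p] xb by (simp add: p_def norm_mult)
  also have "\<dots> \<le> 1 * (x * b)"
    using assms xb by (intro mult_right_mono) auto
  finally have "0 \<le> (b - x) * (b + x + 2 * Re p)"
    using xb assms by (intro mult_nonneg_nonneg) auto
  then have "(cmod (of_real x + p))\<^sup>2 \<le> (cmod (of_real b + p))\<^sup>2"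
    unfolding cmod_power2 by (simp add: power2_eq_square algebra_simps)
  then have "cmod (of_real x + p) \<le> cmod (of_real b + p)"
    by (rule power2_le_imp_le) simp
  moreover have "of_real x + p = of_real x * (1 + a * of_real b)" "of_real b + p = of_real b * (1 + a * of_real x)"
    by (simp_all add: p_def algebra_simps)
  ultimately show ?thesis
    using assms by (simp add: norm_mult)
qed

text \<open>The bound on Gromov products in the disc itself, with base point 0. After exponentiation
  the left side is of order \<open>1 / (u * v)\<close>, while on the right
  \<open>1 - \<rho>\<^sup>2\<close> is at most \<open>4 * u * v / c\<^sup>2\<close>, because
  \<open>cmod (1 - cnj \<zeta> * \<eta>)\<close> is at least
  \<open>cmod (\<zeta> - \<eta>)\<close>.\<close>

lemma artanh_pseudohyp_ge:
  assumes c: "0 < c" "c \<le> cmod (\<zeta> - \<eta>)" and \<zeta>: "cmod \<zeta> < 1" and \<eta>: "cmod \<eta> < 1"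
  shows "artanh (cmod \<zeta>) + artanh (cmod \<eta>) - ln (4 / c) \<le> artanh (pseudohyp \<zeta> \<eta>)"
proof -
  define u v \<rho> where "u = 1 - cmod \<zeta>" and "v = 1 - cmod \<eta>" and "\<rho> = pseudohyp \<zeta> \<eta>"
  have uv: "0 < u" "0 < v" "u \<le> 1" "v \<le> 1"
    using \<zeta> \<eta> by (auto simp: u_def v_def)
  have \<rho>: "0 \<le> \<rho>" "\<rho> < 1"
    using pseudohyp_lt_1[OF \<zeta> \<eta>] by (auto simp: \<rho>_def pseudohyp_nonneg)
  have "exp (2 * artanh (cmod \<zeta>)) = (1 + cmod \<zeta>) / u" "exp (2 * artanh (cmod \<eta>)) = (1 + cmod \<eta>) / v"
    using \<zeta> \<eta> by (simp_all add: exp_2_artanh u_def v_def)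
  then have e1: "exp (2 * artanh (cmod \<zeta>)) \<le> 2 / u" and e2: "exp (2 * artanh (cmod \<eta>)) \<le> 2 / v"
    using \<zeta> \<eta> uv by (auto intro!: divide_right_mono)
  have "exp (2 * (artanh (cmod \<zeta>) + artanh (cmod \<eta>))) \<le> (2 / u) * (2 / v)"
    unfolding distrib_left exp_add using e1 e2 uv by (intro mult_mono) auto
  also have "\<dots> = (4 / c)\<^sup>2 * (c\<^sup>2 / (4 * u * v))"
    using c(1) uv by (simp add: power2_eq_square field_simps)
  also have "\<dots> \<le> (4 / c)\<^sup>2 * exp (2 * artanh \<rho>)"
  proof (rule mult_left_mono)
    have s: "0 < 1 - (cmod \<zeta>)\<^sup>2" "0 < 1 - (cmod \<eta>)\<^sup>2" "1 - (cmod \<zeta>)\<^sup>2 \<le> 2 * u" "1 - (cmod \<eta>)\<^sup>2 \<le> 2 * v"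
    proof -
      have f: "1 - r\<^sup>2 = (1 - r) * (1 + r)" for r :: real
        by (simp add: power2_eq_square algebra_simps)
      show "0 < 1 - (cmod \<zeta>)\<^sup>2" "0 < 1 - (cmod \<eta>)\<^sup>2"
        unfolding f using \<zeta> \<eta> norm_ge_zero[of \<zeta>] norm_ge_zero[of \<eta>] by (intro mult_pos_pos; linarith)+
      show "1 - (cmod \<zeta>)\<^sup>2 \<le> 2 * u" "1 - (cmod \<eta>)\<^sup>2 \<le> 2 * v"
        unfolding f u_def v_def using \<zeta> \<eta>
          mult_left_mono[of "1 + cmod \<zeta>" 2 "1 - cmod \<zeta>"] mult_left_mono[of "1 + cmod \<eta>" 2 "1 - cmod \<eta>"]
        by simp_all
    qed
    let ?n = "cmod (1 - cnj \<zeta> * \<eta>)"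
    have "0 \<le> (1 - (cmod \<zeta>)\<^sup>2) * (1 - (cmod \<eta>)\<^sup>2)"
      using s by simp
    then have "(cmod (\<eta> - \<zeta>))\<^sup>2 \<le> ?n\<^sup>2"
      using norm_one_minus_cnj_mult_sq[of \<zeta> \<eta>] by linarith
    moreover have "c\<^sup>2 \<le> (cmod (\<eta> - \<zeta>))\<^sup>2"
      using c by (intro power_mono) (auto simp: norm_minus_commute)
    ultimately have cn: "c\<^sup>2 \<le> ?n\<^sup>2"
      by linarith
    have n0: "0 < ?n\<^sup>2"
      using cn c(1) zero_less_power[of c 2] by linarith
    have "c\<^sup>2 / (4 * u * v) \<le> ?n\<^sup>2 / ((1 - (cmod \<zeta>)\<^sup>2) * (1 - (cmod \<eta>)\<^sup>2))"
    proof (rule frac_le)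
      show "(1 - (cmod \<zeta>)\<^sup>2) * (1 - (cmod \<eta>)\<^sup>2) \<le> 4 * u * v"
        using mult_mono[OF s(3,4)] s uv by simp
    qed (use cn n0 s in auto)
    also have "\<dots> = 1 / (1 - \<rho>\<^sup>2)"
      using one_minus_pseudohyp_sq[OF \<zeta> \<eta>] n0 s by (simp add: \<rho>_def)
    also have "\<dots> \<le> (1 + \<rho>) / (1 - \<rho>)"
    proof -
      have "1 - \<rho>\<^sup>2 = (1 - \<rho>) * (1 + \<rho>)"
        by (simp add: power2_eq_square algebra_simps)
      then have "1 / (1 - \<rho>\<^sup>2) = (1 / (1 + \<rho>)) / (1 - \<rho>)"
        by simp
      also have "\<dots> \<le> (1 + \<rho>) / (1 - \<rho>)"
      proof (rule divide_right_mono)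
        have "1 / (1 + \<rho>) \<le> 1"
          using \<rho> by simp
        then show "1 / (1 + \<rho>) \<le> 1 + \<rho>"
          using \<rho> by linarith
      qed (use \<rho> in auto)
      finally show ?thesis .
    qed
    also have "\<dots> = exp (2 * artanh \<rho>)"
      using \<rho> by (simp add: exp_2_artanh)
    finally show "c\<^sup>2 / (4 * u * v) \<le> exp (2 * artanh \<rho>)" .
  qed simp
  also have "(4 / c)\<^sup>2 = exp (2 * ln (4 / c))"
    using c(1) by (simp add: exp_double)
  also have "exp (2 * ln (4 / c)) * exp (2 * artanh \<rho>) = exp (2 * (ln (4 / c) + artanh \<rho>))"
    by (simp add: distrib_left exp_add)
  finally show ?thesis
    by (simp add: \<rho>_def)
qed

context bounded_convex_domain
begin

lemma geodesic_disc_kob: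
  "\<lbrakk>geodesic_disc \<phi>; cmod \<zeta> < 1; cmod \<eta> < 1\<rbrakk> \<Longrightarrow> kob (\<phi> \<zeta>) (\<phi> \<eta>) = artanh (pseudohyp \<zeta> \<eta>)"
  by (simp add: geodesic_disc_def)

lemma geodesic_disc_mem: "\<lbrakk>geodesic_disc \<phi>; cmod \<zeta> < 1\<rbrakk> \<Longrightarrow> \<phi> \<zeta> \<in> D"
  by (simp add: geodesic_disc_def disc_in_mem)

lemma geodesic_disc_continuous: "geodesic_disc \<phi> \<Longrightarrow> continuous_on unit_disc \<phi>"
  by (simp add: geodesic_disc_def disc_in_def holomorphic_disc_map_continuous)

lemma geodesic_disc_Moebius:
  assumes "geodesic_disc \<phi>" "cmod a < 1"
  shows "geodesic_disc (\<phi> \<circ> Moebius_function 0 a)"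
  using assms unfolding geodesic_disc_def
  by (simp add: disc_in_Moebius Moebius_function_norm_lt_1 pseudohyp_Moebius)

text \<open>A radius, parametrised by \<open>tanh\<close> to have unit speed, is moved to
  \<open>\<zeta>\<close> by a Moebius map. The Euclidean clause is what later confines a visible
  point to the neighbourhood of two nearby parameters.\<close>

lemma real_geodesic_in_disc:
  assumes \<phi>: "geodesic_disc \<phi>" and \<zeta>: "cmod \<zeta> < 1" and \<eta>: "cmod \<eta> < 1"
  obtains T \<psi> where "real_geodesic D 0 T \<psi>" "\<psi> 0 = \<phi> \<zeta>" "\<psi> T = \<phi> \<eta>"
    "\<And>t. t \<in> {0..T} \<Longrightarrow> \<exists>\<xi>. cmod \<xi> < 1 \<and> \<psi> t = \<phi> \<xi> \<and> cmod (\<xi> - \<zeta>) \<le> cmod (\<eta> - \<zeta>)"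
proof -
  define \<beta> where "\<beta> = Moebius_function 0 \<zeta> \<eta>"
  define b where "b = cmod \<beta>"
  \<comment> \<open>For \<open>\<zeta> = \<eta>\<close> no direction is given; the value 1 keeps
    \<open>u\<close> on the unit circle.\<close>
  define u where "u = (if \<beta> = 0 then 1 else \<beta> / of_real b)"
  define T where "T = artanh b"
  have b: "0 \<le> b" "b < 1"
    using Moebius_function_norm_lt_1[OF \<zeta> \<eta>] by (simp_all add: b_def \<beta>_def)
  have u: "cmod u = 1" "of_real b * u = \<beta>"
    by (simp_all add: u_def b_def norm_divide)
  have T: "0 \<le> T" "tanh T = b"
    using artanh_nonneg[OF b] tanh_artanh_real[of b] b by (simp_all add: T_def)
  define m where "m = (\<lambda>t. Moebius_function 0 (-\<zeta>) (of_real (tanh t) * u))"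
  have w: "cmod (of_real (tanh t) * u) < 1" for t
    using u(1) tanh_real_bounds[of t] by (auto simp: norm_mult abs_less_iff)
  have m1: "cmod (m t) < 1" for t
    unfolding m_def using \<zeta> w by (intro Moebius_function_norm_lt_1) auto
  have mconv: "m t = (of_real (tanh t) * u + \<zeta>) / (1 + cnj \<zeta> * (of_real (tanh t) * u))" for t
    by (simp add: m_def Moebius_function_simple)
  have den: "1 + cnj \<zeta> * (of_real (tanh t) * u) \<noteq> 0" for t
    using one_minus_cnj_mult_nonzero[of "-\<zeta>" "of_real (tanh t) * u"] \<zeta> w[of t] by simp
  have "continuous_on {0..T} m"
    unfolding mconv by (intro continuous_intros) (use den in auto)
  then have cont: "continuous_on {0..T} (\<lambda>t. \<phi> (m t))"
    using m1 by (intro continuous_on_compose2[OF geodesic_disc_continuous[OF \<phi>]]) auto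
  have dist: "pseudohyp (m s) (m t) = \<bar>tanh (s - t)\<bar>" for s t
  proof -
    have "pseudohyp (m s) (m t) = pseudohyp (of_real (tanh s) * u) (of_real (tanh t) * u)"
      unfolding m_def using \<zeta> w by (intro pseudohyp_Moebius) auto
    also have "\<dots> = cmod (of_real (tanh t - tanh s) * u) / cmod (1 - of_real (tanh s * tanh t) * (cnj u * u))"
      by (simp add: pseudohyp_eq algebra_simps)
    also have "cnj u * u = 1"
      using u(1) complex_norm_square[of u] by (simp add: mult.commute)
    also have "cmod (of_real (tanh t - tanh s) * u) = \<bar>tanh t - tanh s\<bar>"
      by (simp only: norm_mult u(1) norm_of_real mult_1_right)
    also have "cmod (1 - of_real (tanh s * tanh t) * 1) = \<bar>1 - tanh s * tanh t\<bar>"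
      by (metis mult.right_neutral norm_of_real of_real_1 of_real_diff)
    finally show ?thesis
      by (simp add: tanh_diff_real abs_divide abs_minus_commute)
  qed
  show ?thesis
  proof
    show "real_geodesic D 0 T (\<lambda>t. \<phi> (m t))"
      unfolding real_geodesic_def
    proof (intro conjI ballI T(1) cont)
      show "(\<lambda>t. \<phi> (m t)) ` {0..T} \<subseteq> D"
        using geodesic_disc_mem[OF \<phi> m1] by auto
      fix s t :: real
      show "kob (\<phi> (m s)) (\<phi> (m t)) = \<bar>s - t\<bar>"
        unfolding geodesic_disc_kob[OF \<phi> m1 m1] dist tanh_real_abs[symmetric] by (rule artanh_tanh_real)
    qed
    have "m 0 = \<zeta>"
      by (simp add: mconv)
    then show "\<phi> (m 0) = \<phi> \<zeta>"
      by simp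
    have mT: "m T = \<eta>"
      using Moebius_inverse(2)[OF \<zeta> \<eta>] by (simp add: m_def T(2) u(2) \<beta>_def)
    then show "\<phi> (m T) = \<phi> \<eta>"
      by simp
    fix t assume t: "t \<in> {0..T}"
    define x where "x = tanh t"
    define a where "a = cnj \<zeta> * u"
    have x: "0 \<le> x" "x \<le> b"
      using t by (auto simp: x_def simp flip: T(2))
    have a: "cmod a \<le> 1"
      using \<zeta> u(1) by (simp add: a_def norm_mult)
    have f: "cmod (m s - \<zeta>) = (1 - (cmod \<zeta>)\<^sup>2) * (tanh s / cmod (1 + a * of_real (tanh s)))" if "0 \<le> tanh s" for s
    proof -
      let ?w = "of_real (tanh s) * u"
      have "m s - \<zeta> = ?w * (1 - \<zeta> * cnj \<zeta>) / (1 + cnj \<zeta> * ?w)"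
        unfolding mconv using den[of s] by (simp add: field_simps)
      moreover have "1 - \<zeta> * cnj \<zeta> = of_real (1 - (cmod \<zeta>)\<^sup>2)"
        by (simp only: of_real_diff complex_norm_square of_real_1)
      moreover have "cnj \<zeta> * ?w = a * of_real (tanh s)"
        by (simp add: a_def)
      moreover have "\<bar>1 - (cmod \<zeta>)\<^sup>2\<bar> = 1 - (cmod \<zeta>)\<^sup>2"
        using \<zeta> by (simp add: power_le_one)
      ultimately have "cmod (m s - \<zeta>) = tanh s * (1 - (cmod \<zeta>)\<^sup>2) / cmod (1 + a * of_real (tanh s))"
        using that u(1) by (simp only: norm_mult norm_divide norm_of_real abs_of_nonneg mult_1_right)
      then show ?thesis
        by simp
    qed
    have d: "0 < cmod (1 + a * of_real (tanh s))" for s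
      using den[of s] by (simp add: a_def mult.assoc mult.commute[of u])
    have "x / cmod (1 + a * of_real x) \<le> b / cmod (1 + a * of_real b)"
      using norm_scaled_denominator_mono[OF x less_imp_le[OF b(2)] a] d[of t] d[of T] T(2)
      by (simp add: x_def field_simps)
    moreover have "0 \<le> 1 - (cmod \<zeta>)\<^sup>2"
      using \<zeta> by (simp add: power_le_one)
    ultimately have "cmod (m t - \<zeta>) \<le> cmod (m T - \<zeta>)"
      unfolding f[OF x(1)[unfolded x_def], folded x_def] f[of T, unfolded T(2), OF b(1)]
      by (rule mult_left_mono)
    then show "\<exists>\<xi>. cmod \<xi> < 1 \<and> \<phi> (m t) = \<phi> \<xi> \<and> cmod (\<xi> - \<zeta>) \<le> cmod (\<eta> - \<zeta>)"
      using m1[of t] mT by auto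
  qed
qed

text \<open>Schwarz-Pick for each coordinate, scaled into the unit disc; the constant depends on
  \<open>D\<close> only.\<close>

lemma disc_in_lipschitz:
  obtains M where "0 < M" "\<And>\<phi> \<zeta> \<eta>. \<lbrakk>disc_in \<phi>; cmod \<zeta> < 1; cmod \<eta> < 1\<rbrakk> \<Longrightarrow> dist (\<phi> \<zeta>) (\<phi> \<eta>) \<le> M * pseudohyp \<zeta> \<eta>"
proof -
  obtain R where R: "0 < R" "\<And>x. x \<in> D \<Longrightarrow> norm x < R"
    using bounded_pos_less bd by metis
  show ?thesis
  proof
    show "0 < real CARD('n) * (2 * R)"
      using R(1) by simp
    fix \<phi> \<zeta> \<eta> assume \<phi>: "disc_in \<phi>" and \<zeta>: "cmod \<zeta> < 1" and \<eta>: "cmod \<eta> < 1"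
    have coord: "cmod ((\<phi> \<zeta> - \<phi> \<eta>) $ i) \<le> 2 * R * pseudohyp \<zeta> \<eta>" for i
    proof -
      define f where "f = (\<lambda>z. \<phi> z $ i / of_real R)"
      have f1: "cmod (f z) < 1" if "cmod z < 1" for z
        using R(2)[OF disc_in_mem[OF \<phi> that]] Finite_Cartesian_Product.norm_nth_le[of "\<phi> z" i] R(1)
        by (simp add: f_def norm_divide)
      have "pseudohyp (f \<zeta>) (f \<eta>) \<le> pseudohyp \<zeta> \<eta>"
      proof (rule schwarz_pick[OF _ _ \<zeta> \<eta>])
        show "f holomorphic_on unit_disc"
          unfolding f_def using \<phi> R(1) by (intro holomorphic_intros) (auto simp: disc_in_def holomorphic_disc_map_def)
        show "f ` unit_disc \<subseteq> unit_disc"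
          using f1 by auto
      qed
      moreover have "cmod (f \<eta> - f \<zeta>) \<le> 2 * pseudohyp (f \<zeta>) (f \<eta>)"
      proof -
        have "cmod (1 - cnj (f \<zeta>) * f \<eta>) \<le> 1 + cmod (f \<zeta>) * cmod (f \<eta>)"
          using norm_triangle_ineq4[of 1 "cnj (f \<zeta>) * f \<eta>"] by (simp add: norm_mult)
        also have "\<dots> \<le> 2"
          using mult_mono[of "cmod (f \<zeta>)" 1 "cmod (f \<eta>)" 1] f1[OF \<zeta>] f1[OF \<eta>] by simp
        finally have n2: "cmod (1 - cnj (f \<zeta>) * f \<eta>) \<le> 2" .
        have n0: "0 < cmod (1 - cnj (f \<zeta>) * f \<eta>)"
          using one_minus_cnj_mult_nonzero[of "f \<zeta>" "f \<eta>"] f1[OF \<zeta>] f1[OF \<eta>] by simp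
        have "cmod (f \<eta> - f \<zeta>) = pseudohyp (f \<zeta>) (f \<eta>) * cmod (1 - cnj (f \<zeta>) * f \<eta>)"
          using n0 by (simp add: pseudohyp_eq)
        also have "\<dots> \<le> pseudohyp (f \<zeta>) (f \<eta>) * 2"
          using n2 by (intro mult_left_mono pseudohyp_nonneg)
        finally show ?thesis
          by simp
      qed
      ultimately have "cmod (f \<zeta> - f \<eta>) \<le> 2 * pseudohyp \<zeta> \<eta>"
        by (simp add: norm_minus_commute)
      moreover have "f \<zeta> - f \<eta> = (\<phi> \<zeta> - \<phi> \<eta>) $ i / of_real R"
        by (simp add: f_def diff_divide_distrib)
      ultimately show ?thesis
        using R(1) by (simp add: norm_divide pos_divide_le_eq algebra_simps del: vector_minus_component)
    qed
    have "norm (\<phi> \<zeta> - \<phi> \<eta>) \<le> (\<Sum>i\<in>UNIV. cmod ((\<phi> \<zeta> - \<phi> \<eta>) $ i))"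
      unfolding norm_vec_def by (rule L2_set_le_sum) simp
    also have "\<dots> \<le> (\<Sum>i\<in>(UNIV::'n set). 2 * R * pseudohyp \<zeta> \<eta>)"
      by (intro sum_mono coord)
    finally show "dist (\<phi> \<zeta>) (\<phi> \<eta>) \<le> real CARD('n) * (2 * R) * pseudohyp \<zeta> \<eta>"
      by (simp add: dist_norm)
  qed
qed

lemma compact_subset_core:
  assumes "compact C" "C \<subseteq> D"
  obtains c where "0 < c" "\<And>z. z \<in> C \<Longrightarrow> c \<le> boundary_dist D z"
proof (cases "C = {}")
  case True
  then show ?thesis
    using that[of 1] by simp
next
  case False
  then obtain z where "z \<in> C" "\<And>y. y \<in> C \<Longrightarrow> boundary_dist D z \<le> boundary_dist D y"
    using continuous_attains_inf[OF assms(1) False boundary_dist_continuous] by blast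
  then show ?thesis
    using that[of "boundary_dist D z", OF boundary_dist_pos[OF subsetD[OF assms(2)]]] by blast
qed

text \<open>Visibility read in the parameters of a disc, with a depth \<open>c\<close> that is the
  same for all discs. The bound on \<open>kob\<close> serves the proof of disc-freeness, the
  Euclidean bound on \<open>\<xi>\<close> that of equicontinuity.\<close>

lemma visible_point_on_disc:
  assumes "visible D" "0 < \<epsilon>"
  obtains c where "0 < c"
    "\<And>\<phi> \<zeta> \<eta>. \<lbrakk>geodesic_disc \<phi>; cmod \<zeta> < 1; cmod \<eta> < 1; \<epsilon> < dist (\<phi> \<zeta>) (\<phi> \<eta>)\<rbrakk> \<Longrightarrow>
       \<exists>\<xi>. cmod \<xi> < 1 \<and> cmod (\<xi> - \<zeta>) \<le> cmod (\<eta> - \<zeta>) \<and> kob (\<phi> \<zeta>) (\<phi> \<xi>) \<le> kob (\<phi> \<zeta>) (\<phi> \<eta>) \<and>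
         c \<le> boundary_dist D (\<phi> \<xi>)"
proof -
  have "\<exists>K. compact (closure K) \<and> closure K \<subseteq> D \<and> (\<forall>a b \<psi>.
      real_geodesic D a b \<psi> \<and> diameter (\<psi> ` {a..b}) > \<epsilon> \<longrightarrow> \<psi> ` {a..b} \<inter> K \<noteq> {})"
    using assms by (simp add: visible_def)
  then obtain K where K: "compact (closure K)" "closure K \<subseteq> D" and
    vis: "\<forall>a b \<psi>. real_geodesic D a b \<psi> \<and> diameter (\<psi> ` {a..b}) > \<epsilon> \<longrightarrow> \<psi> ` {a..b} \<inter> K \<noteq> {}"
    by (elim exE conjE)
  obtain c where c: "0 < c" "\<And>z. z \<in> closure K \<Longrightarrow> c \<le> boundary_dist D z"
    using compact_subset_core[OF K] by metis
  show ?thesis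
  proof (rule that[OF c(1)])
    fix \<phi> \<zeta> \<eta>
    assume \<phi>: "geodesic_disc \<phi>" and \<zeta>: "cmod \<zeta> < 1" and \<eta>: "cmod \<eta> < 1" and far: "\<epsilon> < dist (\<phi> \<zeta>) (\<phi> \<eta>)"
    obtain T \<psi> where \<psi>: "real_geodesic D 0 T \<psi>" "\<psi> 0 = \<phi> \<zeta>" "\<psi> T = \<phi> \<eta>"
      "\<And>t. t \<in> {0..T} \<Longrightarrow> \<exists>\<xi>. cmod \<xi> < 1 \<and> \<psi> t = \<phi> \<xi> \<and> cmod (\<xi> - \<zeta>) \<le> cmod (\<eta> - \<zeta>)"
      using real_geodesic_in_disc[OF \<phi> \<zeta> \<eta>] by metis
    have T: "0 \<le> T" and iso: "\<And>s t. s \<in> {0..T} \<Longrightarrow> t \<in> {0..T} \<Longrightarrow> kob (\<psi> s) (\<psi> t) = \<bar>s - t\<bar>"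
      and sub: "\<psi> ` {0..T} \<subseteq> D"
      using \<psi>(1) by (simp_all add: real_geodesic_def)
    have "dist (\<psi> 0) (\<psi> T) \<le> diameter (\<psi> ` {0..T})"
      by (rule diameter_bounded_bound[OF bounded_subset[OF bd sub]]) (use T in auto)
    then have "\<psi> ` {0..T} \<inter> K \<noteq> {}"
      using far by (intro vis[rule_format] conjI \<psi>(1)) (simp add: \<psi>(2,3))
    then obtain t where t: "t \<in> {0..T}" "\<psi> t \<in> K"
      by blast
    obtain \<xi> where \<xi>: "cmod \<xi> < 1" "\<psi> t = \<phi> \<xi>" "cmod (\<xi> - \<zeta>) \<le> cmod (\<eta> - \<zeta>)"
      using \<psi>(4)[OF t(1)] by blast
    have "kob (\<phi> \<zeta>) (\<phi> \<xi>) \<le> kob (\<phi> \<zeta>) (\<phi> \<eta>)"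
      using iso[of 0 t] iso[of 0 T] t(1) T by (simp add: \<psi>(2,3) \<xi>(2))
    moreover have "c \<le> boundary_dist D (\<phi> \<xi>)"
      using c(2)[OF subsetD[OF closure_subset t(2)]] by (simp add: \<xi>(2))
    ultimately show "\<exists>\<xi>. cmod \<xi> < 1 \<and> cmod (\<xi> - \<zeta>) \<le> cmod (\<eta> - \<zeta>) \<and>
        kob (\<phi> \<zeta>) (\<phi> \<xi>) \<le> kob (\<phi> \<zeta>) (\<phi> \<eta>) \<and> c \<le> boundary_dist D (\<phi> \<xi>)"
      using \<xi>(1,3) by blast
  qed
qed

end

section \<open>Visibility\<close>

context bounded_convex_domain
begin

section \<open>Visibility implies disc-freeness and equicontinuity\<close>

lemma visible_imp_disc_free:
  assumes vis: "visible D"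
  shows "disc_free (frontier D)"
  unfolding disc_free_def
proof (intro allI impI)
  fix g :: "complex \<Rightarrow> complex ^ 'n"
  assume "holomorphic_disc_map g \<and> g ` unit_disc \<subseteq> frontier D"
  then have g: "holomorphic_disc_map g" and gf: "\<And>x. cmod x < 1 \<Longrightarrow> g x \<in> frontier D"
    by (auto simp: image_subset_iff)
  have "g \<alpha> = g 0" if \<alpha>: "cmod \<alpha> < 1" for \<alpha>
  proof (rule ccontr)
    assume "g \<alpha> \<noteq> g 0"
    then have pos: "0 < dist (g 0) (g \<alpha>)"
      by simp
    then have half: "0 < dist (g 0) (g \<alpha>) / 2"
      by simp
    obtain c where c: "0 < c" and pt:
      "\<And>\<phi> \<zeta> \<eta>. \<lbrakk>geodesic_disc \<phi>; cmod \<zeta> < 1; cmod \<eta> < 1; dist (g 0) (g \<alpha>) / 2 < dist (\<phi> \<zeta>) (\<phi> \<eta>)\<rbrakk> \<Longrightarrow>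
         \<exists>\<xi>. cmod \<xi> < 1 \<and> cmod (\<xi> - \<zeta>) \<le> cmod (\<eta> - \<zeta>) \<and> kob (\<phi> \<zeta>) (\<phi> \<xi>) \<le> kob (\<phi> \<zeta>) (\<phi> \<eta>) \<and>
           c \<le> boundary_dist D (\<phi> \<xi>)"
      by (rule visible_point_on_disc[OF vis half]) blast
    obtain b where b: "b \<in> D"
      using ne by blast
    define B where "B = artanh (cmod \<alpha>)"
    \<comment> \<open>The depth that \<open>boundary_dist_lower\<close> will force on
      \<open>h 0\<close>, given a visible point of depth at least \<open>c\<close> at Kobayashi
      distance at most \<open>B\<close>.\<close>
    define e where "e = exp (- 2 * B) * c"
    have e: "0 < e"
      using c by (simp add: e_def)
    \<comment> \<open>Small enough to bring \<open>h 0\<close> closer to the boundary than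
      \<open>e\<close>; the bound \<open>1 / 4\<close> keeps \<open>h 0\<close> and
      \<open>h \<alpha>\<close> more than half as far apart as \<open>g 0\<close> and
      \<open>g \<alpha>\<close>.\<close>
    define t where "t = min (1 / 4) (e / (2 * (norm (g 0 - b) + 1)))"
    have n1: "0 < 2 * (norm (g 0 - b) + 1)"
      by (simp add: add_nonneg_pos)
    have t: "0 < t" "t \<le> 1 / 4"
      unfolding t_def using e n1 by (simp, intro min.cobounded1)
    have "t \<le> e / (2 * (norm (g 0 - b) + 1))"
      unfolding t_def by (rule min.cobounded2)
    then have "t * (2 * (norm (g 0 - b) + 1)) \<le> e"
      unfolding pos_le_divide_eq[OF n1] .
    then have "2 * (t * norm (g 0 - b)) + 2 * t \<le> e"
      by (simp add: algebra_simps)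
    moreover have "0 \<le> t * norm (g 0 - b)"
      using t(1) by simp
    ultimately have tn: "t * norm (g 0 - b) < e"
      using t(1) by linarith
    \<comment> \<open>A disc in \<open>D\<close> for each such \<open>t\<close>, so the distance
      from \<open>h 0\<close> to \<open>h \<alpha>\<close> is at most \<open>B\<close>,
      independently of \<open>t\<close>.\<close>
    define h where "h = (\<lambda>x. g x - t *\<^sub>R (g x - b))"
    have "h x \<in> D" if "cmod x < 1" for x
    proof -
      have "g x - t *\<^sub>R (g x - b) \<in> interior D"
        using b op gf[OF that] t
        by (intro mem_interior_closure_convex_shrink[OF cv]) (auto simp: interior_open frontier_def)
      then show ?thesis
        by (simp add: h_def interior_open[OF op])
    qed
    moreover have "holomorphic_disc_map h"
      using g by (auto simp: h_def holomorphic_disc_map_def scaleR_conv_of_real intro!: holomorphic_intros)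
    ultimately have h: "disc_in h"
      by (auto simp: disc_in_def)
    have hD: "h 0 \<in> D" "h \<alpha> \<in> D"
      using disc_in_mem[OF h] \<alpha> by simp_all
    have "h 0 - h \<alpha> = (1 - t) *\<^sub>R (g 0 - g \<alpha>)"
      by (simp add: h_def algebra_simps)
    then have "dist (h 0) (h \<alpha>) = (1 - t) * dist (g 0) (g \<alpha>)"
      using t by (simp add: dist_norm)
    moreover have "1 / 2 * dist (g 0) (g \<alpha>) < (1 - t) * dist (g 0) (g \<alpha>)"
      using t pos by (intro mult_strict_right_mono) auto
    ultimately have far: "dist (g 0) (g \<alpha>) / 2 < dist (h 0) (h \<alpha>)"
      by simp
    then have "h 0 \<noteq> h \<alpha>"
      using pos by auto
    then obtain \<phi> \<eta> where \<phi>: "geodesic_disc \<phi>" "cmod \<eta> < 1" "\<phi> 0 = h 0" "\<phi> \<eta> = h \<alpha>"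
      by (rule geodesic_disc_exists[OF hD])
    obtain \<xi> where \<xi>: "cmod \<xi> < 1" "kob (\<phi> 0) (\<phi> \<xi>) \<le> kob (\<phi> 0) (\<phi> \<eta>)" "c \<le> boundary_dist D (\<phi> \<xi>)"
      using pt[OF \<phi>(1) _ \<phi>(2), of 0] far unfolding \<phi>(3,4) by auto
    have "kob (h 0) (h \<alpha>) \<le> B"
      using lempert_le[OF h, of 0 \<alpha>] \<alpha> by (simp add: kobayashi_eq_lempert hD pseudohyp_0 B_def)
    then have "kob (\<phi> \<xi>) (\<phi> 0) \<le> B"
      using \<xi>(2) unfolding \<phi>(4) \<phi>(3) kob_commute[of "\<phi> \<xi>"] by linarith
    then have "e \<le> boundary_dist D (\<phi> 0)"
      unfolding e_def
      by (intro boundary_dist_lower[of "\<phi> \<xi>"] \<xi>(3) geodesic_disc_mem[OF \<phi>(1)] \<xi>(1)) simp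
    moreover have "boundary_dist D (h 0) \<le> t * norm (g 0 - b)"
    proof -
      have "boundary_dist D (h 0) \<le> dist (h 0) (g 0)"
        unfolding boundary_dist_def by (rule infdist_le) (simp add: gf)
      then show ?thesis
        using t(1) by (simp add: h_def dist_norm)
    qed
    ultimately show False
      using tn \<phi>(3) by simp
  qed
  then have "\<forall>x\<in>unit_disc. g x = g 0"
    by (intro ballI) (simp only: mem_ball_0)
  then show "g constant_on unit_disc"
    unfolding constant_on_def by (rule exI)
qed

lemma visible_imp_equicontinuous:
  assumes vis: "visible D"
  shows "uniformly_equicontinuous_on unit_disc (centred_geodesics D)"
  unfolding uniformly_equicontinuous_on_def
proof (intro allI impI)
  fix \<epsilon> :: real assume \<epsilon>: "0 < \<epsilon>"
  then have half: "0 < \<epsilon> / 2"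
    by simp
  obtain c where c: "0 < c" and pt:
    "\<And>\<phi> \<zeta> \<eta>. \<lbrakk>geodesic_disc \<phi>; cmod \<zeta> < 1; cmod \<eta> < 1; \<epsilon> / 2 < dist (\<phi> \<zeta>) (\<phi> \<eta>)\<rbrakk> \<Longrightarrow>
       \<exists>\<xi>. cmod \<xi> < 1 \<and> cmod (\<xi> - \<zeta>) \<le> cmod (\<eta> - \<zeta>) \<and> kob (\<phi> \<zeta>) (\<phi> \<xi>) \<le> kob (\<phi> \<zeta>) (\<phi> \<eta>) \<and>
         c \<le> boundary_dist D (\<phi> \<xi>)"
    by (rule visible_point_on_disc[OF vis half]) blast
  obtain b where b: "b \<in> D"
    using ne by blast
  obtain B where B: "\<And>z. z \<in> core c \<Longrightarrow> kob b z \<le> B"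
    by (rule kob_bounded_on_core[OF c b]) blast
  obtain M where M: "0 < M" "\<And>\<phi> \<zeta> \<eta>. \<lbrakk>disc_in \<phi>; cmod \<zeta> < 1; cmod \<eta> < 1\<rbrakk> \<Longrightarrow> dist (\<phi> \<zeta>) (\<phi> \<eta>) \<le> M * pseudohyp \<zeta> \<eta>"
    by (rule disc_in_lipschitz) blast
  \<comment> \<open>The visible point and, by maximality, the centre both have depth at least
    \<open>c\<close>, so each is within \<open>B\<close> of \<open>b\<close>; the parameter
    \<open>\<xi>\<close> is then at hyperbolic distance at most \<open>2 * B\<close> from 0.\<close>
  define r where "r = tanh (2 * B)"
  define q where "q = 1 - r"
  have q: "0 < q"
    by (simp add: q_def r_def tanh_real_lt_1)
  \<comment> \<open>The first bound keeps \<open>\<zeta>\<close>, which is within \<open>d\<close>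
    of \<open>\<xi>\<close>, more than \<open>q / 2\<close> inside the circle; the second then
    brings the Lipschitz estimate down to \<open>\<epsilon> / 2\<close>.\<close>
  define d where "d = min (q / 2) (\<epsilon> * (q / 2) / (2 * M))"
  have d: "0 < d" "d \<le> q / 2" "d \<le> \<epsilon> * (q / 2) / (2 * M)"
    using q \<epsilon> M(1) by (auto simp: d_def)
  show "\<exists>\<delta>>0. \<forall>f\<in>centred_geodesics D. \<forall>x\<in>unit_disc. \<forall>y\<in>unit_disc. dist x y < \<delta> \<longrightarrow> dist (f x) (f y) < \<epsilon>"
  proof (intro exI[of _ d] conjI d(1) ballI impI, rule ccontr)
    fix \<phi> \<zeta> \<eta>
    assume F: "\<phi> \<in> centred_geodesics D" and "\<zeta> \<in> unit_disc" "\<eta> \<in> unit_disc" and near: "dist \<zeta> \<eta> < d"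
      and "\<not> dist (\<phi> \<zeta>) (\<phi> \<eta>) < \<epsilon>"
    then have \<zeta>: "cmod \<zeta> < 1" and \<eta>: "cmod \<eta> < 1" and far: "\<epsilon> \<le> dist (\<phi> \<zeta>) (\<phi> \<eta>)"
      by auto
    have \<phi>: "geodesic_disc \<phi>" and cen: "\<And>x. cmod x < 1 \<Longrightarrow> boundary_dist D (\<phi> x) \<le> boundary_dist D (\<phi> 0)"
      using F by (auto simp: centred_geodesics_def complex_geodesic_iff)
    obtain \<xi> where \<xi>: "cmod \<xi> < 1" "cmod (\<xi> - \<zeta>) \<le> cmod (\<eta> - \<zeta>)" "c \<le> boundary_dist D (\<phi> \<xi>)"
      using pt[OF \<phi> \<zeta> \<eta>] far \<epsilon> by auto
    have D0: "\<phi> 0 \<in> D" "\<phi> \<xi> \<in> D"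
      using geodesic_disc_mem[OF \<phi>] \<xi>(1) by simp_all
    have "\<phi> \<xi> \<in> core c" "\<phi> 0 \<in> core c"
      using \<xi>(3) cen[OF \<xi>(1)] by (auto intro!: mem_core D0)
    from B[OF this(1)] B[OF this(2)] have "kob (\<phi> 0) (\<phi> \<xi>) \<le> 2 * B"
      using kob_triangle[OF D0(1) b D0(2)] kob_commute[of b "\<phi> 0"] by linarith
    then have "artanh (cmod \<xi>) \<le> 2 * B"
      using geodesic_disc_kob[OF \<phi> _ \<xi>(1), of 0] by (simp add: pseudohyp_0)
    then have \<xi>r: "cmod \<xi> \<le> r"
      unfolding r_def using \<xi>(1) by (intro artanh_le_imp_le_tanh) auto
    have "cmod \<zeta> \<le> cmod \<xi> + cmod (\<xi> - \<zeta>)"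
      using norm_triangle_ineq4[of \<xi> "\<xi> - \<zeta>"] by simp
    also have "\<dots> < r + d"
      using \<xi>r \<xi>(2) near by (simp add: dist_norm norm_minus_commute)
    also have "\<dots> \<le> 1 - q / 2"
      using d(2) by (simp add: q_def field_simps)
    finally have \<zeta>q: "cmod \<zeta> < 1 - q / 2" .
    have "cmod \<zeta> * cmod \<eta> \<le> cmod \<zeta>"
      using \<eta> by (simp add: mult_left_le)
    then have den: "q / 2 \<le> cmod (1 - cnj \<zeta> * \<eta>)"
      using norm_triangle_ineq2[of 1 "cnj \<zeta> * \<eta>"] \<zeta>q by (simp add: norm_mult)
    have "pseudohyp \<zeta> \<eta> \<le> d / (q / 2)"
      unfolding pseudohyp_eq using near den q d by (intro frac_le) (auto simp: dist_norm norm_minus_commute)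
    also have "\<dots> \<le> (\<epsilon> * (q / 2) / (2 * M)) / (q / 2)"
      using d(3) q by (intro divide_right_mono) auto
    also have "\<dots> = \<epsilon> / (2 * M)"
      using q by simp
    finally have "M * pseudohyp \<zeta> \<eta> \<le> M * (\<epsilon> / (2 * M))"
      using M(1) by (intro mult_left_mono) auto
    then have "dist (\<phi> \<zeta>) (\<phi> \<eta>) \<le> \<epsilon> / 2"
      using M(2)[of \<phi> \<zeta> \<eta>] \<phi> \<zeta> \<eta> M(1) by (simp add: geodesic_disc_def)
    then show False
      using far \<epsilon> by simp
  qed
qed

section \<open>Disc-freeness and equicontinuity imply visibility\<close>

lemma centred_geodesic_exists:
  assumes z: "z \<in> D" "w \<in> D" "z \<noteq> w"
  obtains \<phi> \<zeta> \<eta> where "\<phi> \<in> centred_geodesics D" "cmod \<zeta> < 1" "cmod \<eta> < 1" "\<phi> \<zeta> = z" "\<phi> \<eta> = w"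
proof -
  obtain \<phi> \<alpha> where \<phi>: "geodesic_disc \<phi>" "cmod \<alpha> < 1" "\<phi> 0 = z" "\<phi> \<alpha> = w"
    by (rule geodesic_disc_exists[OF z])
  define c where "c = boundary_dist D (\<phi> 0)"
  have D0: "\<phi> 0 \<in> D"
    using z(1) \<phi>(3) by simp
  have c: "0 < c"
    unfolding c_def by (rule boundary_dist_pos[OF D0])
  obtain B where B: "\<And>z. z \<in> core c \<Longrightarrow> kob (\<phi> 0) z \<le> B"
    by (rule kob_bounded_on_core[OF c D0]) blast
  define r where "r = tanh B"
  \<comment> \<open>A geodesic disc is proper: depth at least \<open>c\<close> bounds the Kobayashi
    distance to \<open>\<phi> 0\<close>, which is the hyperbolic distance of the parameter to 0.
    Hence the maximal depth is attained in a compact subdisc.\<close>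
  have in_r: "cmod x \<le> r" if "cmod x < 1" "c \<le> boundary_dist D (\<phi> x)" for x
  proof -
    have "kob (\<phi> 0) (\<phi> x) \<le> B"
      using that by (intro B mem_core geodesic_disc_mem[OF \<phi>(1)])
    then have "artanh (cmod x) \<le> B"
      using geodesic_disc_kob[OF \<phi>(1) _ that(1), of 0] by (simp add: pseudohyp_0)
    then show ?thesis
      unfolding r_def using that(1) by (intro artanh_le_imp_le_tanh) auto
  qed
  have r: "0 \<le> r" "r < 1"
    using in_r[of 0] by (auto simp: c_def r_def tanh_real_lt_1)
  have sub: "cball 0 r \<subseteq> unit_disc"
    using r by auto
  have "continuous_on (cball 0 r) (\<lambda>x. boundary_dist D (\<phi> x))"
    by (rule continuous_on_compose2[OF boundary_dist_continuous[of UNIV]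
          continuous_on_subset[OF geodesic_disc_continuous[OF \<phi>(1)] sub]]) simp
  moreover have "cball 0 r \<noteq> ({} :: complex set)"
    using r by auto
  ultimately obtain a where a: "a \<in> cball 0 r" "\<And>x. x \<in> cball 0 r \<Longrightarrow> boundary_dist D (\<phi> x) \<le> boundary_dist D (\<phi> a)"
    using continuous_attains_sup[OF compact_cball] by metis
  have a1: "cmod a < 1"
    using a(1) r by simp
  have max: "boundary_dist D (\<phi> x) \<le> boundary_dist D (\<phi> a)" if "cmod x < 1" for x
  proof (cases "c \<le> boundary_dist D (\<phi> x)")
    case True
    then show ?thesis
      using in_r[OF that] a(2) by simp
  next
    case False
    then show ?thesis
      using a(2)[of 0] r(1) by (simp add: c_def)
  qed
  define \<psi> where "\<psi> = \<phi> \<circ> Moebius_function 0 (-a)"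
  have "geodesic_disc \<psi>"
    unfolding \<psi>_def using a1 by (intro geodesic_disc_Moebius \<phi>(1)) simp
  moreover have "boundary_dist D (\<psi> x) \<le> boundary_dist D (\<psi> 0)" if "cmod x < 1" for x
    using max[of "Moebius_function 0 (-a) x"] Moebius_function_norm_lt_1[of "-a" x 0] a1 that
    by (simp add: \<psi>_def Moebius_minus_0)
  ultimately have "\<psi> \<in> centred_geodesics D"
    by (simp add: centred_geodesics_def complex_geodesic_iff)
  then show ?thesis
  proof (rule that)
    show "cmod (Moebius_function 0 a 0) < 1" "cmod (Moebius_function 0 a \<alpha>) < 1"
      using a1 \<phi>(2) by (simp_all add: Moebius_function_norm_lt_1)
    show "\<psi> (Moebius_function 0 a 0) = z" "\<psi> (Moebius_function 0 a \<alpha>) = w"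
      using Moebius_inverse(2)[OF a1, of 0] Moebius_inverse(2)[OF a1 \<phi>(2)] \<phi>(3,4) by (simp_all add: \<psi>_def)
  qed
qed

text \<open>Otherwise centred discs converge to a disc in the boundary, which is constant. Locally
  uniform convergence says nothing about parameters that tend to the circle; equicontinuity replaces
  them by fixed parameters inside the disc, where constancy of the limit contradicts the distance
  \<open>c\<close>.\<close>

lemma centres_bounded_away:
  assumes df: "disc_free (frontier D)"
    and eq: "uniformly_equicontinuous_on unit_disc (centred_geodesics D)" and c: "0 < c"
  obtains c' where "0 < c'" "\<And>\<phi> \<zeta> \<eta>. \<lbrakk>\<phi> \<in> centred_geodesics D; cmod \<zeta> < 1; cmod \<eta> < 1; c \<le> dist (\<phi> \<zeta>) (\<phi> \<eta>)\<rbrakk>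
      \<Longrightarrow> c' \<le> boundary_dist D (\<phi> 0)"
proof (rule ccontr)
  assume contra: "\<not> thesis"
  have "\<exists>\<phi> \<zeta> \<eta>. \<phi> \<in> centred_geodesics D \<and> cmod \<zeta> < 1 \<and> cmod \<eta> < 1 \<and> c \<le> dist (\<phi> \<zeta>) (\<phi> \<eta>) \<and>
      boundary_dist D (\<phi> 0) < 1 / real (Suc n)" for n
  proof (rule ccontr)
    assume none: "\<not> ?thesis"
    have thesis
    proof (rule that[of "1 / real (Suc n)"])
      fix \<phi> \<zeta> \<eta>
      assume "\<phi> \<in> centred_geodesics D" "cmod \<zeta> < 1" "cmod \<eta> < 1" "c \<le> dist (\<phi> \<zeta>) (\<phi> \<eta>)"
      then have "\<not> boundary_dist D (\<phi> 0) < 1 / real (Suc n)"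
        using none by blast
      then show "1 / real (Suc n) \<le> boundary_dist D (\<phi> 0)"
        by (rule leI)
    qed simp
    with contra show False ..
  qed
  then obtain \<phi> \<zeta> \<eta> where F: "\<And>n. \<phi> n \<in> centred_geodesics D" and \<zeta>: "\<And>n. cmod (\<zeta> n) < 1" and \<eta>: "\<And>n. cmod (\<eta> n) < 1"
    and far: "\<And>n. c \<le> dist (\<phi> n (\<zeta> n)) (\<phi> n (\<eta> n))" and sm: "\<And>n. boundary_dist D (\<phi> n 0) < 1 / real (Suc n)"
    by metis
  have geo: "geodesic_disc (\<phi> n)" and cen: "cmod x < 1 \<Longrightarrow> boundary_dist D (\<phi> n x) \<le> boundary_dist D (\<phi> n 0)" for n x
    using F[of n] by (auto simp: centred_geodesics_def complex_geodesic_iff)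
  \<comment> \<open>Pairs, so that one subsequence serves both parameters.\<close>
  have "bounded (range (\<lambda>n. (\<zeta> n, \<eta> n)))"
  proof -
    have "range (\<lambda>n. (\<zeta> n, \<eta> n)) \<subseteq> unit_disc \<times> unit_disc"
      using \<zeta> \<eta> by auto
    then show ?thesis
      by (rule bounded_subset[OF bounded_Times[OF bounded_ball bounded_ball]])
  qed
  then obtain p r1 where r1: "strict_mono (r1 :: nat \<Rightarrow> nat)" "((\<lambda>n. (\<zeta> n, \<eta> n)) \<circ> r1) \<longlonglongrightarrow> p"
    using bounded_imp_convergent_subsequence by blast
  have hol: "holomorphic_disc_map (\<phi> (r1 n))" "\<phi> (r1 n) ` unit_disc \<subseteq> D" for n
    using geo by (simp_all add: geodesic_disc_def disc_in_def)
  obtain r2 g where r2: "strict_mono (r2 :: nat \<Rightarrow> nat)" "holomorphic_disc_map g" and lim: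
    "\<And>\<alpha> a \<rho>. \<rho> < 1 \<Longrightarrow> (\<And>n. cmod (\<alpha> n) \<le> \<rho>) \<Longrightarrow> \<alpha> \<longlonglongrightarrow> a \<Longrightarrow> (\<lambda>n. \<phi> (r1 (r2 n)) (\<alpha> n)) \<longlonglongrightarrow> g a"
    by (rule Montel_disc_maps[of "\<lambda>n. \<phi> (r1 n)", OF hol(1) bd hol(2)]) blast
  define s where "s = (\<lambda>n. r1 (r2 n))"
  have s: "strict_mono s"
    using strict_mono_o[OF r1(1) r2(1)] by (simp add: s_def o_def)
  have pl: "(\<lambda>n. (\<zeta> (s n), \<eta> (s n))) \<longlonglongrightarrow> p"
    using LIMSEQ_subseq_LIMSEQ[OF r1(2) r2(1)] by (simp add: o_def s_def)
  have \<zeta>l: "(\<lambda>n. \<zeta> (s n)) \<longlonglongrightarrow> fst p" and \<eta>l: "(\<lambda>n. \<eta> (s n)) \<longlonglongrightarrow> snd p"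
    using tendsto_fst[OF pl] tendsto_snd[OF pl] by simp_all
  have gl: "(\<lambda>n. \<phi> (s n) x) \<longlonglongrightarrow> g x" if "cmod x < 1" for x
    using lim[OF that order.refl, of x] by (simp add: s_def)
  have "g x \<in> frontier D" if x: "cmod x < 1" for x
  proof -
    have "(\<lambda>n. boundary_dist D (\<phi> (s n) x)) \<longlonglongrightarrow> boundary_dist D (g x)"
      unfolding boundary_dist_def by (intro tendsto_infdist gl x)
    moreover have "(\<lambda>n. boundary_dist D (\<phi> (s n) x)) \<longlonglongrightarrow> 0"
    proof (rule tendsto_sandwich[OF _ _ tendsto_const])
      show "\<forall>\<^sub>F n in sequentially. 0 \<le> boundary_dist D (\<phi> (s n) x)"
        by (simp add: boundary_dist_def infdist_nonneg)
      show "\<forall>\<^sub>F n in sequentially. boundary_dist D (\<phi> (s n) x) \<le> 1 / real (Suc (s n))"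
        using cen[OF x] sm by (intro always_eventually allI) (meson less_imp_le order_trans)
      have "(\<lambda>n. 1 / real (Suc n)) \<longlonglongrightarrow> 0"
        using LIMSEQ_inverse_real_of_nat unfolding inverse_eq_divide .
      from LIMSEQ_subseq_LIMSEQ[OF this s] show "(\<lambda>n. 1 / real (Suc (s n))) \<longlonglongrightarrow> 0"
        unfolding o_def .
    qed
    ultimately have "boundary_dist D (g x) = 0"
      by (rule LIMSEQ_unique)
    then show ?thesis
      unfolding boundary_dist_def
      using in_closed_iff_infdist_zero[OF frontier_closed frontier_nonempty] by blast
  qed
  then have "g constant_on unit_disc"
    using df r2(2) by (auto simp: disc_free_def)
  then have gconst: "g x = g y" if "cmod x < 1" "cmod y < 1" for x y
    using that by (auto simp: constant_on_def)
  \<comment> \<open>Three errors of \<open>c / 4\<close> will add up to less than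
    \<open>c\<close>.\<close>
  have "\<exists>d>0. \<forall>f\<in>centred_geodesics D. \<forall>x\<in>unit_disc. \<forall>y\<in>unit_disc. dist x y < d \<longrightarrow> dist (f x) (f y) < c / 4"
    by (rule eq[unfolded uniformly_equicontinuous_on_def, rule_format]) (use c in simp)
  then obtain d where d0: "0 < d"
    and d1: "\<forall>f\<in>centred_geodesics D. \<forall>x\<in>unit_disc. \<forall>y\<in>unit_disc. dist x y < d \<longrightarrow> dist (f x) (f y) < c / 4"
    by (elim exE conjE)
  have d: "dist (\<phi> n x) (\<phi> n y) < c / 4" if "cmod x < 1" "cmod y < 1" "dist x y < d" for n x y
    using d1[rule_format, OF F[of n], of x y] that by simp
  \<comment> \<open>The fixed parameter is a late term of the sequence itself: it lies in the disc
    even if the limit \<open>a\<close> is on the circle.\<close>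
  have ex: "\<exists>x. cmod x < 1 \<and> (\<forall>\<^sub>F n in sequentially. dist (\<phi> (s n) (f (s n))) (\<phi> (s n) x) < c / 4)"
    if f: "\<And>n. cmod (f n) < 1" and fl: "(\<lambda>n. f (s n)) \<longlonglongrightarrow> a" for f :: "nat \<Rightarrow> complex" and a
  proof -
    obtain N where N: "dist (f (s N)) a < d / 2"
      using metric_LIMSEQ_D[OF fl, of "d / 2"] d0 by auto
    have "\<forall>\<^sub>F n in sequentially. dist (f (s n)) a < d / 2"
      using tendstoD[OF fl, of "d / 2"] d0 by simp
    then have "\<forall>\<^sub>F n in sequentially. dist (\<phi> (s n) (f (s n))) (\<phi> (s n) (f (s N))) < c / 4"
    proof eventually_elim
      case (elim n)
      then have "dist (f (s n)) (f (s N)) < d"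
        using N dist_triangle_half_l[of "f (s n)" a d "f (s N)"] by (simp add: dist_commute)
      then show ?case
        by (intro d f)
    qed
    then show ?thesis
      using f by blast
  qed
  obtain x where x: "cmod x < 1" "\<forall>\<^sub>F n in sequentially. dist (\<phi> (s n) (\<zeta> (s n))) (\<phi> (s n) x) < c / 4"
    using ex[OF \<zeta> \<zeta>l] by blast
  obtain y where y: "cmod y < 1" "\<forall>\<^sub>F n in sequentially. dist (\<phi> (s n) (\<eta> (s n))) (\<phi> (s n) y) < c / 4"
    using ex[OF \<eta> \<eta>l] by blast
  have "(\<lambda>n. dist (\<phi> (s n) x) (\<phi> (s n) y)) \<longlonglongrightarrow> dist (g x) (g y)"
    by (intro tendsto_dist gl x y)
  then have "\<forall>\<^sub>F n in sequentially. dist (\<phi> (s n) x) (\<phi> (s n) y) < c / 4"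
    using gconst[OF x(1) y(1)] c by (intro order_tendstoD(2)) auto
  with x(2) y(2) have "\<forall>\<^sub>F n in sequentially. False"
  proof eventually_elim
    case (elim n)
    have "dist (\<phi> (s n) (\<zeta> (s n))) (\<phi> (s n) (\<eta> (s n))) \<le>
        dist (\<phi> (s n) (\<zeta> (s n))) (\<phi> (s n) x) + (dist (\<phi> (s n) x) (\<phi> (s n) y) + dist (\<phi> (s n) y) (\<phi> (s n) (\<eta> (s n))))"
      using dist_triangle[of "\<phi> (s n) (\<zeta> (s n))" "\<phi> (s n) (\<eta> (s n))" "\<phi> (s n) x"]
        dist_triangle[of "\<phi> (s n) x" "\<phi> (s n) (\<eta> (s n))" "\<phi> (s n) y"] by linarith
    then show False
      using far[of "s n"] elim c by (simp add: dist_commute)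
  qed
  then show False
    by simp
qed

text \<open>On a centred geodesic through \<open>z\<close> and \<open>w\<close>, equicontinuity
  keeps the parameters at least \<open>d\<close> apart, and the estimate in the disc bounds the
  Gromov product based at \<open>\<phi> 0\<close>. As the centre lies in a core, moving the base
  point to \<open>b\<close> costs at most \<open>B\<close> for each of the two points.\<close>

lemma gromov_product_bound:
  assumes df: "disc_free (frontier D)"
    and eq: "uniformly_equicontinuous_on unit_disc (centred_geodesics D)" and c: "0 < c" and b: "b \<in> D"
  obtains C where "\<And>z w. \<lbrakk>z \<in> D; w \<in> D; c \<le> dist z w\<rbrakk> \<Longrightarrow> kob z b + kob w b - C \<le> kob z w"
proof -
  obtain c' where c': "0 < c'" "\<And>\<phi> \<zeta> \<eta>. \<lbrakk>\<phi> \<in> centred_geodesics D; cmod \<zeta> < 1; cmod \<eta> < 1; c \<le> dist (\<phi> \<zeta>) (\<phi> \<eta>)\<rbrakk>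
      \<Longrightarrow> c' \<le> boundary_dist D (\<phi> 0)"
    by (rule centres_bounded_away[OF df eq c]) blast
  obtain B where B: "\<And>z. z \<in> core c' \<Longrightarrow> kob b z \<le> B"
    by (rule kob_bounded_on_core[OF c'(1) b]) blast
  have "\<exists>d>0. \<forall>f\<in>centred_geodesics D. \<forall>x\<in>unit_disc. \<forall>y\<in>unit_disc. dist x y < d \<longrightarrow> dist (f x) (f y) < c"
    by (rule eq[unfolded uniformly_equicontinuous_on_def, rule_format, OF c])
  then obtain d where d: "0 < d"
    and d1: "\<forall>f\<in>centred_geodesics D. \<forall>x\<in>unit_disc. \<forall>y\<in>unit_disc. dist x y < d \<longrightarrow> dist (f x) (f y) < c"
    by (elim exE conjE)
  show ?thesis
  proof (rule that[of "ln (4 / d) + 2 * B"])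
    fix z w assume z: "z \<in> D" "w \<in> D" and far: "c \<le> dist z w"
    then have "z \<noteq> w"
      using c by auto
    then obtain \<phi> \<zeta> \<eta> where F: "\<phi> \<in> centred_geodesics D" and \<zeta>: "cmod \<zeta> < 1" and \<eta>: "cmod \<eta> < 1"
      and im: "\<phi> \<zeta> = z" "\<phi> \<eta> = w"
      by (rule centred_geodesic_exists[OF z])
    have \<phi>: "geodesic_disc \<phi>"
      using F by (simp add: centred_geodesics_def complex_geodesic_iff)
    have D0: "\<phi> 0 \<in> D"
      by (rule geodesic_disc_mem[OF \<phi>]) simp
    have "d \<le> cmod (\<zeta> - \<eta>)"
    proof (rule ccontr)
      assume "\<not> d \<le> cmod (\<zeta> - \<eta>)"
      then have "dist \<zeta> \<eta> < d"
        by (simp add: dist_norm)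
      then have "dist (\<phi> \<zeta>) (\<phi> \<eta>) < c"
        using d1[rule_format, OF F, of \<zeta> \<eta>] \<zeta> \<eta> by simp
      then show False
        using far by (simp add: im)
    qed
    from artanh_pseudohyp_ge[OF d this \<zeta> \<eta>]
    have "kob z (\<phi> 0) + kob w (\<phi> 0) - ln (4 / d) \<le> kob z w"
      using geodesic_disc_kob[OF \<phi> \<zeta> \<eta>] geodesic_disc_kob[OF \<phi> \<zeta>, of 0] geodesic_disc_kob[OF \<phi> \<eta>, of 0]
      by (simp add: im pseudohyp_0)
    moreover have "kob (\<phi> 0) b \<le> B"
      using B[OF mem_core[OF D0 c'(2)[OF F \<zeta> \<eta>]]] far by (simp add: im kob_commute[of b])
    ultimately show "kob z b + kob w b - (ln (4 / d) + 2 * B) \<le> kob z w"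
      using kob_triangle[OF z(1) D0 b] kob_triangle[OF z(2) D0 b] by linarith
  qed
qed

lemma equicontinuous_imp_visible:
  assumes df: "disc_free (frontier D)"
    and eq: "uniformly_equicontinuous_on unit_disc (centred_geodesics D)"
  shows "visible D"
  unfolding visible_def
proof (intro conjI allI impI bd mcomplete_kob)
  show "is_domain D"
    using op cv ne by (simp add: is_domain_def convex_connected)
  fix \<epsilon> :: real assume \<epsilon>: "0 < \<epsilon>"
  obtain b where b: "b \<in> D"
    using ne by blast
  have "0 < \<epsilon> / 2"
    using \<epsilon> by simp
  from gromov_product_bound[OF df eq this b]
  obtain C where C: "\<And>z w. \<lbrakk>z \<in> D; w \<in> D; \<epsilon> / 2 \<le> dist z w\<rbrakk> \<Longrightarrow> kob z b + kob w b - C \<le> kob z w"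
    by blast
  define c where "c = exp (- 2 * C) * boundary_dist D b"
  have c: "0 < c"
    using boundary_dist_pos[OF b] by (simp add: c_def)
  show "\<exists>K. compact (closure K) \<and> closure K \<subseteq> D \<and>
      (\<forall>a b \<psi>. real_geodesic D a b \<psi> \<and> \<epsilon> < diameter (\<psi> ` {a..b}) \<longrightarrow> \<psi> ` {a..b} \<inter> K \<noteq> {})"
  proof (intro exI[of _ "core c"] conjI allI impI)
    have cl: "closure (core c) = core c"
      using compact_core compact_imp_closed by (intro closure_closed) blast
    show "compact (closure (core c))" "closure (core c) \<subseteq> D"
      unfolding cl by (rule compact_core, rule core_subset[OF c])
    fix l u \<psi> assume "real_geodesic D l u \<psi> \<and> \<epsilon> < diameter (\<psi> ` {l..u})"
    then have cont: "continuous_on {l..u} \<psi>" and sub: "\<psi> ` {l..u} \<subseteq> D" and big: "\<epsilon> < diameter (\<psi> ` {l..u})"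
      and iso: "\<And>s t. s \<in> {l..u} \<Longrightarrow> t \<in> {l..u} \<Longrightarrow> kob (\<psi> s) (\<psi> t) = \<bar>s - t\<bar>"
      by (simp_all add: real_geodesic_def)
    have "\<exists>x\<in>\<psi> ` {l..u}. \<exists>y\<in>\<psi> ` {l..u}. \<epsilon> < dist x y"
      using diameter_lower_bounded[OF bounded_subset[OF bd sub] \<epsilon> big] .
    then obtain s0 t0 where st0: "s0 \<in> {l..u}" "t0 \<in> {l..u}" "\<epsilon> < dist (\<psi> s0) (\<psi> t0)"
      by blast
    obtain s t where st: "s \<in> {l..u}" "t \<in> {l..u}" "s \<le> t" "\<epsilon> < dist (\<psi> s) (\<psi> t)"
    proof (cases "s0 \<le> t0")
      case True
      then show ?thesis
        using that st0 by blast
    next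
      case False
      then show ?thesis
        using that[of t0 s0] st0 by (simp add: dist_commute)
    qed
    \<comment> \<open>An intermediate point at distance exactly \<open>\<epsilon> / 2\<close> from
      \<open>\<psi> s\<close> is at least as far from \<open>\<psi> t\<close>, so the Gromov bound
      applies on both sides of it.\<close>
    have "continuous_on {s..t} (\<lambda>x. dist (\<psi> s) (\<psi> x))"
      using st(1,2) by (intro continuous_intros continuous_on_subset[OF cont]) auto
    then obtain x where x: "s \<le> x" "x \<le> t" "dist (\<psi> s) (\<psi> x) = \<epsilon> / 2"
      using IVT'[of "\<lambda>x. dist (\<psi> s) (\<psi> x)" s "\<epsilon> / 2" t] st(3,4) \<epsilon> by auto
    have xi: "x \<in> {l..u}"
      using x st(1,2) by auto
    have D3: "\<psi> s \<in> D" "\<psi> x \<in> D" "\<psi> t \<in> D"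
      using sub st(1,2) xi by auto
    have "\<epsilon> / 2 \<le> dist (\<psi> x) (\<psi> t)"
      using dist_triangle[of "\<psi> s" "\<psi> t" "\<psi> x"] x(3) st(4) by linarith
    \<comment> \<open>The two bounds add up along the geodesic; comparison with the path from
      \<open>\<psi> s\<close> to \<open>\<psi> t\<close> through \<open>b\<close> cancels the end
      terms and leaves twice the distance from \<open>\<psi> x\<close> to \<open>b\<close>, bounded
      by \<open>2 * C\<close>.\<close>
    from C[OF D3(2,3) this] C[OF D3(1,2)] x(3)
    have "kob (\<psi> s) b + kob (\<psi> x) b - C + (kob (\<psi> x) b + kob (\<psi> t) b - C) \<le> kob (\<psi> s) (\<psi> x) + kob (\<psi> x) (\<psi> t)"
      by linarith
    also have "\<dots> = kob (\<psi> s) (\<psi> t)"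
      using iso[OF st(1) xi] iso[OF xi st(2)] iso[OF st(1,2)] x(1,2) by linarith
    also have "\<dots> \<le> kob (\<psi> s) b + kob (\<psi> t) b"
      using kob_triangle[OF D3(1) b D3(3)] kob_commute[of b "\<psi> t"] by linarith
    finally have "kob b (\<psi> x) \<le> C"
      using kob_commute[of b "\<psi> x"] by linarith
    then have "\<psi> x \<in> core c"
      unfolding c_def by (intro mem_core D3 boundary_dist_lower[OF b D3(2)] order.refl)
    then show "\<psi> ` {l..u} \<inter> core c \<noteq> {}"
      using xi by blast
  qed
qed

end

theorem proposition5:
  fixes D :: "(complex ^ 'n) set"
  assumes "is_domain D" and "bounded D" and "convex D"
  shows "visible D \<longleftrightarrow>
    disc_free (frontier D) \<and> uniformly_equicontinuous_on unit_disc (centred_geodesics D)"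
proof -
  interpret bounded_convex_domain D
    using assms by unfold_locales (auto simp: is_domain_def)
  show ?thesis
    using visible_imp_disc_free visible_imp_equicontinuous equicontinuous_imp_visible by blast
qed

end
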